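(* The automorphism $\dot\Psi$ of $\dot{\mathbf{U}}[\mathbf{t}]$ induces an isomorphism of $\mathbb{Q}(\mathbf{t})$-algebras $\dot{\mathbf{U}}[\mathbf{t}]|_{\pi=1}\cong\dot{\mathbf{U}}[\mathbf{t}]|_{\pi=-1}$ and an isomorphism of $\mathbb{Z}[\mathbf{t}]$-algebras ${}_{\mathbb{Z}}\dot{\mathbf{U}}[\mathbf{t}]|_{\pi=1}\cong{}_{\mathbb{Z}}\dot{\mathbf{U}}[\mathbf{t}]|_{\pi=-1}$. In particular, we have embeddings $\dot{\mathbf{U}}|_{\pi=\pm1}\hookrightarrow\dot{\mathbf{U}}[\mathbf{t}]|_{\pi=\mp1}$ and ${}_{\mathbb{Z}}\dot{\mathbf{U}}|_{\pi=\pm1}\hookrightarrow{}_{\mathbb{Z}}\dot{\mathbf{U}}[\mathbf{t}]|_{\pi=\mp1}$.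
   Context: Datum. $(I,\cdot)$ is a bar-consistent super Cartan datum of anisotropic type: $I$ is a finite set with a $\mathbb{Z}$-valued symmetric bilinear form $\cdot$ on the free abelian group $\mathbb{Z}[I]$ such that $d_i=\frac{i\cdot i}{2}\in\mathbb{Z}_{>0}$ for all $i\in I$ and $a_{ij}=2\frac{i\cdot j}{i\cdot i}\in\mathbb{Z}_{\le 0}$ for $i\ne j$ (for $i=j$ the same formula gives $a_{ii}=2$); there is a partition $I=I_{\bar 0}\sqcup I_{\bar 1}$ with $I_{\bar1}\neq\emptyset$, with parity $p(i)=0$ for $i\in I_{\bar 0}$ and $p(i)=1$ for $i\in I_{\bar 1}$; $a_{ij}\in 2\mathbb{Z}$ for $i\in I_{\bar 1}$, $j\in I$; and $d_i\equiv p(i)\bmod 2$ for all $i$. Put $b_{ij}=1-a_{ij}$. Fix a total order $<$ on $I$. A super root datum $(Y,X,I,\cdot)$ is given: finitely generated free abelian groups $Y,X$ with a perfect bilinear pairing $\langle\cdot,\cdot\rangle:Y\times X\to\mathbb{Z}$, and embeddings $I\subset X$ ($i\mapsto i'$), $I\subset Y$ ($i\mapsto i$), with linearly independent images, such that $\langle i,j'\rangle=a_{ij}$ for all $i,j\in I$. Extend $i\mapsto i'$ linearly to $\mathbb{Z}[I]\hookrightarrow X$, $\mu\mapsto\mu'$. Scalars. $v$ is a formal parameter, $\pi$ an indeterminate with $\pi^2=1$; for a ring $R$, $R^\pi=R[\pi]/(\pi^2-1)$. $\mathbf{t}$ is a square root of $-1$. Put $v_i=v^{d_i}$, $\pi_i=\pi^{d_i}$,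 $[n]_{v,\pi}=\frac{(\pi v)^n-v^{-n}}{\pi v-v^{-1}}$ ($n\in\mathbb{Z}$), $[n]^!_{v,\pi}=\prod_{l=1}^n[l]_{v,\pi}$, $\begin{bmatrix}n\\k\end{bmatrix}_{v,\pi}=\frac{\prod_{l=n-k+1}^n((\pi v)^l-v^{-l})}{\prod_{l=1}^k((\pi v)^l-v^{-l})}$. For an $R^\pi$-module (or algebra) $M$, the specialization is $M|_{\pi=\pm1}=R_\pm\otimes_{R^\pi}M$, where $R_\pm=R$ with $\pi$ acting as $\pm1$. Modified covering quantum group. $\dot{\mathbf{U}}$ is the associative $\mathbb{Q}(v)^\pi$-algebra without unit generated by $1_\lambda,E_i1_\lambda,F_i1_\lambda$ ($\lambda\in X$, $i\in I$) subject to, for $i,j\in I$, $\lambda,\lambda'\in X$: $1_\lambda1_{\lambda'}=\delta_{\lambda,\lambda'}1_\lambda$; $(E_i1_\lambda)1_{\lambda'}=\delta_{\lambda,\lambda'}E_i1_\lambda$, $1_{\lambda'}(E_i1_\lambda)=\delta_{\lambda',\lambda+i'}E_i1_\lambda$; $(F_i1_\lambda)1_{\lambda'}=\delta_{\lambda,\lambda'}F_i1_\lambda$, $1_{\lambda'}(F_i1_\lambda)=\delta_{\lambda',\lambda-i'}F_i1_\lambda$; $(E_iF_j-\pi^{p(i)p(j)}F_jE_i)1_\lambda=\delta_{ij}[\langle i,\lambda\rangle]_{v_i,\pi_i}1_\lambda$; and for $i\ne j$, $\sum_{k=0}^{b_{ij}}(-1)^k\pi^{\binom k2p(i)+kp(i)p(j)}\begin{bmatrix}b_{ij}\\k\end{bmatrix}_{v_i,\pi_i}E_i^{b_{ij}-k}E_jE_i^k1_\lambda=0$,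 and the same relation with $F$ in place of $E$. Here products of $E$'s and $F$'s applied to $1_\lambda$ are read with the appropriate idempotents inserted, $xy1_\lambda=(x1_{\lambda+|y|})(y1_\lambda)$ with $|E_i|=i'$, $|F_i|=-i'$. Put $E_i^{(n)}1_\lambda=([n]^!_{v_i,\pi_i})^{-1}E_i^n1_\lambda$, and similarly $F_i^{(n)}1_\lambda$. ${}_{\mathbb{Z}}\dot{\mathbf{U}}$ is the $\mathbb{Z}[v^{\pm1}]^\pi$-subalgebra generated by $1_\lambda,E_i^{(n)}1_\lambda,F_i^{(n)}1_\lambda$ ($n\ge1$). Set $\dot{\mathbf{U}}[\mathbf{t}]=\mathbb{Q}(v,\mathbf{t})^\pi\otimes_{\mathbb{Q}(v)^\pi}\dot{\mathbf{U}}$ and ${}_{\mathbb{Z}}\dot{\mathbf{U}}[\mathbf{t}]=\mathbb{Z}[v^{\pm1},\mathbf{t}]^\pi\otimes_{\mathbb{Z}[v^{\pm1}]^\pi}{}_{\mathbb{Z}}\dot{\mathbf{U}}$. Twistor. Let $\phi:\mathbb{Z}[I]\times\mathbb{Z}[I]\to\mathbb{Z}$ be the bilinear form with $\phi(i,j)=d_ia_{ij}$ if $j<i$, $\phi(i,i)=d_i$, $\phi(i,j)=-2p(i)p(j)$ if $j>i$. Fix a transversal $C\subset X$ for $X/\mathbb{Z}[I]$, and define $\dot\phi:\mathbb{Z}[I]\times X\to\mathbb{Z}$ by $\dot\phi(\nu,\mu'+\lambda)=\phi(\nu,\mu)$ for $\nu,\mu\in\mathbb{Z}[I]$, $\lambda\in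 C$. $\dot\Psi$ is the $\mathbb{Q}(\mathbf{t})$-algebra automorphism of $\dot{\mathbf{U}}[\mathbf{t}]$ with $\dot\Psi(1_\lambda)=1_\lambda$, $\dot\Psi(E_i1_\lambda)=\mathbf{t}^{d_i\langle i,\lambda\rangle-\dot\phi(i,\lambda)}E_i1_\lambda$, $\dot\Psi(F_i1_\lambda)=\mathbf{t}^{\dot\phi(i,\lambda)}F_i1_\lambda$, $\dot\Psi(\pi)=-\pi$, $\dot\Psi(v)=\mathbf{t}^{-1}v$. *)

theory Defs
  imports
    "HOL-Library.Poly_Mapping"
    "HOL-Computational_Algebra.Computational_Algebra"
    "HOL-Computational_Algebra.Group_Closure"
begin

section \<open>Scalars\<close>

text \<open>\<open>Cov a b\<close> stands for \<open>a + b \<pi>\<close>, so that \<open>'a cov\<close> is \<open>R[\<pi>]/(\<pi>\<^sup>2 - 1)\<close>.\<close>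

datatype 'a cov = Cov (cov_re: 'a) (cov_pi: 'a)

instantiation cov :: (comm_ring_1) comm_ring_1
begin
definition "0 = Cov 0 0"
definition "1 = Cov 1 0"
definition "x + y = Cov (cov_re x + cov_re y) (cov_pi x + cov_pi y)"
definition "- x = Cov (- cov_re x) (- cov_pi x)"
definition "x - y = Cov (cov_re x - cov_re y) (cov_pi x - cov_pi y)"
definition "x * y = Cov (cov_re x * cov_re y + cov_pi x * cov_pi y)
                        (cov_re x * cov_pi y + cov_pi x * cov_re y)"
instance
  by standard
    (auto simp: zero_cov_def one_cov_def plus_cov_def uminus_cov_def minus_cov_def times_cov_def
      algebra_simps)
end

text \<open>
  Over a field, \<open>a + b \<pi>\<close> is a unit iff \<open>a\<^sup>2 \<noteq> b\<^sup>2\<close>, and then the following is its inverse;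
  otherwise the formula gives \<open>0\<close>. The syntactic class makes \<open>/\<close> and \<open>powi\<close> available.
\<close>

instantiation cov :: (field) inverse
begin
definition "inverse x = Cov (cov_re x / (cov_re x ^ 2 - cov_pi x ^ 2))
                            (- cov_pi x / (cov_re x ^ 2 - cov_pi x ^ 2))"
definition "x div y = x * inverse y" for x y :: "'a cov"
instance ..
end

lemma cov_inverse: "x * inverse x = 1" if "cov_re x ^ 2 \<noteq> cov_pi x ^ 2" for x :: "'a::field cov"
proof -
  have "cov_re x ^ 2 - cov_pi x ^ 2 \<noteq> 0" using that by simp
  then show ?thesis
    by (simp add: inverse_cov_def times_cov_def one_cov_def power2_eq_square divide_simps mult.commute)
qed

text \<open>\<open>Gau a b\<close> stands for \<open>a + b t\<close> with \<open>t\<^sup>2 = -1\<close>. Over an ordered field this is again a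
  field.\<close>

datatype 'a gau = Gau (gau_re: 'a) (gau_im: 'a)

instantiation gau :: (comm_ring_1) comm_ring_1
begin
definition "0 = Gau 0 0"
definition "1 = Gau 1 0"
definition "x + y = Gau (gau_re x + gau_re y) (gau_im x + gau_im y)"
definition "- x = Gau (- gau_re x) (- gau_im x)"
definition "x - y = Gau (gau_re x - gau_re y) (gau_im x - gau_im y)"
definition "x * y = Gau (gau_re x * gau_re y - gau_im x * gau_im y)
                        (gau_re x * gau_im y + gau_im x * gau_re y)"
instance
  by standard
    (auto simp: zero_gau_def one_gau_def plus_gau_def uminus_gau_def minus_gau_def times_gau_def
      algebra_simps)
end

instantiation gau :: (linordered_field) field
begin
definition "inverse x = Gau (gau_re x / (gau_re x ^ 2 + gau_im x ^ 2))
                            (- gau_im x / (gau_re x ^ 2 + gau_im x ^ 2))"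
definition "x div y = x * inverse y" for x y :: "'a gau"
instance
proof
  fix x y :: "'a gau"
  show "inverse x * x = 1" if "x \<noteq> 0"
  proof -
    have "gau_re x ^ 2 + gau_im x ^ 2 \<noteq> 0"
      using that by (cases x) (simp add: zero_gau_def sum_power2_eq_zero_iff)
    then show ?thesis
      by (simp add: inverse_gau_def times_gau_def one_gau_def power2_eq_square divide_simps
          mult.commute)
  qed
  show "x div y = x * inverse y" by (rule divide_gau_def)
  show "inverse (0 :: 'a gau) = 0" by (simp add: inverse_gau_def zero_gau_def)
qed
end

type_synonym Qv = "rat poly fract"
type_synonym Qvt = "Qv gau"

definition vv :: Qv where "vv = Fract [:0, 1:] 1"

definition ofQ :: "rat \<Rightarrow> Qv" where "ofQ q = Fract [:q:] 1"

text \<open>\<open>\<int>[v, v\<^sup>-\<^sup>1]\<close> inside \<open>\<rat>(v)\<close>.\<close>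
definition Zv :: "Qv set" where
  "Zv = {Fract (map_poly rat_of_int p) (monom 1 n) | p n. True}"

definition gau_ring :: "'a set \<Rightarrow> 'a gau set" where
  "gau_ring R = {Gau a b | a b. a \<in> R \<and> b \<in> R}"

definition cov_ring :: "'a set \<Rightarrow> 'a cov set" where
  "cov_ring R = {Cov a b | a b. a \<in> R \<and> b \<in> R}"

definition of_base :: "'a::zero \<Rightarrow> 'a gau" where "of_base a = Gau a 0"
definition cov_const :: "'a::zero \<Rightarrow> 'a cov" where "cov_const a = Cov a 0"

definition Qt :: "Qvt set" where "Qt = gau_ring (range ofQ)"
definition Zt :: "Qvt set" where "Zt = gau_ring (range of_int)"

definition ppi :: "'a::{zero,one} cov" where "ppi = Cov 0 1"

definition cov_eval :: "'a::comm_ring_1 \<Rightarrow> 'a cov \<Rightarrow> 'a" where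
  "cov_eval s x = cov_re x + s * cov_pi x"

text \<open>The elements \<open>v\<close> of \<open>\<rat>(v)\<^sup>\<pi>\<close>, and \<open>v\<close> and \<open>t\<close> of \<open>\<rat>(v,t)\<^sup>\<pi>\<close>.\<close>
definition vK :: "Qv cov" where "vK = cov_const vv"
definition vT :: "Qvt cov" where "vT = cov_const (of_base vv)"
definition tT :: "Qvt cov" where "tT = cov_const (Gau 0 1)"

definition qint :: "Qv cov \<Rightarrow> Qv cov \<Rightarrow> int \<Rightarrow> Qv cov" where
  "qint w p n = ((p * w) powi n - w powi (- n)) / (p * w - w powi (- 1))"

definition qfact :: "Qv cov \<Rightarrow> Qv cov \<Rightarrow> nat \<Rightarrow> Qv cov" where
  "qfact w p n = (\<Prod>l = 1..n. qint w p (int l))"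

definition qbinom :: "Qv cov \<Rightarrow> Qv cov \<Rightarrow> nat \<Rightarrow> nat \<Rightarrow> Qv cov" where
  "qbinom w p n k =
     (\<Prod>l = int n - int k + 1..int n. (p * w) powi l - w powi (- l)) /
     (\<Prod>l = 1..int k. (p * w) powi l - w powi (- l))"

section \<open>Super Cartan and root data\<close>

definition zscale :: "int \<Rightarrow> 'a::ab_group_add \<Rightarrow> 'a" where
  "zscale n x = (\<Sum>_<nat n. x) - (\<Sum>_<nat (- n). x)"

definition free_basis :: "'a::ab_group_add set \<Rightarrow> bool" where
  "free_basis B \<longleftrightarrow> finite B \<and>
     (\<forall>x. \<exists>!c. (\<forall>b. b \<notin> B \<longrightarrow> c b = 0) \<and> x = (\<Sum>b\<in>B. zscale (c b) b))"

text \<open>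
  \<open>I\<close> is the type \<open>'i\<close>, whose class \<open>linorder\<close> provides the fixed total order, and \<open>\<int>[I]\<close> is
  \<open>'i \<Rightarrow> int\<close>. The field \<open>form\<close> records the bilinear form on the basis \<open>I\<close>, \<open>odd_part\<close> is
  \<open>I\<^sub>1\<close> (with \<open>I\<^sub>0\<close> its complement), \<open>simple_root i\<close> is \<open>i'\<close> in \<open>X\<close>, and \<open>simple_coroot i\<close> is \<open>i\<close> in \<open>Y\<close>.
\<close>

record ('i, 'x, 'y) root_datum =
  form :: "'i \<Rightarrow> 'i \<Rightarrow> int"
  odd_part :: "'i set"
  pairing :: "'y \<Rightarrow> 'x \<Rightarrow> int"
  simple_root :: "'i \<Rightarrow> 'x"
  simple_coroot :: "'i \<Rightarrow> 'y"

definition dd :: "('i, 'x, 'y) root_datum \<Rightarrow> 'i \<Rightarrow> int" where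
  "dd D i = form D i i div 2"

definition aa :: "('i, 'x, 'y) root_datum \<Rightarrow> 'i \<Rightarrow> 'i \<Rightarrow> int" where
  "aa D i j = 2 * form D i j div form D i i"

definition par :: "('i, 'x, 'y) root_datum \<Rightarrow> 'i \<Rightarrow> nat" where
  "par D i = (if i \<in> odd_part D then 1 else 0)"

definition bb :: "('i, 'x, 'y) root_datum \<Rightarrow> 'i \<Rightarrow> 'i \<Rightarrow> nat" where
  "bb D i j = nat (1 - aa D i j)"

definition zcomb :: "('i::finite \<Rightarrow> 'x::ab_group_add) \<Rightarrow> ('i \<Rightarrow> int) \<Rightarrow> 'x" where
  "zcomb r \<mu> = (\<Sum>i\<in>UNIV. zscale (\<mu> i) (r i))"

definition super_cartan_datum :: "('i::finite, 'x, 'y) root_datum \<Rightarrow> bool" where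
  "super_cartan_datum D \<longleftrightarrow>
     (\<forall>i j. form D i j = form D j i) \<and>
     (\<forall>i. even (form D i i) \<and> dd D i > 0) \<and>
     (\<forall>i j. i \<noteq> j \<longrightarrow> form D i i dvd 2 * form D i j \<and> aa D i j \<le> 0) \<and>
     odd_part D \<noteq> {} \<and>
     (\<forall>i \<in> odd_part D. \<forall>j. even (aa D i j)) \<and>
     (\<forall>i. dd D i mod 2 = int (par D i) mod 2)"

definition super_root_datum ::
    "('i::finite, 'x::ab_group_add, 'y::ab_group_add) root_datum \<Rightarrow> bool" where
  "super_root_datum D \<longleftrightarrow>
     super_cartan_datum D \<and>
     (\<exists>B :: 'x set. free_basis B) \<and> (\<exists>B :: 'y set. free_basis B) \<and>
     bij_betw (\<lambda>y. pairing D y) UNIV {f. additive f} \<and>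
     bij_betw (\<lambda>x y. pairing D y x) UNIV {f. additive f} \<and>
     inj (zcomb (simple_root D)) \<and> inj (zcomb (simple_coroot D)) \<and>
     (\<forall>i j. pairing D (simple_coroot D i) (simple_root D j) = aa D i j)"

definition transversal :: "('i::finite, 'x::ab_group_add, 'y) root_datum \<Rightarrow> 'x set \<Rightarrow> bool" where
  "transversal D C \<longleftrightarrow> (\<forall>x. \<exists>!c. c \<in> C \<and> x - c \<in> range (zcomb (simple_root D)))"

section \<open>Algebras without unit\<close>

record ('k, 'a) nalg =
  scal :: "'k set"
  car :: "'a set"
  add :: "'a \<Rightarrow> 'a \<Rightarrow> 'a"
  mul :: "'a \<Rightarrow> 'a \<Rightarrow> 'a"
  smul :: "'k \<Rightarrow> 'a \<Rightarrow> 'a"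

text \<open>Homomorphisms linear over a common subring \<open>R\<close> of the scalars; \<open>j\<close> is its inclusion into
  the scalars of the target.\<close>

definition alg_hom ::
    "'k set \<Rightarrow> ('k \<Rightarrow> 'l) \<Rightarrow> ('k, 'a) nalg \<Rightarrow> ('l, 'b) nalg \<Rightarrow> ('a \<Rightarrow> 'b) \<Rightarrow> bool" where
  "alg_hom R j A B f \<longleftrightarrow>
     (\<forall>x\<in>car A. f x \<in> car B) \<and>
     (\<forall>x\<in>car A. \<forall>y\<in>car A. f (add A x y) = add B (f x) (f y)) \<and>
     (\<forall>x\<in>car A. \<forall>y\<in>car A. f (mul A x y) = mul B (f x) (f y)) \<and>
     (\<forall>c\<in>R. \<forall>x\<in>car A. f (smul A c x) = smul B (j c) (f x))"

definition alg_iso :: "'k set \<Rightarrow> ('k, 'a) nalg \<Rightarrow> ('k, 'b) nalg \<Rightarrow> ('a \<Rightarrow> 'b) \<Rightarrow> bool" where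
  "alg_iso R A B f \<longleftrightarrow> alg_hom R (\<lambda>c. c) A B f \<and> bij_betw f (car A) (car B)"

definition alg_emb ::
    "'k set \<Rightarrow> ('k \<Rightarrow> 'l) \<Rightarrow> ('k, 'a) nalg \<Rightarrow> ('l, 'b) nalg \<Rightarrow> ('a \<Rightarrow> 'b) \<Rightarrow> bool" where
  "alg_emb R j A B f \<longleftrightarrow> alg_hom R j A B f \<and> inj_on f (car A)"

text \<open>Cosets of an additive subgroup \<open>N\<close> and the operations they inherit.\<close>

definition acoset :: "'a::ab_group_add set \<Rightarrow> 'a \<Rightarrow> 'a set" where
  "acoset N x = {y. y - x \<in> N}"

definition acoset_lift :: "'b::ab_group_add set \<Rightarrow> ('a \<Rightarrow> 'b) \<Rightarrow> 'a set \<Rightarrow> 'b set" where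
  "acoset_lift N f A = (\<Union>x\<in>A. acoset N (f x))"

definition acoset_lift2 ::
    "'a::ab_group_add set \<Rightarrow> ('a \<Rightarrow> 'a \<Rightarrow> 'a) \<Rightarrow> 'a set \<Rightarrow> 'a set \<Rightarrow> 'a set" where
  "acoset_lift2 N f A B = (\<Union>x\<in>A. \<Union>y\<in>B. acoset N (f x y))"

section \<open>Extension of scalars\<close>

text \<open>
  For a ring \<open>T\<close>, a ring homomorphism \<open>f\<close> from \<open>S = scal M\<close> to \<open>T\<close>, and an \<open>S\<close>-algebra \<open>M\<close>, the
  tensor product of \<open>T\<close> and \<open>M\<close> over \<open>S\<close> is the free abelian group on \<open>T \<times> M\<close> modulo the
  subgroup \<open>tens_rel T f M\<close>.
\<close>

definition tens_rel ::
    "'t::comm_ring_1 set \<Rightarrow> ('s \<Rightarrow> 't) \<Rightarrow> ('s, 'm) nalg \<Rightarrow> ('t \<times> 'm \<Rightarrow>\<^sub>0 int) set" where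
  "tens_rel T f M = group_closure
     ({frag_of (a + b, m) - frag_of (a, m) - frag_of (b, m) | a b m.
         a \<in> T \<and> b \<in> T \<and> m \<in> car M} \<union>
      {frag_of (a, add M m n) - frag_of (a, m) - frag_of (a, n) | a m n.
         a \<in> T \<and> m \<in> car M \<and> n \<in> car M} \<union>
      {frag_of (a * f s, m) - frag_of (a, smul M s m) | a s m.
         a \<in> T \<and> s \<in> scal M \<and> m \<in> car M})"

definition tens ::
    "'t::comm_ring_1 set \<Rightarrow> ('s \<Rightarrow> 't) \<Rightarrow> ('s, 'm) nalg \<Rightarrow> 't \<Rightarrow> 'm \<Rightarrow> ('t \<times> 'm \<Rightarrow>\<^sub>0 int) set" where
  "tens T f M a m = acoset (tens_rel T f M) (frag_of (a, m))"

definition tens_mul ::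
    "('s, 'm) nalg \<Rightarrow> ('t::comm_ring_1 \<times> 'm \<Rightarrow>\<^sub>0 int) \<Rightarrow> ('t \<times> 'm \<Rightarrow>\<^sub>0 int) \<Rightarrow> ('t \<times> 'm \<Rightarrow>\<^sub>0 int)" where
  "tens_mul M x y =
     frag_extend (\<lambda>(a, m). frag_extend (\<lambda>(b, n). frag_of (a * b, mul M m n)) y) x"

definition tens_smul :: "'t::comm_ring_1 \<Rightarrow> ('t \<times> 'm \<Rightarrow>\<^sub>0 int) \<Rightarrow> ('t \<times> 'm \<Rightarrow>\<^sub>0 int)" where
  "tens_smul c x = frag_extend (\<lambda>(a, m). frag_of (c * a, m)) x"

definition base_change ::
    "'t::comm_ring_1 set \<Rightarrow> ('s \<Rightarrow> 't) \<Rightarrow> ('s, 'm) nalg \<Rightarrow> ('t, ('t \<times> 'm \<Rightarrow>\<^sub>0 int) set) nalg" where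
  "base_change T f M =
     \<lparr>scal = T,
      car = {acoset (tens_rel T f M) x | x. Poly_Mapping.keys x \<subseteq> T \<times> car M},
      add = acoset_lift2 (tens_rel T f M) (+),
      mul = acoset_lift2 (tens_rel T f M) (tens_mul M),
      smul = (\<lambda>c. acoset_lift (tens_rel T f M) (tens_smul c))\<rparr>"

text \<open>
  For an algebra \<open>M\<close> over \<open>R\<^sup>\<pi>\<close>, \<open>spec s M\<close> with \<open>s = \<plusminus>1\<close> is the specialization at \<open>\<pi> = s\<close>, and
  \<open>spec_el s M m\<close> is the image of \<open>m\<close> in it.
\<close>

definition pi_free :: "('s::zero cov, 'm) nalg \<Rightarrow> 's set" where
  "pi_free M = {a. cov_const a \<in> scal M}"

definition spec ::
    "'s::comm_ring_1 \<Rightarrow> ('s cov, 'm) nalg \<Rightarrow> ('s, ('s \<times> 'm \<Rightarrow>\<^sub>0 int) set) nalg" where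
  "spec s M = base_change (pi_free M) (cov_eval s) M"

definition spec_el ::
    "'s::comm_ring_1 \<Rightarrow> ('s cov, 'm) nalg \<Rightarrow> 'm \<Rightarrow> ('s \<times> 'm \<Rightarrow>\<^sub>0 int) set" where
  "spec_el s M m = tens (pi_free M) (cov_eval s) M 1 m"

text \<open>For an algebra \<open>M\<close> over \<open>R\<^sup>\<pi>\<close>, \<open>adj_t M\<close> is its extension of scalars to \<open>R[t]\<^sup>\<pi>\<close>.\<close>

definition adj_t ::
    "('s::comm_ring_1 cov, 'm) nalg \<Rightarrow> ('s gau cov, ('s gau cov \<times> 'm \<Rightarrow>\<^sub>0 int) set) nalg" where
  "adj_t M = base_change (cov_ring (gau_ring (pi_free M))) (map_cov of_base) M"

definition adj_t_el ::
    "('s::comm_ring_1 cov, 'm) nalg \<Rightarrow> 'm \<Rightarrow> ('s gau cov \<times> 'm \<Rightarrow>\<^sub>0 int) set" where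
  "adj_t_el M m = tens (cov_ring (gau_ring (pi_free M))) (map_cov of_base) M 1 m"

text \<open>The map \<open>adj_t L \<rightarrow> adj_t M\<close> induced by the inclusion of a subalgebra \<open>L\<close> (over a subring
  of the scalars) into \<open>M\<close>.\<close>

definition adj_t_incl ::
    "('s::comm_ring_1 cov, 'm) nalg \<Rightarrow> ('s gau cov \<times> 'm \<Rightarrow>\<^sub>0 int) set
       \<Rightarrow> ('s gau cov \<times> 'm \<Rightarrow>\<^sub>0 int) set" where
  "adj_t_incl M =
     acoset_lift (tens_rel (cov_ring (gau_ring (pi_free M))) (map_cov of_base) M) (\<lambda>x. x)"

section \<open>The modified covering quantum group\<close>

datatype 'i letter = E 'i | F 'i

text \<open>\<open>Gen (E i) \<lambda>\<close> and \<open>Gen (F i) \<lambda>\<close> are the generators \<open>E\<^sub>i 1\<^sub>\<lambda>\<close> and \<open>F\<^sub>i 1\<^sub>\<lambda>\<close>.\<close>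
datatype ('i, 'x) gen = Idem 'x | Gen "'i letter" 'x

datatype 'g word = Word "'g list"

instantiation word :: (type) monoid_add
begin
definition "0 = Word []"
definition "x + y = (case x of Word a \<Rightarrow> case y of Word b \<Rightarrow> Word (a @ b))"
instance
  by standard (auto simp: zero_word_def plus_word_def split: word.splits)
end

text \<open>
  The monoid algebra of words is the free unital algebra; the elements whose coefficient at the
  empty word \<open>0\<close> vanishes form the free algebra without unit.
\<close>

type_synonym ('i, 'x) freealg = "('i, 'x) gen word \<Rightarrow>\<^sub>0 Qv cov"

definition gen :: "('i, 'x) gen \<Rightarrow> ('i, 'x) freealg" where
  "gen g = Poly_Mapping.single (Word [g]) 1"

definition sc :: "Qv cov \<Rightarrow> ('i, 'x) freealg" where
  "sc c = Poly_Mapping.single 0 c"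

fun wt :: "('i, 'x::ab_group_add, 'y) root_datum \<Rightarrow> 'i letter \<Rightarrow> 'x" where
  "wt D (E i) = simple_root D i"
| "wt D (F i) = - simple_root D i"

text \<open>\<open>mon D [x\<^sub>1, \<dots>, x\<^sub>n] \<lambda>\<close> is \<open>x\<^sub>1 \<dots> x\<^sub>n 1\<^sub>\<lambda>\<close> with the idempotents inserted.\<close>
fun mon :: "('i, 'x::ab_group_add, 'y) root_datum \<Rightarrow> 'i letter list \<Rightarrow> 'x \<Rightarrow> ('i, 'x) freealg" where
  "mon D [] l = gen (Idem l)"
| "mon D (x # w) l = gen (Gen x (l + sum_list (map (wt D) w))) * mon D w l"

definition vi :: "('i, 'x, 'y) root_datum \<Rightarrow> 'i \<Rightarrow> Qv cov" where
  "vi D i = vK powi dd D i"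

definition ppii :: "('i, 'x, 'y) root_datum \<Rightarrow> 'i \<Rightarrow> Qv cov" where
  "ppii D i = ppi powi dd D i"

inductive_set rels :: "('i, 'x::ab_group_add, 'y) root_datum \<Rightarrow> ('i, 'x) freealg set"
  for D where
  idem: "gen (Idem l) * gen (Idem l') - (if l = l' then gen (Idem l) else 0) \<in> rels D"
| right: "gen (Gen x l) * gen (Idem l') - (if l = l' then gen (Gen x l) else 0) \<in> rels D"
| left: "gen (Idem l') * gen (Gen x l) - (if l' = l + wt D x then gen (Gen x l) else 0) \<in> rels D"
| EF: "mon D [E i, F j] l - sc (ppi ^ (par D i * par D j)) * mon D [F j, E i] l
        - (if i = j then sc (qint (vi D i) (ppii D i) (pairing D (simple_coroot D i) l)) * gen (Idem l)
           else 0) \<in> rels D"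
| serre: "i \<noteq> j \<Longrightarrow> X \<in> {E, F} \<Longrightarrow>
    (\<Sum>k\<le>bb D i j.
       sc ((- 1) ^ k * ppi ^ ((k choose 2) * par D i + k * par D i * par D j) *
           qbinom (vi D i) (ppii D i) (bb D i j) k) *
       mon D (replicate (bb D i j - k) (X i) @ [X j] @ replicate k (X i)) l) \<in> rels D"

definition relideal :: "('i, 'x::ab_group_add, 'y) root_datum \<Rightarrow> ('i, 'x) freealg set" where
  "relideal D = group_closure {p * r * q | p r q. r \<in> rels D}"

definition dotU ::
    "('i, 'x::ab_group_add, 'y) root_datum \<Rightarrow> (Qv cov, ('i, 'x) freealg set) nalg" where
  "dotU D =
     \<lparr>scal = UNIV,
      car = {acoset (relideal D) p | p. Poly_Mapping.lookup p 0 = 0},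
      add = acoset_lift2 (relideal D) (+),
      mul = acoset_lift2 (relideal D) (*),
      smul = (\<lambda>c. acoset_lift (relideal D) (\<lambda>p. sc c * p))\<rparr>"

definition dotU_one :: "('i, 'x::ab_group_add, 'y) root_datum \<Rightarrow> 'x \<Rightarrow> ('i, 'x) freealg set" where
  "dotU_one D l = acoset (relideal D) (gen (Idem l))"

definition dotU_gen ::
    "('i, 'x::ab_group_add, 'y) root_datum \<Rightarrow> 'i letter \<Rightarrow> 'x \<Rightarrow> ('i, 'x) freealg set" where
  "dotU_gen D x l = acoset (relideal D) (gen (Gen x l))"

definition divpow ::
    "('i, 'x::ab_group_add, 'y) root_datum \<Rightarrow> ('i \<Rightarrow> 'i letter) \<Rightarrow> 'i \<Rightarrow> nat \<Rightarrow> 'x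
       \<Rightarrow> ('i, 'x) freealg set" where
  "divpow D X i n l =
     acoset (relideal D) (sc (inverse (qfact (vi D i) (ppii D i) n)) * mon D (replicate n (X i)) l)"

inductive_set intform ::
    "('i, 'x::ab_group_add, 'y) root_datum \<Rightarrow> ('i, 'x) freealg set set" for D where
  "dotU_one D l \<in> intform D"
| "n \<ge> 1 \<Longrightarrow> X \<in> {E, F} \<Longrightarrow> divpow D X i n l \<in> intform D"
| "x \<in> intform D \<Longrightarrow> y \<in> intform D \<Longrightarrow> add (dotU D) x y \<in> intform D"
| "x \<in> intform D \<Longrightarrow> y \<in> intform D \<Longrightarrow> mul (dotU D) x y \<in> intform D"
| "c \<in> cov_ring Zv \<Longrightarrow> x \<in> intform D \<Longrightarrow> smul (dotU D) c x \<in> intform D"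

definition ZdotU ::
    "('i, 'x::ab_group_add, 'y) root_datum \<Rightarrow> (Qv cov, ('i, 'x) freealg set) nalg" where
  "ZdotU D = dotU D \<lparr>scal := cov_ring Zv, car := intform D\<rparr>"

section \<open>The twistor\<close>

definition phi :: "('i::{finite,linorder}, 'x, 'y) root_datum \<Rightarrow> ('i \<Rightarrow> int) \<Rightarrow> ('i \<Rightarrow> int) \<Rightarrow> int" where
  "phi D \<nu> \<mu> = (\<Sum>i\<in>UNIV. \<Sum>j\<in>UNIV. \<nu> i * \<mu> j *
     (if j < i then dd D i * aa D i j
      else if j = i then dd D i
      else - 2 * int (par D i) * int (par D j)))"

definition dotphi ::
    "('i::{finite,linorder}, 'x::ab_group_add, 'y) root_datum \<Rightarrow> 'x set \<Rightarrow> ('i \<Rightarrow> int) \<Rightarrow> 'x \<Rightarrow> int" where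
  "dotphi D C \<nu> x = phi D \<nu> (THE \<mu>. x - zcomb (simple_root D) \<mu> \<in> C)"

definition unitv :: "'i \<Rightarrow> 'i \<Rightarrow> int" where
  "unitv i = (\<lambda>j. if j = i then 1 else 0)"

text \<open>The conditions on \<open>\<Psi>(\<pi>)\<close> and \<open>\<Psi>(v)\<close> are read on scalar multiples, the algebra having no
  unit.\<close>

definition is_twistor ::
    "('i::{finite,linorder}, 'x::ab_group_add, 'y) root_datum \<Rightarrow> 'x set
      \<Rightarrow> ((Qvt cov \<times> ('i, 'x) freealg set \<Rightarrow>\<^sub>0 int) set
            \<Rightarrow> (Qvt cov \<times> ('i, 'x) freealg set \<Rightarrow>\<^sub>0 int) set) \<Rightarrow> bool" where
  "is_twistor D C \<Psi> \<longleftrightarrow>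
     (let U = dotU D; Ut = adj_t U in
       alg_iso (cov_const ` Qt) Ut Ut \<Psi> \<and>
       (\<forall>l. \<Psi> (adj_t_el U (dotU_one D l)) = adj_t_el U (dotU_one D l)) \<and>
       (\<forall>i l. \<Psi> (adj_t_el U (dotU_gen D (E i) l)) =
          smul Ut (tT powi (dd D i * pairing D (simple_coroot D i) l - dotphi D C (unitv i) l))
            (adj_t_el U (dotU_gen D (E i) l))) \<and>
       (\<forall>i l. \<Psi> (adj_t_el U (dotU_gen D (F i) l)) =
          smul Ut (tT powi dotphi D C (unitv i) l) (adj_t_el U (dotU_gen D (F i) l))) \<and>
       (\<forall>x\<in>car Ut. \<Psi> (smul Ut ppi x) = smul Ut (- ppi) (\<Psi> x)) \<and>
       (\<forall>x\<in>car Ut. \<Psi> (smul Ut vT x) = smul Ut (tT powi (- 1) * vT) (\<Psi> x)))"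

text \<open>The conditions determine \<open>\<Psi>\<close> on the carrier; its values elsewhere are irrelevant.\<close>

definition twistor ::
    "('i::{finite,linorder}, 'x::ab_group_add, 'y) root_datum \<Rightarrow> 'x set
      \<Rightarrow> (Qvt cov \<times> ('i, 'x) freealg set \<Rightarrow>\<^sub>0 int) set
            \<Rightarrow> (Qvt cov \<times> ('i, 'x) freealg set \<Rightarrow>\<^sub>0 int) set" where
  "twistor D C = (SOME \<Psi>. is_twistor D C \<Psi>)"

end

theory Submission
  imports Defs "HOL-Algebra.Free_Abelian_Groups"
begin

text \<open>
  The twistor is diagonal in the generators: on a word in the \<open>E\<^sub>i 1\<^sub>\<lambda>\<close>,
  \<open>F\<^sub>i 1\<^sub>\<lambda>\<close>, \<open>1\<^sub>\<lambda>\<close> it acts by a power of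
  \<open>t\<close> whose exponent is additive in the letters, and on coefficients by the ring automorphism
  \<open>v \<mapsto> t\<^sup>-\<^sup>1 v\<close>, \<open>\<pi> \<mapsto> - \<pi>\<close>. On the free
  algebra over \<open>\<rat>(v,t)\<^sup>\<pi>\<close> this semilinear map (\<open>twist_alg\<close>) always
  exists and has order dividing 4. It descends to the algebra because every defining relation is
  homogeneous: all its terms are multiplied by the same power of \<open>t\<close>
  (\<open>rels_homog\<close>). For scalars this homogeneity is formal. Both \<open>v\<close> and
  \<open>\<pi>\<close> are homogeneous, hence so are quantum integers and quantum binomials with all their
  quotients, and only degrees modulo 4 have to be compared. For words the comparison comes down to one
  congruence, \<open>\<phi>(i,j) - \<phi>(j,i) \<equiv> d\<^sub>i a\<^sub>i\<^sub>j + 2 p(i) p(j)\<close>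
  modulo 4 (\<open>phi_entry_skew\<close>), together with \<open>d\<^sub>i \<equiv> p(i)\<close> modulo 2.

  The algebra with \<open>t\<close> adjoined is a tensor product. Its elements are uniquely \<open>m + t
  n\<close> with \<open>m\<close>, \<open>n\<close> in the original algebra (\<open>gpair_surj\<close>,
  \<open>gpair_inject\<close>). This has two uses. It identifies \<open>U[t]\<close> with the free algebra
  over \<open>\<rat>(v,t)\<^sup>\<pi>\<close> modulo the elements whose two components lie in the relation
  ideal (\<open>present_eq_iff\<close>), so that the diagonal map descends to the twistor. It also shows
  that the integral form with \<open>t\<close> adjoined embeds into \<open>U[t]\<close>. Since divided
  powers are homogeneous, the twistor preserves its image, and since its fourth power is the identity, it
  restricts to a bijection of that image.

  A specialization \<open>\<pi> = s\<close> is the quotient by the multiples of \<open>\<pi> - s\<close>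
  (\<open>spec_el_eq_iff\<close>). A bijection that negates \<open>\<pi>\<close> carries the multiples of
  \<open>\<pi> - 1\<close> onto those of \<open>\<pi> + 1\<close>, and thus induces an isomorphism between
  the two specializations (\<open>spec_twist\<close>), rationally and integrally alike. Finally \<open>m
  \<mapsto> m + t 0\<close> stays injective modulo \<open>\<pi> - s\<close>, because divisibility by
  \<open>\<pi> - s\<close> can be read off from the two components (\<open>spec_adj_t_embedding\<close>).
  Composing it with the isomorphism or its inverse gives the four embeddings.

  The twistor is only given as some map with the stated values on generators. It is pinned down on the whole
  carrier (\<open>twistor_present\<close>): the prescribed behaviour on \<open>\<rat>(t)\<close>,
  \<open>\<pi>\<close> and \<open>v\<close> forces its semilinearity over the full ring of scalars, and nonempty words in the
  generators span.
\<close>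

section \<open>Algebras without unit over a ring of scalars\<close>

text \<open>
  The operations carry no zero; multiplying any element by the scalar \<open>0\<close> recovers it.
\<close>
definition nzero :: "('k::comm_ring_1, 'a) nalg \<Rightarrow> 'a" where
  "nzero M = smul M 0 (SOME x. x \<in> car M)"

text \<open>
  The axiom \<open>smul_zero_eq\<close> supplies both the zero and, through the scalar \<open>- 1\<close>,
  the negatives.
\<close>
locale nalgebra =
  fixes M :: "('k::comm_ring_1, 'a) nalg"
  assumes scal_one: "1 \<in> scal M"
    and scal_diff: "c \<in> scal M \<Longrightarrow> d \<in> scal M \<Longrightarrow> c - d \<in> scal M"
    and scal_mult: "c \<in> scal M \<Longrightarrow> d \<in> scal M \<Longrightarrow> c * d \<in> scal M"
    and car_nonempty: "car M \<noteq> {}"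
    and add_closed: "x \<in> car M \<Longrightarrow> y \<in> car M \<Longrightarrow> add M x y \<in> car M"
    and add_assoc: "x \<in> car M \<Longrightarrow> y \<in> car M \<Longrightarrow> z \<in> car M \<Longrightarrow>
          add M (add M x y) z = add M x (add M y z)"
    and add_comm: "x \<in> car M \<Longrightarrow> y \<in> car M \<Longrightarrow> add M x y = add M y x"
    and smul_closed: "c \<in> scal M \<Longrightarrow> x \<in> car M \<Longrightarrow> smul M c x \<in> car M"
    and smul_add_left: "c \<in> scal M \<Longrightarrow> d \<in> scal M \<Longrightarrow> x \<in> car M \<Longrightarrow>
          smul M (c + d) x = add M (smul M c x) (smul M d x)"
    and smul_add_right: "c \<in> scal M \<Longrightarrow> x \<in> car M \<Longrightarrow> y \<in> car M \<Longrightarrow>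
          smul M c (add M x y) = add M (smul M c x) (smul M c y)"
    and smul_smul: "c \<in> scal M \<Longrightarrow> d \<in> scal M \<Longrightarrow> x \<in> car M \<Longrightarrow>
          smul M c (smul M d x) = smul M (c * d) x"
    and smul_one: "x \<in> car M \<Longrightarrow> smul M 1 x = x"
    and smul_zero_eq: "x \<in> car M \<Longrightarrow> y \<in> car M \<Longrightarrow> smul M 0 x = smul M 0 y"
    and mul_closed: "x \<in> car M \<Longrightarrow> y \<in> car M \<Longrightarrow> mul M x y \<in> car M"
    and mul_add_left: "x \<in> car M \<Longrightarrow> y \<in> car M \<Longrightarrow> z \<in> car M \<Longrightarrow>
          mul M (add M x y) z = add M (mul M x z) (mul M y z)"
    and mul_add_right: "x \<in> car M \<Longrightarrow> y \<in> car M \<Longrightarrow> z \<in> car M \<Longrightarrow>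
          mul M x (add M y z) = add M (mul M x y) (mul M x z)"
    and mul_smul_left: "c \<in> scal M \<Longrightarrow> x \<in> car M \<Longrightarrow> y \<in> car M \<Longrightarrow>
          mul M (smul M c x) y = smul M c (mul M x y)"
    and mul_smul_right: "c \<in> scal M \<Longrightarrow> x \<in> car M \<Longrightarrow> y \<in> car M \<Longrightarrow>
          mul M x (smul M c y) = smul M c (mul M x y)"
begin

lemma scal_zero: "0 \<in> scal M"
  using scal_diff[OF scal_one scal_one] by simp

lemma scal_uminus: "c \<in> scal M \<Longrightarrow> - c \<in> scal M"
  using scal_diff[OF scal_zero, of c] by simp

lemma scal_add: "c \<in> scal M \<Longrightarrow> d \<in> scal M \<Longrightarrow> c + d \<in> scal M"
  using scal_diff[of c "- d"] scal_uminus[of d] by simp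

lemma smul_zero: "x \<in> car M \<Longrightarrow> smul M 0 x = nzero M"
  unfolding nzero_def using car_nonempty by (intro smul_zero_eq) (auto intro: someI)

lemma nzero_closed: "nzero M \<in> car M"
  using car_nonempty smul_zero smul_closed[OF scal_zero] by (metis all_not_in_conv)

lemma smul_nzero: "c \<in> scal M \<Longrightarrow> smul M c (nzero M) = nzero M"
  by (metis mult_zero_right nzero_closed scal_zero smul_smul smul_zero)

lemma add_nzero: "x \<in> car M \<Longrightarrow> add M x (nzero M) = x"
  by (metis add.right_neutral scal_one scal_zero smul_add_left smul_one smul_zero)

lemma nzero_add: "x \<in> car M \<Longrightarrow> add M (nzero M) x = x"
  by (simp add: add_comm add_nzero nzero_closed)

lemma neg_closed: "x \<in> car M \<Longrightarrow> smul M (- 1) x \<in> car M"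
  by (simp add: scal_one scal_uminus smul_closed)

lemma add_neg: "x \<in> car M \<Longrightarrow> add M x (smul M (- 1) x) = nzero M"
  by (metis add.right_inverse scal_one scal_uminus smul_add_left smul_one smul_zero)

lemma add_left_comm: "x \<in> car M \<Longrightarrow> y \<in> car M \<Longrightarrow> z \<in> car M \<Longrightarrow>
    add M x (add M y z) = add M y (add M x z)"
  by (metis add_assoc add_comm)

lemma eq_add_negD: "x \<in> car M \<Longrightarrow> y \<in> car M \<Longrightarrow> add M x (smul M (- 1) y) = z \<Longrightarrow> x = add M y z"
  by (metis add_assoc add_comm add_neg add_nzero neg_closed)

text \<open>
  The additive group in the form in which the universal property of free abelian groups applies to it.
\<close>
definition agrp :: "'a monoid" where
  "agrp = \<lparr>carrier = car M, monoid.mult = add M, one = nzero M\<rparr>"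

lemma agrp_comm_group: "comm_group agrp"
proof (rule comm_groupI)
  fix x assume "x \<in> carrier agrp"
  then show "\<exists>y\<in>carrier agrp. y \<otimes>\<^bsub>agrp\<^esub> x = \<one>\<^bsub>agrp\<^esub>"
    by (intro bexI[of _ "smul M (- 1) x"]) (auto simp: agrp_def neg_closed add_neg add_comm)
next
  fix x y z assume "x \<in> carrier agrp" "y \<in> carrier agrp" "z \<in> carrier agrp"
  then show "x \<otimes>\<^bsub>agrp\<^esub> y \<otimes>\<^bsub>agrp\<^esub> z = x \<otimes>\<^bsub>agrp\<^esub> (y \<otimes>\<^bsub>agrp\<^esub> z)"
    by (simp add: agrp_def add_assoc)
qed (auto simp: agrp_def add_closed nzero_closed nzero_add intro: add_comm)

end

section \<open>Operations on cosets\<close>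

definition add_subgroup :: "'a::ab_group_add set \<Rightarrow> bool" where
  "add_subgroup N \<longleftrightarrow> 0 \<in> N \<and> (\<forall>x\<in>N. \<forall>y\<in>N. x - y \<in> N)"

lemma add_subgroup_group_closure: "add_subgroup (group_closure S)"
  by (auto simp: add_subgroup_def intro: group_closure.diff)

lemma add_subgroupD:
  assumes "add_subgroup N"
  shows "0 \<in> N" "x \<in> N \<Longrightarrow> y \<in> N \<Longrightarrow> x - y \<in> N" "x \<in> N \<Longrightarrow> - x \<in> N" "x \<in> N \<Longrightarrow> y \<in> N \<Longrightarrow> x + y \<in> N"
proof -
  show 0: "0 \<in> N" and diff: "x \<in> N \<Longrightarrow> y \<in> N \<Longrightarrow> x - y \<in> N" for x y
    using assms by (auto simp: add_subgroup_def)
  show minus: "x \<in> N \<Longrightarrow> - x \<in> N" for x using diff[OF 0] by fastforce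
  show "x \<in> N \<Longrightarrow> y \<in> N \<Longrightarrow> x + y \<in> N" using diff[OF _ minus] by fastforce
qed

lemma acoset_eq_iff:
  assumes "add_subgroup N"
  shows "acoset N x = acoset N y \<longleftrightarrow> x - y \<in> N"
proof
  assume "acoset N x = acoset N y"
  moreover have "x \<in> acoset N x" by (simp add: acoset_def add_subgroupD[OF assms])
  ultimately have "x \<in> acoset N y" by blast
  then show "x - y \<in> N" by (simp add: acoset_def)
next
  assume xy: "x - y \<in> N"
  have "z - x \<in> N \<longleftrightarrow> z - y \<in> N" for z
    using add_subgroupD(4)[OF assms _ xy, of "z - x"] add_subgroupD(2)[OF assms _ xy, of "z - y"]
    by (auto simp: algebra_simps)
  then show "acoset N x = acoset N y" by (auto simp: acoset_def)
qed

lemma mem_acoset: "y \<in> acoset N x \<longleftrightarrow> y - x \<in> N"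
  by (simp add: acoset_def)

lemma acoset_lift_acoset:
  assumes "add_subgroup N" "add_subgroup N'" "\<And>y. y - x \<in> N' \<Longrightarrow> f y - f x \<in> N"
  shows "acoset_lift N f (acoset N' x) = acoset N (f x)"
proof -
  have "acoset N (f y) = acoset N (f x)" if "y \<in> acoset N' x" for y
    using that assms by (simp add: acoset_eq_iff mem_acoset)
  moreover have "x \<in> acoset N' x" by (simp add: mem_acoset add_subgroupD[OF assms(2)])
  ultimately show ?thesis unfolding acoset_lift_def by blast
qed

text \<open>
  The lifted operation is a union over all representatives, so it is a single coset once the choice of
  representatives does not matter.
\<close>
lemma acoset_lift2_acoset:
  assumes "add_subgroup N" "\<And>x' y'. x' - x \<in> N \<Longrightarrow> y' - y \<in> N \<Longrightarrow> f x' y' - f x y \<in> N"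
  shows "acoset_lift2 N f (acoset N x) (acoset N y) = acoset N (f x y)"
proof -
  have "acoset N (f x' y') = acoset N (f x y)" if "x' \<in> acoset N x" "y' \<in> acoset N y" for x' y'
    using that assms by (simp add: acoset_eq_iff mem_acoset)
  moreover have "x \<in> acoset N x" "y \<in> acoset N y"
    by (simp_all add: mem_acoset add_subgroupD[OF assms(1)])
  ultimately show ?thesis unfolding acoset_lift2_def by blast
qed

lemma acoset_lift2_plus:
  assumes "add_subgroup N"
  shows "acoset_lift2 N (+) (acoset N x) (acoset N y) = acoset N (x + y)"
proof (rule acoset_lift2_acoset[OF assms])
  fix x' y' assume "x' - x \<in> N" "y' - y \<in> N"
  from add_subgroupD(4)[OF assms this] show "x' + y' - (x + y) \<in> N" by (simp add: algebra_simps)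
qed

section \<open>Base change\<close>

locale base_change_setting = nalgebra M
  for M :: "('s::comm_ring_1, 'm) nalg" +
  fixes T :: "'t::comm_ring_1 set" and f :: "'s \<Rightarrow> 't"
  assumes T_one: "1 \<in> T"
    and T_diff: "a \<in> T \<Longrightarrow> b \<in> T \<Longrightarrow> a - b \<in> T"
    and T_mult: "a \<in> T \<Longrightarrow> b \<in> T \<Longrightarrow> a * b \<in> T"
    and f_closed: "s \<in> scal M \<Longrightarrow> f s \<in> T"
begin

abbreviation "N \<equiv> tens_rel T f M"
abbreviation "B \<equiv> base_change T f M"
definition "frags = {x. Poly_Mapping.keys x \<subseteq> T \<times> car M}"

lemma T_zero: "0 \<in> T"
  using T_diff[OF T_one T_one] by simp

lemma T_uminus: "a \<in> T \<Longrightarrow> - a \<in> T"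
  using T_diff[OF T_zero, of a] by simp

lemma T_add: "a \<in> T \<Longrightarrow> b \<in> T \<Longrightarrow> a + b \<in> T"
  using T_diff[of a "- b"] T_uminus[of b] by simp

lemma N_subgroup: "add_subgroup N"
  by (simp add: tens_rel_def add_subgroup_group_closure)

lemma frags_diff: "x \<in> frags \<Longrightarrow> y \<in> frags \<Longrightarrow> x - y \<in> frags"
  using Poly_Mapping.keys_diff[of x y] by (auto simp: frags_def)

lemma frags_add: "x \<in> frags \<Longrightarrow> y \<in> frags \<Longrightarrow> x + y \<in> frags"
  using Poly_Mapping.keys_add[of x y] by (auto simp: frags_def)

lemma frag_of_frags: "a \<in> T \<Longrightarrow> m \<in> car M \<Longrightarrow> frag_of (a, m) \<in> frags"
  by (simp add: frags_def)

lemma zero_frags: "0 \<in> frags"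
  by (simp add: frags_def)

lemma uminus_frags: "- x \<in> frags \<longleftrightarrow> x \<in> frags"
  by (simp add: frags_def)

lemma tens_rel_intros:
  "a \<in> T \<Longrightarrow> b \<in> T \<Longrightarrow> m \<in> car M \<Longrightarrow> frag_of (a + b, m) - frag_of (a, m) - frag_of (b, m) \<in> N"
  "a \<in> T \<Longrightarrow> m \<in> car M \<Longrightarrow> n \<in> car M \<Longrightarrow>
     frag_of (a, add M m n) - frag_of (a, m) - frag_of (a, n) \<in> N"
  "a \<in> T \<Longrightarrow> s \<in> scal M \<Longrightarrow> m \<in> car M \<Longrightarrow> frag_of (a * f s, m) - frag_of (a, smul M s m) \<in> N"
  unfolding tens_rel_def by (rule group_closure.base; blast)+

text \<open>
  Additive maps out of the free abelian group are compatible with the tensor product as soon as they respect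
  the three families of generating relations.
\<close>
lemma tens_rel_induct [consumes 1, case_names diff zero left right balanced]:
  assumes "x \<in> N"
    and "\<And>x y. x \<in> N \<Longrightarrow> y \<in> N \<Longrightarrow> P x \<Longrightarrow> P y \<Longrightarrow> P (x - y)"
    and "P 0"
    and "\<And>a b m. a \<in> T \<Longrightarrow> b \<in> T \<Longrightarrow> m \<in> car M \<Longrightarrow>
           P (frag_of (a + b, m) - frag_of (a, m) - frag_of (b, m))"
    and "\<And>a m n. a \<in> T \<Longrightarrow> m \<in> car M \<Longrightarrow> n \<in> car M \<Longrightarrow>
           P (frag_of (a, add M m n) - frag_of (a, m) - frag_of (a, n))"
    and "\<And>a s m. a \<in> T \<Longrightarrow> s \<in> scal M \<Longrightarrow> m \<in> car M \<Longrightarrow>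
           P (frag_of (a * f s, m) - frag_of (a, smul M s m))"
  shows "P x"
  using assms(1) unfolding tens_rel_def
proof (induction rule: group_closure.induct)
  case (base s)
  then show ?case using assms(3-6) by blast
next
  case (diff s t)
  then show ?case using assms(2) unfolding tens_rel_def by blast
qed

lemma N_frags: "x \<in> N \<Longrightarrow> x \<in> frags"
  by (induction rule: tens_rel_induct)
    (simp_all add: frags_diff zero_frags frag_of_frags T_add T_mult f_closed add_closed smul_closed)

lemma frags_induct [consumes 1, case_names diff zero frag]:
  assumes "x \<in> frags"
    and "\<And>x y. P x \<Longrightarrow> P y \<Longrightarrow> P (x - y)" "P 0"
    and "\<And>a m. a \<in> T \<Longrightarrow> m \<in> car M \<Longrightarrow> P (frag_of (a, m))"
  shows "P x"
  using assms(1)[unfolded frags_def mem_Collect_eq]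
  by (induction rule: frag_induction) (auto intro: assms)

lemma frags_induct_N [consumes 1, case_names diff zero frag]:
  assumes "x \<in> frags"
    and "\<And>x y. P x \<in> N \<Longrightarrow> P y \<in> N \<Longrightarrow> P (x - y) = P x - P y" "P 0 = 0"
    and "\<And>a m. a \<in> T \<Longrightarrow> m \<in> car M \<Longrightarrow> P (frag_of (a, m)) \<in> N"
  shows "P x \<in> N"
  using assms(1)
  by (induction rule: frags_induct) (auto simp: assms add_subgroupD[OF N_subgroup])

lemma tens_smul_simps:
  "tens_smul c (x + y) = tens_smul c x + tens_smul c y"
  "tens_smul c (x - y) = tens_smul c x - tens_smul c y"
  "tens_smul c 0 = 0"
  "tens_smul c (frag_of (a, m)) = frag_of (c * a, m)"
  by (simp_all add: tens_smul_def frag_extend_add frag_extend_diff)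

lemma tens_mul_simps:
  "tens_mul M (x + y) z = tens_mul M x z + tens_mul M y z"
  "tens_mul M (x - y) z = tens_mul M x z - tens_mul M y z"
  "tens_mul M 0 z = 0"
  "tens_mul M (frag_of (a, m)) (frag_of (b, n)) = frag_of (a * b, mul M m n)"
  by (simp_all add: tens_mul_def frag_extend_add frag_extend_diff)

lemma tens_mul_diff_right: "tens_mul M x (y - z) = tens_mul M x y - tens_mul M x z"
proof -
  have "Poly_Mapping.keys x \<subseteq> UNIV" by simp
  then show ?thesis
  proof (induction rule: frag_induction)
    case (one am)
    then show ?case by (cases am) (simp add: tens_mul_def frag_extend_diff)
  qed (simp_all add: tens_mul_simps)
qed

lemma tens_mul_zero_right: "tens_mul M x 0 = 0"
  using tens_mul_diff_right[of x 0 0] by simp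

lemma tens_mul_add_right: "tens_mul M x (y + z) = tens_mul M x y + tens_mul M x z"
  using tens_mul_diff_right[of x "y + z" z] by simp

lemma tens_smul_N: "x \<in> N \<Longrightarrow> c \<in> T \<Longrightarrow> tens_smul c x \<in> N"
proof (induction rule: tens_rel_induct)
  case (left a b m)
  then show ?case
    using tens_rel_intros(1)[of "c * a" "c * b" m] by (simp add: tens_smul_simps T_mult algebra_simps)
next
  case (balanced a s m)
  then show ?case
    using tens_rel_intros(3)[of "c * a" s m] by (simp add: tens_smul_simps T_mult algebra_simps)
qed (simp_all add: tens_smul_simps tens_rel_intros T_mult add_subgroupD[OF N_subgroup])

text \<open>
  Checked on generators: each generating relation times a pure tensor is a generating relation of the same
  family.
\<close>
lemma tens_mul_N_left: "x \<in> N \<Longrightarrow> y \<in> frags \<Longrightarrow> tens_mul M x y \<in> N"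
proof (induction rule: tens_rel_induct)
  case (left a b m)
  from left(4) show ?case
  proof (induction rule: frags_induct_N)
    case (frag c n)
    then show ?case
      using left(1-3) tens_rel_intros(1)[of "a * c" "b * c" "mul M m n"]
      by (simp add: tens_mul_simps T_mult mul_closed algebra_simps)
  qed (simp_all add: tens_mul_diff_right tens_mul_zero_right)
next
  case (right a m m')
  from right(4) show ?case
  proof (induction rule: frags_induct_N)
    case (frag c n)
    then show ?case
      using right(1-3) tens_rel_intros(2)[of "a * c" "mul M m n" "mul M m' n"]
      by (simp add: tens_mul_simps T_mult mul_closed mul_add_left)
  qed (simp_all add: tens_mul_diff_right tens_mul_zero_right)
next
  case (balanced a s m)
  from balanced(4) show ?case
  proof (induction rule: frags_induct_N)
    case (frag c n)
    then show ?case
      using balanced(1-3) tens_rel_intros(3)[of "a * c" s "mul M m n"]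
      by (simp add: tens_mul_simps T_mult mul_closed mul_smul_left mult_ac)
  qed (simp_all add: tens_mul_diff_right tens_mul_zero_right)
qed (simp_all add: tens_mul_simps add_subgroupD[OF N_subgroup])

lemma tens_mul_N_right: "y \<in> N \<Longrightarrow> x \<in> frags \<Longrightarrow> tens_mul M x y \<in> N"
proof (induction rule: tens_rel_induct)
  case (left a b m)
  from left(4) show ?case
  proof (induction rule: frags_induct_N)
    case (frag c n)
    then show ?case
      using left(1-3) tens_rel_intros(1)[of "c * a" "c * b" "mul M n m"]
      by (simp add: tens_mul_simps tens_mul_diff_right tens_mul_add_right T_mult mul_closed algebra_simps)
  qed (simp_all add: tens_mul_simps)
next
  case (right a m m')
  from right(4) show ?case
  proof (induction rule: frags_induct_N)
    case (frag c n)
    then show ?case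
      using right(1-3) tens_rel_intros(2)[of "c * a" "mul M n m" "mul M n m'"]
      by (simp add: tens_mul_simps tens_mul_diff_right T_mult mul_closed mul_add_right)
  qed (simp_all add: tens_mul_simps)
next
  case (balanced a s m)
  from balanced(4) show ?case
  proof (induction rule: frags_induct_N)
    case (frag c n)
    then show ?case
      using balanced(1-3) tens_rel_intros(3)[of "c * a" s "mul M n m"]
      by (simp add: tens_mul_simps tens_mul_diff_right T_mult mul_closed mul_smul_right mult_ac)
  qed (simp_all add: tens_mul_simps)
qed (simp_all add: tens_mul_diff_right tens_mul_zero_right add_subgroupD[OF N_subgroup])

lemma coset_in_car: "x \<in> frags \<Longrightarrow> acoset N x \<in> car B"
  by (auto simp: base_change_def frags_def)

lemma car_cases [consumes 1]:
  assumes "X \<in> car B" obtains x where "x \<in> frags" "X = acoset N x"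
  using assms by (auto simp: base_change_def frags_def)

lemma coset_add: "add B (acoset N x) (acoset N y) = acoset N (x + y)"
  by (simp add: base_change_def acoset_lift2_plus[OF N_subgroup])

lemma coset_mul:
  assumes "x \<in> frags" "y \<in> frags"
  shows "mul B (acoset N x) (acoset N y) = acoset N (tens_mul M x y)"
proof -
  have "tens_mul M x' y' - tens_mul M x y \<in> N" if "x' - x \<in> N" "y' - y \<in> N" for x' y'
  proof -
    have "y' \<in> frags" using frags_add[OF N_frags[OF that(2)] assms(2)] by simp
    then have "tens_mul M (x' - x) y' \<in> N" "tens_mul M x (y' - y) \<in> N"
      using tens_mul_N_left tens_mul_N_right that assms by blast+
    from add_subgroupD(4)[OF N_subgroup this] show ?thesis
      by (simp add: tens_mul_simps tens_mul_diff_right)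
  qed
  then show ?thesis
    by (simp add: base_change_def acoset_lift2_acoset[OF N_subgroup])
qed

lemma coset_smul: "c \<in> T \<Longrightarrow> smul B c (acoset N x) = acoset N (tens_smul c x)"
  using tens_smul_N[of _ c]
  by (simp add: base_change_def acoset_lift_acoset[OF N_subgroup N_subgroup]
      flip: tens_smul_simps)

lemma coset_eq: "acoset N x = acoset N y \<longleftrightarrow> x - y \<in> N"
  by (rule acoset_eq_iff[OF N_subgroup])

lemma scal_B: "scal B = T"
  by (simp add: base_change_def)

lemma tens_smul_frags: "x \<in> frags \<Longrightarrow> c \<in> T \<Longrightarrow> tens_smul c x \<in> frags"
  by (induction rule: frags_induct)
    (simp_all add: frags_diff zero_frags frag_of_frags tens_smul_simps T_mult)

lemma tens_mul_frags: "x \<in> frags \<Longrightarrow> y \<in> frags \<Longrightarrow> tens_mul M x y \<in> frags"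
proof (induction rule: frags_induct)
  case (frag a m)
  from frag(3) show ?case
    by (induction rule: frags_induct)
      (simp_all add: frags_diff zero_frags frag_of_frags tens_mul_simps tens_mul_diff_right
          tens_mul_zero_right T_mult mul_closed frag)
qed (simp_all add: frags_diff zero_frags tens_mul_simps)

lemma tens_smul_mul:
  assumes "x \<in> frags" "y \<in> frags"
  shows "tens_mul M (tens_smul c x) y = tens_smul c (tens_mul M x y)"
    and "tens_mul M x (tens_smul c y) = tens_smul c (tens_mul M x y)"
proof -
  have "tens_mul M (tens_smul c x) y = tens_smul c (tens_mul M x y) \<and>
        tens_mul M x (tens_smul c y) = tens_smul c (tens_mul M x y)"
    using assms
  proof (induction rule: frags_induct)
    case (frag a m)
    from frag(3) show ?case
      by (induction rule: frags_induct)
        (simp_all add: tens_mul_simps tens_mul_diff_right tens_mul_zero_right tens_smul_simps mult_ac)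
  qed (simp_all add: tens_mul_simps tens_smul_simps)
  then show "tens_mul M (tens_smul c x) y = tens_smul c (tens_mul M x y)"
    and "tens_mul M x (tens_smul c y) = tens_smul c (tens_mul M x y)" by blast+
qed

text \<open>
  All axioms hold already for the representatives, except the additivity in the scalar and the uniqueness of
  zero, which need the first family of relations.
\<close>
lemma base_change_nalgebra: "nalgebra B"
proof
  show "car B \<noteq> {}" using coset_in_car[OF zero_frags] by auto
next
  fix c d x assume "c \<in> scal B" "d \<in> scal B" "x \<in> car B"
  then have cd: "c \<in> T" "d \<in> T" by (simp_all add: scal_B)
  from \<open>x \<in> car B\<close> obtain p where p: "p \<in> frags" "x = acoset N p" by (rule car_cases)
  from p(1) have "tens_smul (c + d) p - (tens_smul c p + tens_smul d p) \<in> N"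
  proof (induction rule: frags_induct_N)
    case (frag a m)
    then show ?case
      using tens_rel_intros(1)[of "c * a" "d * a" m] cd
      by (simp add: tens_smul_simps T_mult algebra_simps)
  qed (simp_all add: tens_smul_simps)
  then show "smul B (c + d) x = add B (smul B c x) (smul B d x)"
    using cd by (simp add: p coset_smul coset_add coset_eq T_add)
  from p(1) have "tens_smul c (tens_smul d p) = tens_smul (c * d) p"
    by (induction rule: frags_induct) (simp_all add: tens_smul_simps mult_ac)
  then show "smul B c (smul B d x) = smul B (c * d) x"
    using cd by (simp add: p coset_smul T_mult)
next
  fix x assume "x \<in> car B"
  then obtain p where p: "p \<in> frags" "x = acoset N p" by (rule car_cases)
  from p(1) have "tens_smul 1 p = p"
    by (induction rule: frags_induct) (simp_all add: tens_smul_simps)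
  then show "smul B 1 x = x" by (simp add: p coset_smul T_one)
next
  have *: "smul B 0 x = acoset N 0" if "x \<in> car B" for x
  proof -
    from that obtain p where p: "p \<in> frags" "x = acoset N p" by (rule car_cases)
    from p(1) have "tens_smul 0 p - 0 \<in> N"
    proof (induction rule: frags_induct_N)
      case (frag a m)
      then show ?case using add_subgroupD(3)[OF N_subgroup tens_rel_intros(1)[of 0 0 m]] T_zero
        by (simp add: tens_smul_simps)
    qed (simp_all add: tens_smul_simps)
    then show ?thesis by (simp add: p coset_smul T_zero coset_eq)
  qed
  show "smul B 0 x = smul B 0 y" if "x \<in> car B" "y \<in> car B" for x y
    using that * by simp
qed (auto elim!: car_cases simp: scal_B T_one T_diff T_mult coset_add coset_mul coset_smul
    tens_smul_frags tens_mul_frags frags_add tens_smul_simps tens_mul_simps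
    tens_mul_add_right tens_smul_mul
    intro!: coset_in_car arg_cong[of _ _ "acoset N"] simp: add_ac)

lemma tens_in_car: "a \<in> T \<Longrightarrow> m \<in> car M \<Longrightarrow> tens T f M a m \<in> car B"
  by (auto simp: tens_def intro: coset_in_car frag_of_frags)

lemma tens_add_right: "a \<in> T \<Longrightarrow> m \<in> car M \<Longrightarrow> n \<in> car M \<Longrightarrow>
    tens T f M a (add M m n) = add B (tens T f M a m) (tens T f M a n)"
  by (simp add: tens_def coset_add coset_eq tens_rel_intros flip: diff_diff_eq)

lemma tens_balanced: "a \<in> T \<Longrightarrow> s \<in> scal M \<Longrightarrow> m \<in> car M \<Longrightarrow>
    tens T f M (a * f s) m = tens T f M a (smul M s m)"
  by (simp add: tens_def coset_eq tens_rel_intros)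

lemma tens_mul: "a \<in> T \<Longrightarrow> b \<in> T \<Longrightarrow> m \<in> car M \<Longrightarrow> n \<in> car M \<Longrightarrow>
    mul B (tens T f M a m) (tens T f M b n) = tens T f M (a * b) (mul M m n)"
  by (simp add: tens_def coset_mul frag_of_frags tens_mul_simps)

lemma tens_smul: "c \<in> T \<Longrightarrow> smul B c (tens T f M a m) = tens T f M (c * a) m"
  by (simp add: tens_def coset_smul tens_smul_simps)

text \<open>
  Pure tensors generate under addition alone, since \<open>- (a \<otimes> m) = (- a) \<otimes> m\<close> and
  \<open>0 = 0 \<otimes> m\<close>.
\<close>
lemma base_change_induct [consumes 1, case_names tens add]:
  assumes "X \<in> car B"
    and "\<And>a m. a \<in> T \<Longrightarrow> m \<in> car M \<Longrightarrow> P (tens T f M a m)"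
    and "\<And>X Y. X \<in> car B \<Longrightarrow> Y \<in> car B \<Longrightarrow> P X \<Longrightarrow> P Y \<Longrightarrow> P (add B X Y)"
  shows "P X"
proof -
  obtain x where x: "x \<in> frags" "X = acoset N x" using assms(1) by (rule car_cases)
  from x(1) have "x \<in> frags \<and> P (acoset N x) \<and> P (acoset N (- x))"
  proof (induction rule: frags_induct)
    case (diff x y)
    then have fr: "- x \<in> frags" "- y \<in> frags" by (simp_all add: uminus_frags)
    have "P (add B (acoset N x) (acoset N (- y)))" "P (add B (acoset N y) (acoset N (- x)))"
      using diff fr by (auto intro!: assms(3) coset_in_car)
    then show ?case using diff frags_diff[of x y] by (simp add: coset_add)
  next
    case zero
    obtain m where m: "m \<in> car M" using car_nonempty by blast
    have "acoset N 0 = tens T f M 0 m"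
      using tens_rel_intros(1)[of 0 0 m] T_zero m by (simp add: tens_def coset_eq)
    then show ?case using assms(2)[OF T_zero m] by (simp add: zero_frags)
  next
    case (frag a m)
    have "acoset N (- frag_of (a, m)) = tens T f M (- a) m"
      using tens_rel_intros(1)[of a "- a" m] tens_rel_intros(1)[of 0 0 m] frag T_zero T_uminus
        add_subgroupD(4)[OF N_subgroup tens_rel_intros(1)[of a "- a" m] tens_rel_intros(1)[of 0 0 m]]
      by (simp add: tens_def coset_eq)
    then show ?case using assms(2)[of a m] assms(2)[of "- a" m] frag T_uminus
      by (simp add: tens_def frag_of_frags)
  qed
  then show ?thesis by (simp add: x)
qed

text \<open>
  The universal property, weakened on purpose: the map \<open>h\<close> has to be balanced only up to a
  subgroup \<open>K\<close>, and then relations are sent into \<open>K\<close>. With \<open>K\<close>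
  trivial this separates elements of the tensor product. With a nontrivial \<open>K\<close> it recognizes
  the tensor product as a quotient, without building that quotient as a group.
\<close>
lemma tens_universal:
  fixes G :: "'g monoid"
  assumes G: "comm_group G" and K: "subgroup K G"
    and h: "\<And>a m. a \<in> T \<Longrightarrow> m \<in> car M \<Longrightarrow> h a m \<in> carrier G"
    and h_left: "\<And>a b m. a \<in> T \<Longrightarrow> b \<in> T \<Longrightarrow> m \<in> car M \<Longrightarrow> h (a + b) m = h a m \<otimes>\<^bsub>G\<^esub> h b m"
    and h_right: "\<And>a m n. a \<in> T \<Longrightarrow> m \<in> car M \<Longrightarrow> n \<in> car M \<Longrightarrow>
          h a (add M m n) = h a m \<otimes>\<^bsub>G\<^esub> h a n"
    and h_balanced: "\<And>a s m. a \<in> T \<Longrightarrow> s \<in> scal M \<Longrightarrow> m \<in> car M \<Longrightarrow>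
          h (a * f s) m \<otimes>\<^bsub>G\<^esub> inv\<^bsub>G\<^esub> h a (smul M s m) \<in> K"
  obtains H where "\<And>x y. x \<in> frags \<Longrightarrow> y \<in> frags \<Longrightarrow> H (x + y) = H x \<otimes>\<^bsub>G\<^esub> H y"
    "\<And>x y. x \<in> frags \<Longrightarrow> y \<in> frags \<Longrightarrow> H (x - y) = H x \<otimes>\<^bsub>G\<^esub> inv\<^bsub>G\<^esub> H y"
    "\<And>a m. a \<in> T \<Longrightarrow> m \<in> car M \<Longrightarrow> H (frag_of (a, m)) = h a m"
    "\<And>x. x \<in> N \<Longrightarrow> H x \<in> K"
proof -
  interpret G: comm_group G by (rule G)
  have "case_prod h ` (T \<times> car M) \<subseteq> carrier G" using h by auto
  from G.free_Abelian_group_universal[OF this] obtain H where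
    H: "H \<in> hom (free_Abelian_group (T \<times> car M)) G"
    and Hf: "\<And>x. x \<in> T \<times> car M \<Longrightarrow> H (frag_of x) = case_prod h x" by blast
  interpret H: group_hom "free_Abelian_group (T \<times> car M)" G H
    by unfold_locales (use H group_free_Abelian_group[of "T \<times> car M"] in
        \<open>auto simp: group_def monoid_def group_axioms_def\<close>)
  have Hadd: "H (x + y) = H x \<otimes>\<^bsub>G\<^esub> H y" if "x \<in> frags" "y \<in> frags" for x y
    using H.hom_mult[of x y] that by (simp add: frags_def)
  have Hdiff: "H (x - y) = H x \<otimes>\<^bsub>G\<^esub> inv\<^bsub>G\<^esub> H y" if "x \<in> frags" "y \<in> frags" for x y
    using Hadd[of x "- y"] H.hom_inv[of y] that by (simp add: frags_def)
  have Hc: "H x \<in> carrier G" if "x \<in> frags" for x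
    using H.hom_closed[of x] that by (simp add: frags_def)
  have cancel: "x \<otimes>\<^bsub>G\<^esub> y \<otimes>\<^bsub>G\<^esub> inv\<^bsub>G\<^esub> x \<otimes>\<^bsub>G\<^esub> inv\<^bsub>G\<^esub> y = \<one>\<^bsub>G\<^esub>"
    if "x \<in> carrier G" "y \<in> carrier G" for x y
    using that by (metis G.inv_closed G.m_assoc G.m_comm G.r_inv G.r_one)
  have HN: "H x \<in> K" if "x \<in> N" for x
    using that
  proof (induction rule: tens_rel_induct)
    case (diff x y)
    then show ?case
      using N_frags by (simp add: Hdiff[OF N_frags N_frags] subgroup.m_closed[OF K] subgroup.m_inv_closed[OF K])
  next
    case zero
    show ?case using H.hom_one subgroup.one_closed[OF K] by simp
  next
    case (left a b m)
    then have "H (frag_of (a + b, m) - frag_of (a, m) - frag_of (b, m)) = \<one>\<^bsub>G\<^esub>"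
      using h T_add by (simp add: Hdiff frags_diff frag_of_frags Hf h_left cancel flip: diff_diff_eq)
    then show ?case using subgroup.one_closed[OF K] by simp
  next
    case (right a m n)
    then have "H (frag_of (a, add M m n) - frag_of (a, m) - frag_of (a, n)) = \<one>\<^bsub>G\<^esub>"
      using h by (simp add: Hdiff frags_diff frag_of_frags Hf h_right cancel add_closed flip: diff_diff_eq)
    then show ?case using subgroup.one_closed[OF K] by simp
  next
    case (balanced a s m)
    then show ?case
      using h_balanced by (simp add: Hdiff frag_of_frags Hf T_mult f_closed smul_closed)
  qed
  show ?thesis by (rule that[of H]) (use Hadd Hdiff Hf HN in auto)
qed

end

section \<open>Specialization at a sign\<close>

lemma cov_sel_simps [simp]:
  "cov_re (x + y) = cov_re x + cov_re y" "cov_pi (x + y) = cov_pi x + cov_pi y"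
  "cov_re (x - y) = cov_re x - cov_re y" "cov_pi (x - y) = cov_pi x - cov_pi y"
  "cov_re (- x) = - cov_re x" "cov_pi (- x) = - cov_pi x"
  "cov_re (x * y) = cov_re x * cov_re y + cov_pi x * cov_pi y"
  "cov_pi (x * y) = cov_re x * cov_pi y + cov_pi x * cov_re y"
  "cov_re 0 = 0" "cov_pi 0 = 0" "cov_re 1 = 1" "cov_pi 1 = 0"
  by (simp_all add: plus_cov_def minus_cov_def uminus_cov_def times_cov_def zero_cov_def one_cov_def)

lemma gau_sel_simps [simp]:
  "gau_re (x + y) = gau_re x + gau_re y" "gau_im (x + y) = gau_im x + gau_im y"
  "gau_re (x - y) = gau_re x - gau_re y" "gau_im (x - y) = gau_im x - gau_im y"
  "gau_re (- x) = - gau_re x" "gau_im (- x) = - gau_im x"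
  "gau_re (x * y) = gau_re x * gau_re y - gau_im x * gau_im y"
  "gau_im (x * y) = gau_re x * gau_im y + gau_im x * gau_re y"
  "gau_re 0 = 0" "gau_im 0 = 0" "gau_re 1 = 1" "gau_im 1 = 0"
  by (simp_all add: plus_gau_def minus_gau_def uminus_gau_def times_gau_def zero_gau_def one_gau_def)

lemma cov_eq_iff: "x = y \<longleftrightarrow> cov_re x = cov_re y \<and> cov_pi x = cov_pi y"
  by (cases x; cases y) simp

lemma gau_eq_iff: "x = y \<longleftrightarrow> gau_re x = gau_re y \<and> gau_im x = gau_im y"
  by (cases x; cases y) simp

lemma map_cov_sel [simp]: "cov_re (map_cov f x) = f (cov_re x)" "cov_pi (map_cov f x) = f (cov_pi x)"
  by (cases x; simp)+

lemma const_sel [simp]: "cov_re (cov_const a) = a" "cov_pi (cov_const a) = 0"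
  "gau_re (of_base b) = b" "gau_im (of_base b) = 0" "cov_re ppi = 0" "cov_pi ppi = 1"
  by (simp_all add: cov_const_def of_base_def ppi_def)

lemma cov_const_hom:
  "cov_const (a + b) = cov_const a + cov_const b" "cov_const (a - b) = cov_const a - cov_const b"
  "cov_const (a * b) = cov_const a * cov_const b" "cov_const (- a) = - cov_const a"
  "cov_const 0 = 0" "cov_const 1 = 1"
  for a b :: "'a::comm_ring_1"
  by (simp_all add: cov_eq_iff)

lemma of_base_hom:
  "of_base (a + b) = of_base a + of_base b" "of_base (a - b) = of_base a - of_base b"
  "of_base (a * b) = of_base a * of_base b" "of_base (- a) = - of_base a"
  "of_base 0 = 0" "of_base 1 = 1"
  for a b :: "'a::comm_ring_1"
  by (simp_all add: gau_eq_iff)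

lemma mem_cov_ring: "x \<in> cov_ring R \<longleftrightarrow> cov_re x \<in> R \<and> cov_pi x \<in> R"
  by (cases x) (auto simp: cov_ring_def)

lemma mem_gau_ring: "x \<in> gau_ring R \<longleftrightarrow> gau_re x \<in> R \<and> gau_im x \<in> R"
  by (cases x) (auto simp: gau_ring_def)

abbreviation ext_scal :: "'a::comm_ring_1 cov \<Rightarrow> 'a gau cov" where
  "ext_scal \<equiv> map_cov of_base"

abbreviation re_scal :: "'a::comm_ring_1 gau cov \<Rightarrow> 'a cov" where
  "re_scal \<equiv> map_cov gau_re"

abbreviation im_scal :: "'a::comm_ring_1 gau cov \<Rightarrow> 'a cov" where
  "im_scal \<equiv> map_cov gau_im"

text \<open>The version of \<open>tT\<close> over an arbitrary ground ring.\<close>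
definition root_t :: "'a::comm_ring_1 gau cov" where
  "root_t = cov_const (Gau 0 1)"

lemma root_t_sel [simp]: "cov_re root_t = Gau 0 1" "cov_pi root_t = 0"
  by (simp_all add: root_t_def)

lemma root_t_sq: "root_t * root_t = - 1"
  by (simp add: cov_eq_iff gau_eq_iff)

lemma ext_scal_hom:
  "ext_scal (a + b) = ext_scal a + ext_scal b" "ext_scal (a - b) = ext_scal a - ext_scal b"
  "ext_scal (a * b) = ext_scal a * ext_scal b" "ext_scal (- a) = - ext_scal a"
  "ext_scal 0 = 0" "ext_scal 1 = 1"
  by (simp_all add: cov_eq_iff of_base_hom)

lemma scal_decomp: "c = ext_scal (re_scal c) + root_t * ext_scal (im_scal c)"
  by (simp add: cov_eq_iff gau_eq_iff)

lemma (in nalgebra) agrp_simps: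
  "carrier agrp = car M" "x \<otimes>\<^bsub>agrp\<^esub> y = add M x y" "\<one>\<^bsub>agrp\<^esub> = nzero M"
  by (simp_all add: agrp_def)

text \<open>
  The scalars form a ring \<open>R\<^sup>\<pi>\<close>, where \<open>R\<close> consists of the scalars that
  are free of \<open>\<pi>\<close>.
\<close>
locale pi_algebra = nalgebra M for M :: "('s::comm_ring_1 cov, 'm) nalg" +
  assumes scal_pi: "scal M = cov_ring (pi_free M)"
begin

lemma mem_pi_free: "a \<in> pi_free M \<longleftrightarrow> cov_const a \<in> scal M"
  by (simp add: pi_free_def)

lemma pi_free_diff: "a \<in> pi_free M \<Longrightarrow> b \<in> pi_free M \<Longrightarrow> a - b \<in> pi_free M"
  by (simp add: mem_pi_free cov_const_hom scal_diff)

lemma pi_free_mult: "a \<in> pi_free M \<Longrightarrow> b \<in> pi_free M \<Longrightarrow> a * b \<in> pi_free M"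
  by (simp add: mem_pi_free cov_const_hom scal_mult)

lemma pi_free_one: "1 \<in> pi_free M"
  by (simp add: mem_pi_free cov_const_hom scal_one)

lemma pi_free_zero: "0 \<in> pi_free M"
  by (simp add: mem_pi_free cov_const_hom scal_zero)

lemma pi_free_add: "a \<in> pi_free M \<Longrightarrow> b \<in> pi_free M \<Longrightarrow> a + b \<in> pi_free M"
  by (simp add: mem_pi_free cov_const_hom scal_add)

lemma pi_free_uminus: "a \<in> pi_free M \<Longrightarrow> - a \<in> pi_free M"
  by (simp add: mem_pi_free cov_const_hom scal_uminus)

lemmas pi_free_closed = pi_free_one pi_free_zero pi_free_add pi_free_diff pi_free_mult pi_free_uminus

lemma ppi_scal: "ppi \<in> scal M"
  by (simp add: scal_pi mem_cov_ring pi_free_closed)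

lemma spec_setting: "s = 1 \<or> s = - 1 \<Longrightarrow> base_change_setting M (pi_free M) (cov_eval s)"
  by unfold_locales (auto simp: pi_free_closed scal_pi mem_cov_ring cov_eval_def)

context
  fixes s :: 's
  assumes s: "s = 1 \<or> s = - 1"
begin

interpretation S: base_change_setting M "pi_free M" "cov_eval s"
  by (rule spec_setting[OF s])

lemma s_pi_free: "s \<in> pi_free M"
  using s by (auto intro: pi_free_closed)

lemma spec_el_closed: "m \<in> car M \<Longrightarrow> spec_el s M m \<in> car (spec s M)"
  by (simp add: spec_el_def spec_def S.tens_in_car pi_free_one)

lemma spec_el_add: "m \<in> car M \<Longrightarrow> n \<in> car M \<Longrightarrow>
    spec_el s M (add M m n) = add (spec s M) (spec_el s M m) (spec_el s M n)"
  by (simp add: spec_el_def spec_def S.tens_add_right pi_free_one)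

lemma spec_el_mul: "m \<in> car M \<Longrightarrow> n \<in> car M \<Longrightarrow>
    spec_el s M (mul M m n) = mul (spec s M) (spec_el s M m) (spec_el s M n)"
  by (simp add: spec_el_def spec_def S.tens_mul pi_free_one)

lemma tens_eq_spec_el: "a \<in> pi_free M \<Longrightarrow> m \<in> car M \<Longrightarrow>
    tens (pi_free M) (cov_eval s) M a m = spec_el s M (smul M (cov_const a) m)"
  using S.tens_balanced[OF pi_free_one, of "cov_const a" m]
  by (simp add: spec_el_def mem_pi_free cov_eval_def)

lemma spec_el_smul: "a \<in> pi_free M \<Longrightarrow> m \<in> car M \<Longrightarrow>
    spec_el s M (smul M (cov_const a) m) = smul (spec s M) a (spec_el s M m)"
  using tens_eq_spec_el[of a m] by (simp add: spec_el_def spec_def S.tens_smul)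

lemma spec_el_surj:
  assumes "X \<in> car (spec s M)" obtains m where "m \<in> car M" "X = spec_el s M m"
proof -
  have "\<exists>m\<in>car M. X = spec_el s M m"
    using assms unfolding spec_def
  proof (induction rule: S.base_change_induct)
    case (tens a m)
    then show ?case
      by (auto simp: tens_eq_spec_el mem_pi_free intro: smul_closed)
  next
    case (add X Y)
    then show ?case by (metis spec_def spec_el_add add_closed)
  qed
  with that show ?thesis by blast
qed

text \<open>
  The specialization at \<open>\<pi> = s\<close> is the quotient by the multiples of \<open>\<pi> -
  s\<close>. Such multiples become zero because \<open>1 \<otimes> (\<pi> - s) k = (s - s) \<otimes>
  k\<close>. Conversely \<open>a \<otimes> m \<mapsto> a m\<close> is balanced up to multiples of
  \<open>\<pi> - s\<close>, as \<open>c\<close> and its value at \<open>\<pi> = s\<close> differ by such a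
  multiple.
\<close>
lemma spec_el_eq_iff:
  assumes x: "x \<in> car M" and y: "y \<in> car M"
  shows "spec_el s M x = spec_el s M y \<longleftrightarrow>
    (\<exists>k\<in>car M. x = add M y (smul M (ppi - cov_const s) k))"
proof
  assume "\<exists>k\<in>car M. x = add M y (smul M (ppi - cov_const s) k)"
  then obtain k where k: "k \<in> car M" "x = add M y (smul M (ppi - cov_const s) k)" by blast
  have sc: "ppi - cov_const s \<in> scal M"
    using s_pi_free by (simp add: ppi_scal scal_diff mem_pi_free)
  have "spec_el s M (smul M (ppi - cov_const s) k) = spec_el s M (smul M (cov_const 0) k)"
    using S.tens_balanced[OF pi_free_one sc k(1)] S.tens_balanced[of 1 "cov_const 0" k] k(1)
    by (simp add: spec_el_def cov_eval_def pi_free_one cov_const_hom scal_zero)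
  then have "spec_el s M x = spec_el s M (add M y (smul M (cov_const 0) k))"
    using k y sc by (simp add: spec_el_add smul_closed cov_const_hom scal_zero)
  then show "spec_el s M x = spec_el s M y"
    by (simp add: k y smul_zero add_nzero cov_const_hom)
next
  assume eq: "spec_el s M x = spec_el s M y"
  let ?c = "ppi - cov_const s"
  let ?K = "smul M ?c ` car M"
  interpret G: comm_group agrp by (rule agrp_comm_group)
  have sc: "?c \<in> scal M"
    using s_pi_free by (simp add: ppi_scal scal_diff mem_pi_free)
  have inv: "inv\<^bsub>agrp\<^esub> z = smul M (- 1) z" if "z \<in> car M" for z
    using that add_neg[of z] add_comm[of z "smul M (- 1) z"] neg_closed[of z]
    by (intro G.inv_equality) (simp_all add: agrp_simps)
  have K: "subgroup ?K agrp"
  proof (rule G.subgroupI)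
    fix a b assume "a \<in> ?K" "b \<in> ?K"
    then obtain k l where kl: "k \<in> car M" "a = smul M ?c k" "l \<in> car M" "b = smul M ?c l" by blast
    have "a \<otimes>\<^bsub>agrp\<^esub> b = smul M ?c (add M k l)" "inv\<^bsub>agrp\<^esub> a = smul M ?c (smul M (- 1) k)"
      using kl sc scal_uminus[OF scal_one] smul_closed
      by (simp_all add: agrp_simps smul_add_right smul_smul inv)
    then show "a \<otimes>\<^bsub>agrp\<^esub> b \<in> ?K" "inv\<^bsub>agrp\<^esub> a \<in> ?K"
      using kl add_closed neg_closed by blast+
  qed (use sc car_nonempty in \<open>auto simp: agrp_simps smul_closed\<close>)
  \<comment> \<open>\<open>c(s) - c = (\<pi> - s) (- c\<^sub>\<pi>)\<close>, where \<open>c\<^sub>\<pi>\<close> is the coefficient of \<open>\<pi>\<close>.\<close>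
  have bal: "smul M (cov_const (a * cov_eval s c)) m \<otimes>\<^bsub>agrp\<^esub>
       inv\<^bsub>agrp\<^esub> smul M (cov_const a) (smul M c m) \<in> ?K"
    if "a \<in> pi_free M" "c \<in> scal M" "m \<in> car M" for a c m
  proof -
    have ev: "cov_eval s c \<in> pi_free M" and cp: "cov_pi c \<in> pi_free M"
      using that S.f_closed by (auto simp: scal_pi mem_cov_ring)
    have "smul M (cov_const (a * cov_eval s c)) m \<otimes>\<^bsub>agrp\<^esub>
       inv\<^bsub>agrp\<^esub> smul M (cov_const a) (smul M c m) =
       add M (smul M (cov_const (a * cov_eval s c)) m) (smul M (- (cov_const a * c)) m)"
      using that ev scal_uminus[OF scal_one]
      by (simp add: inv smul_closed smul_smul mem_pi_free agrp_simps scal_mult)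
    also have "\<dots> = smul M (cov_const (a * cov_eval s c) + - (cov_const a * c)) m"
      using that ev by (subst smul_add_left)
        (auto simp: mem_pi_free cov_const_hom intro!: scal_mult scal_uminus)
    also have "cov_const (a * cov_eval s c) + - (cov_const a * c) = ?c * - cov_const (a * cov_pi c)"
      by (simp add: cov_eq_iff cov_eval_def algebra_simps)
    also have "smul M \<dots> m = smul M ?c (smul M (- cov_const (a * cov_pi c)) m)"
      using that cp sc by (simp add: smul_smul scal_uminus mem_pi_free cov_const_hom scal_mult)
    finally show ?thesis
      using that cp by (auto intro!: imageI smul_closed scal_uminus scal_mult simp: mem_pi_free cov_const_hom)
  qed
  obtain H where H: "\<And>x y. x \<in> S.frags \<Longrightarrow> y \<in> S.frags \<Longrightarrow> H (x - y) = H x \<otimes>\<^bsub>agrp\<^esub> inv\<^bsub>agrp\<^esub> H y"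
    "\<And>a m. a \<in> pi_free M \<Longrightarrow> m \<in> car M \<Longrightarrow> H (frag_of (a, m)) = smul M (cov_const a) m"
    "\<And>x. x \<in> S.N \<Longrightarrow> H x \<in> ?K"
    by (rule S.tens_universal[OF agrp_comm_group K, of "\<lambda>a m. smul M (cov_const a) m"])
      (use bal in \<open>auto simp: agrp_simps cov_const_hom smul_add_left smul_add_right smul_closed mem_pi_free\<close>)
  have "frag_of (1, x) - frag_of (1, y) \<in> S.N"
    using eq by (simp add: spec_el_def tens_def S.coset_eq)
  from H(3)[OF this] have "add M x (smul M (- 1) y) \<in> ?K"
    using x y by (simp add: H(1,2) S.frag_of_frags pi_free_one inv cov_const_hom smul_one agrp_simps)
  then obtain k where "k \<in> car M" "add M x (smul M (- 1) y) = smul M ?c k" by blast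
  then show "\<exists>k\<in>car M. x = add M y (smul M ?c k)"
    using eq_add_negD[OF x y] by blast
qed

end

section \<open>Adjoining a square root of -1\<close>

abbreviation "R\<^sub>t \<equiv> cov_ring (gau_ring (pi_free M))"

lemma mem_Rt: "c \<in> R\<^sub>t \<longleftrightarrow> re_scal c \<in> scal M \<and> im_scal c \<in> scal M"
  by (auto simp: scal_pi mem_cov_ring mem_gau_ring)

lemma adj_t_setting: "base_change_setting M R\<^sub>t ext_scal"
  by unfold_locales (auto simp: pi_free_closed scal_pi mem_cov_ring mem_gau_ring)

interpretation A: base_change_setting M R\<^sub>t ext_scal
  by (rule adj_t_setting)

lemma scal_adj_t: "scal (adj_t M) = R\<^sub>t"
  by (simp add: adj_t_def A.scal_B)

lemma pi_free_adj_t: "pi_free (adj_t M) = gau_ring (pi_free M)"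
  unfolding pi_free_def[of "adj_t M"] by (auto simp: scal_adj_t mem_cov_ring mem_gau_ring pi_free_closed)

lemma adj_t_pi_algebra: "pi_algebra (adj_t M)"
proof -
  have "nalgebra (adj_t M)" unfolding adj_t_def by (rule A.base_change_nalgebra)
  then interpret T: nalgebra "adj_t M" .
  show ?thesis by unfold_locales (simp add: pi_free_adj_t scal_adj_t)
qed

interpretation T: pi_algebra "adj_t M"
  by (rule adj_t_pi_algebra)

lemma ext_scal_Rt: "c \<in> scal M \<Longrightarrow> ext_scal c \<in> R\<^sub>t"
  by (rule A.f_closed)

lemma root_t_Rt: "root_t \<in> R\<^sub>t"
  by (simp add: mem_cov_ring mem_gau_ring pi_free_closed)

lemma adj_t_el_closed: "m \<in> car M \<Longrightarrow> adj_t_el M m \<in> car (adj_t M)"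
  by (simp add: adj_t_el_def adj_t_def A.tens_in_car A.T_one)

lemma adj_t_el_add: "m \<in> car M \<Longrightarrow> n \<in> car M \<Longrightarrow>
    adj_t_el M (add M m n) = add (adj_t M) (adj_t_el M m) (adj_t_el M n)"
  by (simp add: adj_t_el_def adj_t_def A.tens_add_right A.T_one)

lemma adj_t_el_mul: "m \<in> car M \<Longrightarrow> n \<in> car M \<Longrightarrow>
    adj_t_el M (mul M m n) = mul (adj_t M) (adj_t_el M m) (adj_t_el M n)"
  by (simp add: adj_t_el_def adj_t_def A.tens_mul A.T_one)

lemma adj_t_el_smul: "c \<in> scal M \<Longrightarrow> m \<in> car M \<Longrightarrow>
    adj_t_el M (smul M c m) = smul (adj_t M) (ext_scal c) (adj_t_el M m)"
  using A.tens_balanced[OF A.T_one, of c m]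
  by (simp add: adj_t_el_def adj_t_def A.tens_smul A.f_closed)

text \<open>The element \<open>m + t n\<close>.\<close>
definition gpair :: "'m \<Rightarrow> 'm \<Rightarrow> ('s gau cov \<times> 'm \<Rightarrow>\<^sub>0 int) set" where
  "gpair m n = add (adj_t M) (adj_t_el M m) (smul (adj_t M) root_t (adj_t_el M n))"

lemma smul_root_closed: "X \<in> car (adj_t M) \<Longrightarrow> smul (adj_t M) root_t X \<in> car (adj_t M)"
  by (simp add: T.smul_closed scal_adj_t root_t_Rt)

lemma gpair_closed: "m \<in> car M \<Longrightarrow> n \<in> car M \<Longrightarrow> gpair m n \<in> car (adj_t M)"
  unfolding gpair_def by (intro T.add_closed smul_root_closed adj_t_el_closed)

lemma gpair_add:
  assumes "m \<in> car M" "n \<in> car M" "m' \<in> car M" "n' \<in> car M"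
  shows "add (adj_t M) (gpair m n) (gpair m' n') = gpair (add M m m') (add M n n')"
  using assms unfolding gpair_def
  by (simp add: adj_t_el_add T.smul_add_right scal_adj_t root_t_Rt adj_t_el_closed smul_root_closed
      T.add_assoc T.add_left_comm T.add_closed)

lemma adj_t_el_nzero: "adj_t_el M (nzero M) = nzero (adj_t M)"
  using adj_t_el_smul[OF scal_zero nzero_closed] nzero_closed
  by (simp add: smul_zero ext_scal_hom T.smul_zero adj_t_el_closed)

lemma adj_t_el_gpair: "m \<in> car M \<Longrightarrow> adj_t_el M m = gpair m (nzero M)"
  by (simp add: gpair_def adj_t_el_nzero T.smul_nzero scal_adj_t root_t_Rt T.add_nzero adj_t_el_closed)

lemma gpair_smul:
  assumes "c \<in> R\<^sub>t" "m \<in> car M" "n \<in> car M"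
  shows "smul (adj_t M) c (gpair m n) =
    gpair (add M (smul M (re_scal c) m) (smul M (- im_scal c) n))
          (add M (smul M (re_scal c) n) (smul M (im_scal c) m))"
proof -
  let ?B = "adj_t M" and ?e = "adj_t_el M"
  define a where "a = re_scal c"
  define b where "b = im_scal c"
  have ab: "a \<in> scal M" "b \<in> scal M" "- b \<in> scal M" "a \<in> scal M"
    using assms(1) scal_uminus by (auto simp: mem_Rt a_def b_def)
  have c: "c = ext_scal a + root_t * ext_scal b" unfolding a_def b_def by (rule scal_decomp)
  have st: "ext_scal a \<in> scal ?B" "ext_scal b \<in> scal ?B" "root_t \<in> scal ?B" "c \<in> scal ?B"
    "root_t * ext_scal b \<in> scal ?B" "root_t * ext_scal a \<in> scal ?B" "ext_scal (- b) \<in> scal ?B"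
    using ab assms(1) T.scal_mult root_t_Rt ext_scal_Rt by (auto simp: scal_adj_t)
  have "smul ?B c (gpair m n) =
     add ?B (smul ?B c (?e m)) (smul ?B (c * root_t) (?e n))"
    using assms st by (simp add: gpair_def T.smul_add_right T.smul_smul adj_t_el_closed T.smul_closed)
  also have "c * root_t = ext_scal (- b) + root_t * ext_scal a"
  proof -
    have "c * root_t = root_t * ext_scal a + (root_t * root_t) * ext_scal b"
      unfolding c by (simp add: algebra_simps)
    then show ?thesis by (simp add: root_t_sq ext_scal_hom)
  qed
  also have "smul ?B \<dots> (?e n) = add ?B (?e (smul M (- b) n)) (smul ?B root_t (?e (smul M a n)))"
    using assms st ab by (simp add: T.smul_add_left T.smul_smul adj_t_el_closed adj_t_el_smul)
  also have "smul ?B c (?e m) = add ?B (?e (smul M a m)) (smul ?B root_t (?e (smul M b m)))"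
    using assms st ab unfolding c by (simp add: T.smul_add_left T.smul_smul adj_t_el_closed adj_t_el_smul)
  also have "add ?B (add ?B (?e (smul M a m)) (smul ?B root_t (?e (smul M b m))))
       (add ?B (?e (smul M (- b) n)) (smul ?B root_t (?e (smul M a n)))) =
     gpair (add M (smul M a m) (smul M (- b) n)) (add M (smul M b m) (smul M a n))"
    unfolding gpair_def[symmetric] using assms ab by (intro gpair_add) (auto intro: smul_closed)
  finally show ?thesis
    using assms ab by (simp add: a_def b_def add_comm[of "smul M (im_scal c) m"] smul_closed)
qed

lemma gpair_mul:
  assumes "m \<in> car M" "n \<in> car M" "m' \<in> car M" "n' \<in> car M"
  shows "mul (adj_t M) (gpair m n) (gpair m' n') =
    gpair (add M (mul M m m') (smul M (- 1) (mul M n n'))) (add M (mul M m n') (mul M n m'))"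
proof -
  let ?B = "adj_t M" and ?e = "adj_t_el M"
  have r: "root_t \<in> scal ?B" "- 1 \<in> scal ?B"
    using T.scal_uminus[OF T.scal_one] by (simp_all add: scal_adj_t root_t_Rt)
  note closed = adj_t_el_closed T.smul_closed T.add_closed T.mul_closed mul_closed neg_closed add_closed
  have "?e (smul M (- 1) (mul M n n')) = smul ?B (- 1) (?e (mul M n n'))"
    using adj_t_el_smul[OF scal_uminus[OF scal_one], of "mul M n n'"] assms
    by (simp add: ext_scal_hom mul_closed)
  then show ?thesis
    using assms r unfolding gpair_def
    by (simp add: T.mul_add_left T.mul_add_right T.mul_smul_left T.mul_smul_right T.smul_smul closed
        root_t_sq adj_t_el_add T.smul_add_right T.add_assoc T.add_left_comm T.add_comm T.scal_mult flip: adj_t_el_mul)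
qed

lemma gpair_surj:
  assumes "X \<in> car (adj_t M)" obtains m n where "m \<in> car M" "n \<in> car M" "X = gpair m n"
proof -
  have "\<exists>m\<in>car M. \<exists>n\<in>car M. X = gpair m n"
    using assms unfolding adj_t_def
  proof (induction rule: A.base_change_induct)
    case (tens a m)
    have "tens R\<^sub>t ext_scal M a m = smul (adj_t M) a (gpair m (nzero M))"
      using tens adj_t_el_gpair[of m] A.tens_smul[of a 1 m]
      by (simp add: adj_t_el_def adj_t_def)
    then show ?case
      using tens by (simp add: gpair_smul nzero_closed mem_Rt)
        (intro bexI, rule refl, (rule smul_closed add_closed scal_uminus nzero_closed | simp)+)
  next
    case (add X Y)
    then obtain m n m' n' where "m \<in> car M" "n \<in> car M" "m' \<in> car M" "n' \<in> car M"
      "X = gpair m n" "Y = gpair m' n'" by blast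
    then show ?case using gpair_add[of m n m' n'] add_closed[of m m'] add_closed[of n n']
      unfolding adj_t_def by auto
  qed
  with that show ?thesis by blast
qed

lemma gpair_eq_coset: "gpair m n = acoset A.N (frag_of (1, m) + frag_of (root_t, n))"
  using root_t_Rt unfolding gpair_def
  by (simp add: adj_t_el_def adj_t_def A.tens_smul) (simp add: tens_def A.coset_add)

text \<open>
  The real part and the imaginary part of a scalar are linear over the scalars without \<open>t\<close>.
  Each of them therefore gives a balanced map \<open>c \<otimes> m \<mapsto> re(c) m\<close> or \<open>c
  \<otimes> m \<mapsto> im(c) m\<close> into \<open>M\<close>, and these recover \<open>m\<close> and
  \<open>n\<close> from \<open>m + t n\<close>.
\<close>
lemma gpair_inject:
  assumes "m \<in> car M" "n \<in> car M" "m' \<in> car M" "n' \<in> car M"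
  shows "gpair m n = gpair m' n' \<longleftrightarrow> m = m' \<and> n = n'"
proof
  assume eq: "gpair m n = gpair m' n'"
  interpret G: comm_group agrp by (rule agrp_comm_group)
  have co: "m \<otimes>\<^bsub>agrp\<^esub> inv\<^bsub>agrp\<^esub> m = \<one>\<^bsub>agrp\<^esub>" if "m \<in> car M" for m
    using that by (intro G.r_inv) (simp add: agrp_simps)
  have part: "h (1 :: 's gau cov) m \<otimes>\<^bsub>agrp\<^esub> h root_t n = h 1 m' \<otimes>\<^bsub>agrp\<^esub> h root_t n'"
    if h: "h = (\<lambda>c m. smul M (map_cov g c) m)"
      and g: "g = gau_re \<or> g = gau_im" for h g
  proof -
    have gs: "map_cov g c \<in> scal M" if "c \<in> R\<^sub>t" for c
      using g that by (auto simp: mem_Rt)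
    have ga: "map_cov g (a + b) = map_cov g a + map_cov g b"
      "map_cov g (a * ext_scal s) = map_cov g a * s" for a b s
      using g by (auto simp: cov_eq_iff)
    obtain H where H: "\<And>x y. x \<in> A.frags \<Longrightarrow> y \<in> A.frags \<Longrightarrow> H (x + y) = H x \<otimes>\<^bsub>agrp\<^esub> H y"
      "\<And>x y. x \<in> A.frags \<Longrightarrow> y \<in> A.frags \<Longrightarrow> H (x - y) = H x \<otimes>\<^bsub>agrp\<^esub> inv\<^bsub>agrp\<^esub> H y"
      "\<And>a m. a \<in> R\<^sub>t \<Longrightarrow> m \<in> car M \<Longrightarrow> H (frag_of (a, m)) = h a m"
      "\<And>x. x \<in> A.N \<Longrightarrow> H x \<in> {\<one>\<^bsub>agrp\<^esub>}"
      by (rule A.tens_universal[OF agrp_comm_group G.triv_subgroup, of h])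
        (use gs ga co in \<open>auto simp: h agrp_simps smul_add_left smul_add_right smul_closed smul_smul scal_mult\<close>)
    let ?x = "frag_of (1, m) + frag_of (root_t, n)" and ?y = "frag_of (1, m') + frag_of (root_t, n')"
    have fr: "?x \<in> A.frags" "?y \<in> A.frags"
      using assms by (auto intro!: A.frags_add A.frag_of_frags A.T_one root_t_Rt)
    have "acoset A.N ?x = acoset A.N ?y"
      using eq by (simp add: gpair_eq_coset)
    then have "H ?x \<otimes>\<^bsub>agrp\<^esub> inv\<^bsub>agrp\<^esub> H ?y = \<one>\<^bsub>agrp\<^esub>"
      using H(4) H(2)[OF fr] by (simp add: A.coset_eq)
    moreover have "H ?x = h 1 m \<otimes>\<^bsub>agrp\<^esub> h root_t n" "H ?y = h 1 m' \<otimes>\<^bsub>agrp\<^esub> h root_t n'"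
      using assms by (simp_all add: H A.frag_of_frags A.T_one root_t_Rt)
    moreover have "h c m \<in> carrier agrp" if "c \<in> R\<^sub>t" "m \<in> car M" for c m
      using that gs by (simp add: h agrp_simps smul_closed)
    ultimately show ?thesis
      using assms A.T_one root_t_Rt
      by (metis G.inv_closed G.inv_equality G.inv_inv G.m_closed)
  qed
  have sc: "re_scal 1 = (1 :: 's cov)" "im_scal 1 = (0 :: 's cov)" "re_scal root_t = (0 :: 's cov)"
    "im_scal root_t = (1 :: 's cov)"
    by (simp_all add: cov_eq_iff)
  show "m = m' \<and> n = n'"
    using part[OF refl, of gau_re] part[OF refl, of gau_im] assms sc
    by (simp add: agrp_simps smul_one smul_zero nzero_add add_nzero)
qed simp

end

section \<open>Maps between specializations\<close>

text \<open>
  A map \<open>g\<close> that identifies exactly the same elements as the surjection \<open>q\<close>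
  factors through it injectively. The action of the scalars on \<open>S\<close> is a parameter, because a
  scalar \<open>c\<close> of a specialization acts upstairs as the constant \<open>c\<close> of
  \<open>R\<^sup>\<pi>\<close>.
\<close>
lemma factor_through_quotient:
  fixes A :: "('k, 'a) nalg" and B :: "('l, 'b) nalg" and S :: "'c set"
  assumes surj: "\<And>X. X \<in> car A \<Longrightarrow> \<exists>x\<in>S. X = q x"
    and g_closed: "\<And>x. x \<in> S \<Longrightarrow> g x \<in> car B"
    and q_eq: "\<And>x y. x \<in> S \<Longrightarrow> y \<in> S \<Longrightarrow> q x = q y \<longleftrightarrow> g x = g y"
    and ad: "\<And>x y. x \<in> S \<Longrightarrow> y \<in> S \<Longrightarrow>
      ad x y \<in> S \<and> q (ad x y) = add A (q x) (q y) \<and> g (ad x y) = add B (g x) (g y)"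
    and mu: "\<And>x y. x \<in> S \<Longrightarrow> y \<in> S \<Longrightarrow>
      mu x y \<in> S \<and> q (mu x y) = mul A (q x) (q y) \<and> g (mu x y) = mul B (g x) (g y)"
    and sm: "\<And>c x. c \<in> R \<Longrightarrow> x \<in> S \<Longrightarrow>
      sm c x \<in> S \<and> q (sm c x) = smul A c (q x) \<and> g (sm c x) = smul B (j c) (g x)"
  obtains e where "alg_emb R j A B e" "\<And>x. x \<in> S \<Longrightarrow> e (q x) = g x"
proof -
  define e where "e X = g (SOME x. x \<in> S \<and> X = q x)" for X
  have e: "e (q x) = g x" if "x \<in> S" for x
  proof -
    define y where "y = (SOME y. y \<in> S \<and> q x = q y)"
    have "y \<in> S \<and> q x = q y" unfolding y_def by (rule someI[of _ x]) (use that in simp)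
    then show ?thesis using q_eq[of x y] that unfolding e_def y_def[symmetric] by simp
  qed
  have "alg_emb R j A B e"
    unfolding alg_emb_def alg_hom_def
  proof (intro conjI ballI inj_onI)
    fix X assume "X \<in> car A"
    then obtain x where x: "x \<in> S" "X = q x" using surj by blast
    show "e X \<in> car B" using x by (simp add: e g_closed)
    show "e (smul A c X) = smul B (j c) (e X)" if "c \<in> R" for c
      using sm[OF that x(1)] x e[of "sm c x"] e[of x] by simp
    fix Y assume "Y \<in> car A"
    then obtain y where y: "y \<in> S" "Y = q y" using surj by blast
    show "e (add A X Y) = add B (e X) (e Y)"
      using ad[OF x(1) y(1)] x y e[of "ad x y"] e[of x] e[of y] by simp
    show "e (mul A X Y) = mul B (e X) (e Y)"
      using mu[OF x(1) y(1)] x y e[of "mu x y"] e[of x] e[of y] by simp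
    show "X = Y" if "e X = e Y"
      using that x y q_eq by (simp add: e)
  qed
  with e that show ?thesis by blast
qed

lemma alg_emb_comp_iso:
  assumes "alg_emb R j A B f" "alg_iso R' B C g" "j ` R \<subseteq> R'"
  shows "alg_emb R j A C (\<lambda>x. g (f x))"
  using assms unfolding alg_emb_def alg_iso_def alg_hom_def bij_betw_def inj_on_def
  by (auto simp: image_subset_iff)

lemma alg_iso_inverse:
  assumes iso: "alg_iso R A B g"
    and closed: "\<And>x y. x \<in> car A \<Longrightarrow> y \<in> car A \<Longrightarrow> add A x y \<in> car A \<and> mul A x y \<in> car A"
      "\<And>c x. c \<in> R \<Longrightarrow> x \<in> car A \<Longrightarrow> smul A c x \<in> car A"
  shows "alg_iso R B A (inv_into (car A) g)"
proof -
  let ?h = "inv_into (car A) g"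
  have bij: "bij_betw g (car A) (car B)" using iso by (simp add: alg_iso_def)
  have h: "bij_betw ?h (car B) (car A)" using bij by (rule bij_betw_inv_into)
  have hc: "?h X \<in> car A" "g (?h X) = X" if "X \<in> car B" for X
    using that bij by (auto simp: bij_betw_def f_inv_into_f inv_into_into)
  have hg: "?h (g x) = x" if "x \<in> car A" for x
    using that bij by (simp add: bij_betw_def)
  have "alg_hom R (\<lambda>c. c) B A ?h"
    unfolding alg_hom_def
  proof (intro conjI ballI)
    fix X assume X: "X \<in> car B"
    show "?h X \<in> car A" by (rule hc[OF X])
    fix c assume c: "c \<in> R"
    have "g (smul A c (?h X)) = smul B c (g (?h X))"
      using iso c hc(1)[OF X] by (auto simp: alg_iso_def alg_hom_def)
    then show "?h (smul B c X) = smul A c (?h X)"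
      using hg[OF closed(2)[OF c hc(1)[OF X]]] hc(2)[OF X] by simp
  next
    fix X Y assume X: "X \<in> car B" and Y: "Y \<in> car B"
    have g: "g (add A (?h X) (?h Y)) = add B (g (?h X)) (g (?h Y))"
      "g (mul A (?h X) (?h Y)) = mul B (g (?h X)) (g (?h Y))"
      using iso hc(1)[OF X] hc(1)[OF Y] by (auto simp: alg_iso_def alg_hom_def)
    have cl: "add A (?h X) (?h Y) \<in> car A" "mul A (?h X) (?h Y) \<in> car A"
      using closed(1) hc(1)[OF X] hc(1)[OF Y] by blast+
    show "?h (add B X Y) = add A (?h X) (?h Y)" "?h (mul B X Y) = mul A (?h X) (?h Y)"
      using hg[OF cl(1)] hg[OF cl(2)] g hc(2)[OF X] hc(2)[OF Y] by simp_all
  qed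
  with h show ?thesis by (simp add: alg_iso_def)
qed

context pi_algebra
begin

text \<open>
  A bijection that negates \<open>\<pi>\<close> maps the multiples of \<open>\<pi> - 1\<close> exactly onto
  those of \<open>\<pi> + 1\<close>.
\<close>
lemma spec_twist:
  assumes bij: "bij_betw \<psi> (car M) (car M)"
    and add: "\<And>x y. x \<in> car M \<Longrightarrow> y \<in> car M \<Longrightarrow> \<psi> (add M x y) = add M (\<psi> x) (\<psi> y)"
    and mul: "\<And>x y. x \<in> car M \<Longrightarrow> y \<in> car M \<Longrightarrow> \<psi> (mul M x y) = mul M (\<psi> x) (\<psi> y)"
    and pi: "\<And>x. x \<in> car M \<Longrightarrow> \<psi> (smul M ppi x) = smul M (- ppi) (\<psi> x)"
    and R: "R \<subseteq> pi_free M" "- 1 \<in> R"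
    and smul: "\<And>c x. c \<in> R \<Longrightarrow> x \<in> car M \<Longrightarrow> \<psi> (smul M (cov_const c) x) = smul M (cov_const c) (\<psi> x)"
  obtains \<Theta> where "alg_iso R (spec 1 M) (spec (- 1) M) \<Theta>"
    "\<And>x. x \<in> car M \<Longrightarrow> \<Theta> (spec_el 1 M x) = spec_el (- 1) M (\<psi> x)"
proof -
  have \<psi>c: "\<psi> x \<in> car M" if "x \<in> car M" for x
    using bij that by (auto simp: bij_betw_def)
  have sgn: "(1 :: 's) = 1 \<or> (1 :: 's) = - 1" "(- 1 :: 's) = 1 \<or> (- 1 :: 's) = - 1" by simp_all
  have m1: "- 1 \<in> scal M" by (rule scal_uminus[OF scal_one])
  have key: "\<psi> (add M y (smul M (ppi - cov_const 1) k)) =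
      add M (\<psi> y) (smul M (ppi - cov_const (- 1)) (smul M (- 1) (\<psi> k)))"
    if "y \<in> car M" "k \<in> car M" for y k
  proof -
    have "smul M (ppi - cov_const 1) k = add M (smul M ppi k) (smul M (cov_const (- 1)) k)"
      using that m1 smul_add_left[OF ppi_scal m1, of k] by (simp add: cov_const_hom)
    then have "\<psi> (smul M (ppi - cov_const 1) k) =
        add M (smul M (- ppi) (\<psi> k)) (smul M (- 1) (\<psi> k))"
      using that m1 smul[OF R(2), of k] by (simp add: add smul_closed ppi_scal pi cov_const_hom)
    also have "\<dots> = smul M (- ppi + - 1) (\<psi> k)"
      using that \<psi>c m1 scal_uminus[OF ppi_scal] by (simp only: smul_add_left)
    also have "\<dots> = smul M (ppi - cov_const (- 1)) (smul M (- 1) (\<psi> k))"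
      using that \<psi>c m1 ppi_scal scal_one by (simp add: smul_smul cov_const_hom scal_add)
    finally have "\<psi> (smul M (ppi - cov_const 1) k) = smul M (ppi - cov_const (- 1)) (smul M (- 1) (\<psi> k))" .
    then show ?thesis
      using that scal_one by (simp add: add smul_closed scal_diff ppi_scal cov_const_hom)
  qed
  have eq: "spec_el 1 M x = spec_el 1 M y \<longleftrightarrow> spec_el (- 1) M (\<psi> x) = spec_el (- 1) M (\<psi> y)"
    if xy: "x \<in> car M" "y \<in> car M" for x y
  proof
    assume "spec_el 1 M x = spec_el 1 M y"
    then obtain k where k: "k \<in> car M" "x = add M y (smul M (ppi - cov_const 1) k)"
      using spec_el_eq_iff[OF sgn(1)] xy by blast
    have "\<psi> x = add M (\<psi> y) (smul M (ppi - cov_const (- 1)) (smul M (- 1) (\<psi> k)))"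
      unfolding k(2) by (rule key[OF xy(2) k(1)])
    then show "spec_el (- 1) M (\<psi> x) = spec_el (- 1) M (\<psi> y)"
      using spec_el_eq_iff[OF sgn(2) \<psi>c[OF xy(1)] \<psi>c[OF xy(2)]] neg_closed[OF \<psi>c[OF k(1)]] by blast
  next
    assume "spec_el (- 1) M (\<psi> x) = spec_el (- 1) M (\<psi> y)"
    then obtain l where l: "l \<in> car M" "\<psi> x = add M (\<psi> y) (smul M (ppi - cov_const (- 1)) l)"
      using spec_el_eq_iff[OF sgn(2)] xy \<psi>c by blast
    have "smul M (- 1) l \<in> \<psi> ` car M"
      using bij neg_closed[OF l(1)] by (simp add: bij_betw_def)
    then obtain k where k: "k \<in> car M" "\<psi> k = smul M (- 1) l" by auto
    have "smul M (- 1) (\<psi> k) = l"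
      using l m1 by (simp add: k smul_smul smul_one)
    then have "\<psi> x = \<psi> (add M y (smul M (ppi - cov_const 1) k))"
      using key[OF xy(2) k(1)] l by simp
    moreover have "add M y (smul M (ppi - cov_const 1) k) \<in> car M"
      using xy k scal_one by (auto intro!: add_closed smul_closed scal_diff ppi_scal simp: cov_const_hom)
    ultimately have "x = add M y (smul M (ppi - cov_const 1) k)"
      using bij xy by (auto simp: bij_betw_def inj_on_def)
    then show "spec_el 1 M x = spec_el 1 M y"
      using xy k by (subst spec_el_eq_iff[OF sgn(1)]) auto
  qed
  have Rs: "cov_const c \<in> scal M" "c \<in> pi_free M" if "c \<in> R" for c
    using that R(1) mem_pi_free by auto
  obtain \<Theta> where \<Theta>: "alg_emb R (\<lambda>c. c) (spec 1 M) (spec (- 1) M) \<Theta>"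
    "\<And>x. x \<in> car M \<Longrightarrow> \<Theta> (spec_el 1 M x) = spec_el (- 1) M (\<psi> x)"
    by (rule factor_through_quotient[where A = "spec 1 M" and B = "spec (- 1) M" and S = "car M"
          and q = "spec_el 1 M" and g = "\<lambda>x. spec_el (- 1) M (\<psi> x)"
          and ad = "add M" and mu = "mul M" and sm = "\<lambda>c. smul M (cov_const c)"
          and R = R and j = "\<lambda>c. c"])
      (use eq \<psi>c Rs in \<open>auto elim: spec_el_surj[OF sgn(1)]
        simp: spec_el_closed[OF sgn(2)] add mul smul add_closed mul_closed smul_closed
          spec_el_add[OF sgn(1)] spec_el_add[OF sgn(2)] spec_el_mul[OF sgn(1)] spec_el_mul[OF sgn(2)]
          spec_el_smul[OF sgn(1)] spec_el_smul[OF sgn(2)]\<close>)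
  have "car (spec (- 1) M) \<subseteq> \<Theta> ` car (spec 1 M)"
  proof
    fix X assume "X \<in> car (spec (- 1) M)"
    then obtain y where y: "y \<in> car M" "X = spec_el (- 1) M y" by (rule spec_el_surj[OF sgn(2)])
    then obtain x where "x \<in> car M" "y = \<psi> x" using bij by (auto simp: bij_betw_def)
    then show "X \<in> \<Theta> ` car (spec 1 M)"
      using y \<Theta>(2) spec_el_closed[OF sgn(1)] by (metis imageI)
  qed
  then have "alg_iso R (spec 1 M) (spec (- 1) M) \<Theta>"
    using \<Theta>(1) by (auto simp: alg_iso_def alg_emb_def alg_hom_def bij_betw_def)
  with \<Theta>(2) that show ?thesis by blast
qed

interpretation T: pi_algebra "adj_t M"
  by (rule adj_t_pi_algebra)

text \<open>
  If \<open>x - y\<close> is \<open>(\<pi> - s) (k + t l)\<close> with \<open>x\<close> and \<open>y\<close>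
  free of \<open>t\<close>, then comparing the components free of \<open>t\<close> gives \<open>x - y =
  (\<pi> - s) k\<close>.
\<close>
lemma spec_adj_t_embedding:
  assumes s: "s = 1 \<or> s = - 1" and Q: "Q \<subseteq> pi_free M"
  obtains e where "alg_emb Q of_base (spec s M) (spec (of_base s) (adj_t M)) e"
    "\<And>u. u \<in> car M \<Longrightarrow> e (spec_el s M u) = spec_el (of_base s) (adj_t M) (adj_t_el M u)"
proof -
  let ?s = "of_base s :: 's gau"
  have s': "?s = 1 \<or> ?s = - 1" using s by (auto simp: of_base_hom)
  have ss: "ppi - cov_const s \<in> scal M"
    using s_pi_free[OF s] by (simp add: ppi_scal scal_diff mem_pi_free)
  have es: "(ppi - cov_const ?s :: 's gau cov) = ext_scal (ppi - cov_const s)"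
    by (simp add: cov_eq_iff of_base_hom)
  have eq: "spec_el s M x = spec_el s M y \<longleftrightarrow>
      spec_el ?s (adj_t M) (adj_t_el M x) = spec_el ?s (adj_t M) (adj_t_el M y)"
    if xy: "x \<in> car M" "y \<in> car M" for x y
  proof
    assume "spec_el s M x = spec_el s M y"
    then obtain k where "k \<in> car M" "x = add M y (smul M (ppi - cov_const s) k)"
      using spec_el_eq_iff[OF s] xy by blast
    then show "spec_el ?s (adj_t M) (adj_t_el M x) = spec_el ?s (adj_t M) (adj_t_el M y)"
      using xy ss es by (subst T.spec_el_eq_iff[OF s'])
        (auto simp: adj_t_el_closed adj_t_el_add smul_closed adj_t_el_smul T.add_closed T.smul_closed
          scal_adj_t ext_scal_Rt)
  next
    assume "spec_el ?s (adj_t M) (adj_t_el M x) = spec_el ?s (adj_t M) (adj_t_el M y)"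
    then obtain K where K: "K \<in> car (adj_t M)"
      "adj_t_el M x = add (adj_t M) (adj_t_el M y) (smul (adj_t M) (ext_scal (ppi - cov_const s)) K)"
      using T.spec_el_eq_iff[OF s'] xy adj_t_el_closed es by metis
    obtain k l where kl: "k \<in> car M" "l \<in> car M" "K = gpair k l"
      using K(1) by (rule gpair_surj)
    have im0: "im_scal (ext_scal c) = 0" "re_scal (ext_scal c) = c" for c :: "'s cov"
      by (simp_all add: cov_eq_iff)
    have "gpair x (nzero M) = gpair (add M y (smul M (ppi - cov_const s) k)) (smul M (ppi - cov_const s) l)"
      using K(2) kl xy ss ext_scal_Rt[OF ss]
      by (simp add: adj_t_el_gpair gpair_smul gpair_add im0 smul_zero add_nzero nzero_add smul_closed
          nzero_closed)
    then have "x = add M y (smul M (ppi - cov_const s) k)"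
      using kl xy ss by (simp add: gpair_inject nzero_closed smul_closed add_closed)
    then show "spec_el s M x = spec_el s M y"
      using xy kl by (subst spec_el_eq_iff[OF s]) auto
  qed
  have Qs: "cov_const c \<in> scal M" "c \<in> pi_free M" "of_base c \<in> pi_free (adj_t M)"
    "ext_scal (cov_const c) = cov_const (of_base c)" if "c \<in> Q" for c
    using that Q pi_free_zero by (auto simp: pi_free_adj_t mem_gau_ring mem_pi_free cov_eq_iff of_base_hom)
  show ?thesis
    by (rule factor_through_quotient[where A = "spec s M" and B = "spec ?s (adj_t M)" and S = "car M"
          and q = "spec_el s M" and g = "\<lambda>x. spec_el ?s (adj_t M) (adj_t_el M x)"
          and ad = "add M" and mu = "mul M" and sm = "\<lambda>c. smul M (cov_const c)"
          and R = Q and j = of_base])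
      (use eq Qs that in \<open>auto elim: spec_el_surj[OF s]
        simp: T.spec_el_closed[OF s'] adj_t_el_closed add_closed mul_closed smul_closed
          spec_el_add[OF s] T.spec_el_add[OF s'] spec_el_mul[OF s] T.spec_el_mul[OF s']
          spec_el_smul[OF s] T.spec_el_smul[OF s'] adj_t_el_add adj_t_el_mul adj_t_el_smul\<close>)
qed

lemma spec_twist_embeddings:
  assumes iso: "alg_iso R (spec 1 (adj_t M)) (spec (- 1) (adj_t M)) \<Theta>"
    and R: "R \<subseteq> pi_free (adj_t M)" and Q: "Q \<subseteq> pi_free M" "of_base ` Q \<subseteq> R"
  shows "\<exists>e. alg_emb Q of_base (spec 1 M) (spec (- 1) (adj_t M)) e \<and>
      (\<forall>u\<in>car M. e (spec_el 1 M u) = \<Theta> (spec_el 1 (adj_t M) (adj_t_el M u)))"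
    and "\<exists>e. alg_emb Q of_base (spec (- 1) M) (spec 1 (adj_t M)) e \<and>
      (\<forall>u\<in>car M. \<Theta> (e (spec_el (- 1) M u)) = spec_el (- 1) (adj_t M) (adj_t_el M u))"
proof -
  have ob: "of_base (1 :: 's) = 1" "of_base (- 1 :: 's) = - 1" by (simp_all add: of_base_hom)
  obtain e where e: "alg_emb Q of_base (spec 1 M) (spec 1 (adj_t M)) e"
    "\<And>u. u \<in> car M \<Longrightarrow> e (spec_el 1 M u) = spec_el 1 (adj_t M) (adj_t_el M u)"
    using spec_adj_t_embedding[of 1, unfolded ob] Q(1) by blast
  show "\<exists>e. alg_emb Q of_base (spec 1 M) (spec (- 1) (adj_t M)) e \<and>
      (\<forall>u\<in>car M. e (spec_el 1 M u) = \<Theta> (spec_el 1 (adj_t M) (adj_t_el M u)))"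
    by (rule exI[of _ "\<lambda>x. \<Theta> (e x)"]) (use alg_emb_comp_iso[OF e(1) iso Q(2)] e(2) in simp)
  obtain e' where e': "alg_emb Q of_base (spec (- 1) M) (spec (- 1) (adj_t M)) e'"
    "\<And>u. u \<in> car M \<Longrightarrow> e' (spec_el (- 1) M u) = spec_el (- 1) (adj_t M) (adj_t_el M u)"
    using spec_adj_t_embedding[of "- 1", unfolded ob] Q(1) by blast
  interpret S: base_change_setting "adj_t M" "pi_free (adj_t M)" "cov_eval 1"
    by (rule T.spec_setting) simp
  interpret S: nalgebra "spec 1 (adj_t M)"
    unfolding spec_def by (rule S.base_change_nalgebra)
  have "scal (spec 1 (adj_t M)) = pi_free (adj_t M)"
    unfolding spec_def by (rule S.scal_B)
  then have inv: "alg_iso R (spec (- 1) (adj_t M)) (spec 1 (adj_t M)) (inv_into (car (spec 1 (adj_t M))) \<Theta>)"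
    using R by (intro alg_iso_inverse[OF iso]) (auto intro: S.add_closed S.mul_closed S.smul_closed)
  have cl: "spec_el (- 1) (adj_t M) (adj_t_el M u) \<in> car (spec (- 1) (adj_t M))" if "u \<in> car M" for u
    using that by (intro T.spec_el_closed adj_t_el_closed) auto
  have "\<Theta> ` car (spec 1 (adj_t M)) = car (spec (- 1) (adj_t M))"
    using iso by (simp add: alg_iso_def bij_betw_def)
  then show "\<exists>e. alg_emb Q of_base (spec (- 1) M) (spec 1 (adj_t M)) e \<and>
      (\<forall>u\<in>car M. \<Theta> (e (spec_el (- 1) M u)) = spec_el (- 1) (adj_t M) (adj_t_el M u))"
    by (intro exI[of _ "\<lambda>x. inv_into (car (spec 1 (adj_t M))) \<Theta> (e' x)"])
      (use alg_emb_comp_iso[OF e'(1) inv Q(2)] e'(2) cl in \<open>simp add: f_inv_into_f\<close>)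
qed

end

section \<open>The twist of the scalars\<close>

lemma Fract_pCons: "Fract (pCons a p) 1 = ofQ a + vv * Fract p 1"
  by (simp add: ofQ_def vv_def)

lemma ofQ_hom: "ofQ (a + b) = ofQ a + ofQ b" "ofQ (a * b) = ofQ a * ofQ b" "ofQ 0 = 0" "ofQ 1 = 1"
  "ofQ (- a) = - ofQ a"
  by (simp_all add: ofQ_def Zero_fract_def One_fract_def mult.commute)
    (simp_all flip: one_pCons add: minus_fract)

lemma ofQ_of_int: "ofQ (of_int a) = of_int a"
  by (induction a rule: int_induct[of _ 0]) (simp_all add: ofQ_hom diff_conv_add_uminus del: add_uminus_conv_diff)

lemma vv_nonzero: "vv \<noteq> 0"
  by (simp add: vv_def Zero_fract_def eq_fract)

definition ofQt :: "rat \<Rightarrow> Qvt" where "ofQt a = of_base (ofQ a)"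

lemma ofQt_hom: "ofQt (a + b) = ofQt a + ofQt b" "ofQt (a * b) = ofQt a * ofQt b"
  "ofQt 0 = 0" "ofQt 1 = 1"
  by (simp_all add: ofQt_def ofQ_hom of_base_hom)

text \<open>
  The substitution \<open>v \<mapsto> t\<^sup>-\<^sup>1 v\<close> on \<open>\<rat>[v]\<close>; note
  \<open>t\<^sup>-\<^sup>1 = - t\<close>.
\<close>
definition twist_poly :: "rat poly \<Rightarrow> Qvt" where
  "twist_poly p = poly (map_poly ofQt p) (Gau 0 (- vv))"

lemma twist_poly_pCons: "twist_poly (pCons a p) = ofQt a + Gau 0 (- vv) * twist_poly p"
  by (simp add: twist_poly_def map_poly_pCons ofQt_hom)

lemma twist_poly_0: "twist_poly 0 = 0"
  by (simp add: twist_poly_def)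

lemma twist_poly_add: "twist_poly (p + q) = twist_poly p + twist_poly q"
  by (induction p q rule: poly_induct2)
    (simp_all add: twist_poly_pCons twist_poly_0 ofQt_hom algebra_simps)

lemma twist_poly_smult: "twist_poly (smult a p) = ofQt a * twist_poly p"
  by (induction p) (simp_all add: twist_poly_pCons twist_poly_0 ofQt_hom algebra_simps)

lemma twist_poly_mult: "twist_poly (p * q) = twist_poly p * twist_poly q"
  by (induction p)
    (simp_all add: twist_poly_pCons twist_poly_0 twist_poly_add twist_poly_smult ofQt_hom algebra_simps)

lemma twist_poly_const: "twist_poly [:a:] = ofQt a"
  by (simp add: twist_poly_pCons twist_poly_0)

text \<open>
  Since \<open>t\<^sup>-\<^sup>n\<close> is one of \<open>\<plusminus> 1\<close>, \<open>\<plusminus> t\<close>, each coefficient ends up, with a sign, in exactly one of the two components.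
  The sum of squares records this without a case distinction modulo 4. It shows that the substitution is injective and hence
  extends to fractions.
\<close>
lemma twist_poly_components:
  "\<exists>P Q. twist_poly p = Gau (Fract P 1) (Fract Q 1) \<and>
     (\<forall>n. coeff P n ^ 2 + coeff Q n ^ 2 = coeff p n ^ 2)"
proof (induction p)
  case 0
  show ?case
    by (rule exI[of _ 0])+ (simp add: twist_poly_0 zero_gau_def Zero_fract_def)
next
  case (pCons a p)
  then obtain P Q where PQ: "twist_poly p = Gau (Fract P 1) (Fract Q 1)"
    "\<And>n. coeff P n ^ 2 + coeff Q n ^ 2 = coeff p n ^ 2" by blast
  have "twist_poly (pCons a p) = Gau (Fract (pCons a Q) 1) (Fract (pCons 0 (- P)) 1)"
  proof -
    have "Fract (pCons 0 (- P)) 1 = - (vv * Fract P 1)"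
      by (simp add: Fract_pCons ofQ_hom flip: minus_fract)
    then show ?thesis
      by (simp add: twist_poly_pCons PQ gau_eq_iff ofQt_def Fract_pCons)
  qed
  moreover have "coeff (pCons a Q) n ^ 2 + coeff (pCons 0 (- P)) n ^ 2 = coeff (pCons a p) n ^ 2" for n
    using PQ(2)[of "n - 1"] by (cases n) (simp_all add: add.commute)
  ultimately show ?case by blast
qed

lemma twist_poly_eq_0: "twist_poly p = 0 \<longleftrightarrow> p = 0"
proof
  assume "twist_poly p = 0"
  moreover obtain P Q where PQ: "twist_poly p = Gau (Fract P 1) (Fract Q 1)"
    "\<And>n. coeff P n ^ 2 + coeff Q n ^ 2 = coeff p n ^ 2" using twist_poly_components by blast
  ultimately have "P = 0" "Q = 0"
    by (simp_all add: gau_eq_iff Zero_fract_def eq_fract)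
  then have "coeff p n = 0" for n using PQ(2)[of n] by simp
  then show "p = 0" by (simp add: poly_eq_iff)
qed (simp add: twist_poly_0)

definition twist_Qv :: "Qv \<Rightarrow> Qvt" where
  "twist_Qv x = (let (p, q) = (SOME (p, q). x = Fract p q \<and> q \<noteq> 0) in twist_poly p / twist_poly q)"

lemma twist_Qv_Fract: "q \<noteq> 0 \<Longrightarrow> twist_Qv (Fract p q) = twist_poly p / twist_poly q"
proof -
  assume q: "q \<noteq> 0"
  define z where "z = (SOME (p', q'). Fract p q = Fract p' q' \<and> q' \<noteq> 0)"
  have "case z of (p', q') \<Rightarrow> Fract p q = Fract p' q' \<and> q' \<noteq> 0"
    unfolding z_def by (rule someI[of _ "(p, q)"]) (use q in simp)
  then have z: "Fract p q = Fract (fst z) (snd z)" "snd z \<noteq> 0" by (auto split: prod.splits)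
  then have "p * snd z = fst z * q" using q by (simp add: eq_fract)
  then have "twist_poly p * twist_poly (snd z) = twist_poly (fst z) * twist_poly q"
    by (simp flip: twist_poly_mult)
  moreover have "twist_Qv (Fract p q) = twist_poly (fst z) / twist_poly (snd z)"
    unfolding twist_Qv_def z_def[symmetric] by (simp add: case_prod_beta)
  ultimately show ?thesis
    using z(2) q by (simp add: twist_poly_eq_0 frac_eq_eq)
qed

lemma twist_Qv_add: "twist_Qv (x + y) = twist_Qv x + twist_Qv y"
  by (cases x; cases y)
    (simp add: twist_Qv_Fract twist_poly_add twist_poly_mult twist_poly_eq_0 divide_simps)

lemma twist_Qv_mult: "twist_Qv (x * y) = twist_Qv x * twist_Qv y"
  by (cases x; cases y) (simp add: twist_Qv_Fract twist_poly_mult)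

lemma twist_poly_1: "twist_poly 1 = 1"
  by (simp add: one_pCons twist_poly_const ofQt_hom)

lemma twist_Qv_ofQ: "twist_Qv (ofQ a) = ofQt a"
  by (simp add: ofQ_def twist_Qv_Fract twist_poly_const twist_poly_1)

lemma twist_Qv_vv: "twist_Qv vv = Gau 0 (- vv)"
  by (simp add: vv_def twist_Qv_Fract twist_poly_pCons twist_poly_1 twist_poly_0 ofQt_hom)

definition twist_Qvt :: "Qvt \<Rightarrow> Qvt" where
  "twist_Qvt x = twist_Qv (gau_re x) + Gau 0 1 * twist_Qv (gau_im x)"

definition twist_scal :: "Qvt cov \<Rightarrow> Qvt cov" where
  "twist_scal c = Cov (twist_Qvt (cov_re c)) (- twist_Qvt (cov_pi c))"

lemma twist_Qv_0: "twist_Qv 0 = 0"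
  using twist_Qv_ofQ[of 0] by (simp add: ofQ_hom ofQt_hom)

lemma twist_Qv_diff: "twist_Qv (x - y) = twist_Qv x - twist_Qv y"
  using twist_Qv_add[of "x - y" y] by simp

lemma twist_Qvt_hom:
  "twist_Qvt (x + y) = twist_Qvt x + twist_Qvt y"
  "twist_Qvt (x * y) = twist_Qvt x * twist_Qvt y"
proof -
  show "twist_Qvt (x + y) = twist_Qvt x + twist_Qvt y"
    by (simp add: twist_Qvt_def twist_Qv_add algebra_simps)
  have "Gau 0 1 * (Gau 0 1 * z) = - z" for z :: Qvt by (simp add: gau_eq_iff)
  from this[of "twist_Qv (gau_im x) * twist_Qv (gau_im y)"] show "twist_Qvt (x * y) = twist_Qvt x * twist_Qvt y"
    by (simp add: twist_Qvt_def twist_Qv_add twist_Qv_diff twist_Qv_mult algebra_simps)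
qed

lemma twist_scal_add: "twist_scal (c + d) = twist_scal c + twist_scal d"
  by (simp add: cov_eq_iff twist_scal_def twist_Qvt_hom)

lemma twist_scal_mult: "twist_scal (c * d) = twist_scal c * twist_scal d"
  by (simp add: cov_eq_iff twist_scal_def twist_Qvt_hom)

lemma twist_scal_0: "twist_scal 0 = 0"
  using twist_scal_add[of 0 0] by simp

lemma twist_scal_Qt: "c \<in> Qt \<Longrightarrow> twist_scal (cov_const c) = cov_const c"
  by (auto simp: Qt_def mem_gau_ring twist_scal_def cov_eq_iff twist_Qvt_def twist_Qv_ofQ twist_Qv_0
      ofQt_def gau_eq_iff)

lemma Qt_simps: "1 \<in> Qt" "- 1 \<in> Qt" "Gau 0 1 \<in> Qt"
  unfolding Qt_def mem_gau_ring
  by (auto simp flip: ofQ_hom(3,4,5))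

lemma twist_scal_1: "twist_scal 1 = 1"
  using twist_scal_Qt[OF Qt_simps(1)] by (simp add: cov_const_hom)

lemma twist_scal_diff: "twist_scal (c - d) = twist_scal c - twist_scal d"
  using twist_scal_add[of "c - d" d] by simp

lemma twist_scal_minus: "twist_scal (- d) = - twist_scal d"
  using twist_scal_diff[of 0 d] by (simp add: twist_scal_0)

lemma twist_scal_ppi: "twist_scal ppi = - ppi"
  using twist_Qv_ofQ[of 1]
  by (simp add: twist_scal_def cov_eq_iff twist_Qvt_def twist_Qv_0 ofQ_hom ofQt_hom)

text \<open>
  Integer powers are taken in the field \<open>\<rat>(v,t)\<close>, where their laws are available;
  \<open>\<rat>(v,t)\<^sup>\<pi>\<close> has zero divisors.
\<close>
definition tpow :: "int \<Rightarrow> Qvt cov" where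
  "tpow k = cov_const (Gau 0 1 powi k)"

lemma root_t_nonzero: "(Gau 0 1 :: Qvt) \<noteq> 0"
  by (simp add: gau_eq_iff)

lemma cov_const_powi: "cov_const a powi k = cov_const (a powi k)" for a :: "'a::field"
proof -
  have pow: "cov_const b ^ n = cov_const (b ^ n)" for b :: 'a and n
    by (induction n) (simp_all add: cov_const_hom)
  have "inverse (cov_const a) = cov_const (inverse a)"
    by (cases "a = 0") (simp_all add: inverse_cov_def cov_const_def power2_eq_square divide_simps)
  then show ?thesis by (simp add: power_int_def pow)
qed

lemma tT_powi: "tT powi k = tpow k"
  by (simp add: tT_def tpow_def cov_const_powi)

lemma tpow_add: "tpow (k + l) = tpow k * tpow l"
  by (simp add: tpow_def power_int_add root_t_nonzero cov_const_hom)

lemma tpow_0: "tpow 0 = 1"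
  by (simp add: tpow_def cov_const_hom)

lemma tpow_1: "tpow 1 = root_t"
  by (simp add: tpow_def root_t_def)

lemma tpow_2: "tpow 2 = - 1"
  using tpow_add[of 1 1] by (simp add: tpow_1 root_t_sq)

lemma tpow_4: "tpow (4 * k) = 1"
proof -
  have "tpow (4 * k) = cov_const ((Gau 0 1 powi 4) powi k)"
    by (simp add: tpow_def power_int_mult)
  also have "(Gau 0 1 :: Qvt) powi 4 = 1"
    using tpow_add[of 2 2] by (simp add: tpow_2) (simp add: tpow_def cov_eq_iff)
  finally show ?thesis by (simp add: cov_const_hom)
qed

lemma tpow_cong: "4 dvd k - l \<Longrightarrow> tpow k = tpow l"
  using tpow_add[of "k - l" l] tpow_4 by (auto elim!: dvdE)

lemma tpow_inverse: "tpow k * tpow (- k) = 1" "tpow (- k) * tpow k = 1"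
  using tpow_add[of k "- k"] tpow_add[of "- k" k] by (simp_all add: tpow_0)

lemma tpow_cases: "tpow k \<in> {1, root_t, - 1, - root_t}"
proof -
  have "tpow k = tpow (k mod 4)" by (rule tpow_cong) (simp add: mod_eq_dvd_iff flip: mod_eq_dvd_iff)
  moreover have "k mod 4 \<in> {0, 1, 2, 3}" by auto
  moreover have "tpow 3 = - root_t" using tpow_add[of 2 1] by (simp add: tpow_1 tpow_2)
  ultimately show ?thesis using tpow_0 tpow_1 tpow_2 by auto
qed

lemma twist_scal_tpow: "twist_scal (tpow k) = tpow k"
proof -
  have "twist_scal root_t = root_t"
    unfolding root_t_def by (rule twist_scal_Qt[OF Qt_simps(3)])
  then show ?thesis using tpow_cases[of k] by (auto simp: twist_scal_minus twist_scal_1)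
qed

lemma twist_scal_vT: "twist_scal vT = tpow (- 1) * vT"
proof -
  have "tpow (- 1) = tpow 2 * tpow 1"
    using tpow_cong[of "- 1" 3] tpow_add[of 2 1] by simp
  then have "tpow (- 1) = - root_t" by (simp add: tpow_1 tpow_2)
  then show ?thesis
    by (simp add: vT_def cov_eq_iff twist_scal_def twist_Qvt_def twist_Qv_vv twist_Qv_0 gau_eq_iff)
qed

text \<open>
  A property of scalars that is preserved by sums, products and inverses has to be checked only on
  \<open>\<rat>(t)\<close>, \<open>\<pi>\<close> and \<open>v\<close>. This serves to compare semilinear
  maps.
\<close>
lemma scal_generated:
  fixes c :: "Qvt cov"
  assumes add: "\<And>c d. c \<in> S \<Longrightarrow> d \<in> S \<Longrightarrow> c + d \<in> S"
    and mult: "\<And>c d. c \<in> S \<Longrightarrow> d \<in> S \<Longrightarrow> c * d \<in> S"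
    and inv: "\<And>c d. c \<in> S \<Longrightarrow> c * d = 1 \<Longrightarrow> d \<in> S"
    and gens: "cov_const ` Qt \<subseteq> S" "ppi \<in> S" "vT \<in> S"
  shows "c \<in> S"
proof -
  have Q: "cov_const (ofQt a) \<in> S" for a
    using gens(1) by (force simp: Qt_def mem_gau_ring ofQt_def simp flip: ofQ_hom(3))
  have poly: "cov_const (of_base (Fract p 1)) \<in> S" for p
  proof (induction p)
    case 0
    then show ?case using Q[of 0] by (simp add: ofQt_hom Zero_fract_def[symmetric] of_base_hom)
  next
    case (pCons a p)
    have "cov_const (of_base (Fract (pCons a p) 1)) =
      cov_const (ofQt a) + vT * cov_const (of_base (Fract p 1))"
      by (simp add: Fract_pCons of_base_hom cov_const_hom ofQt_def vT_def)
    then show ?case using pCons Q gens by (simp add: add mult)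
  qed
  have base: "cov_const (of_base x) \<in> S" for x
  proof (cases x)
    case (Fract p q)
    have "Fract 1 q * Fract q 1 = 1" using Fract by (simp add: One_fract_def eq_fract)
    then have "cov_const (of_base (Fract q 1)) * cov_const (of_base (Fract 1 q)) = 1"
      by (simp add: mult.commute cov_const_hom of_base_hom flip: cov_const_hom(3) of_base_hom(3))
    then have "cov_const (of_base (Fract 1 q)) \<in> S" using poly inv by blast
    moreover have "cov_const (of_base x) = cov_const (of_base (Fract p 1)) * cov_const (of_base (Fract 1 q))"
      by (simp add: Fract flip: cov_const_hom(3) of_base_hom(3))
    ultimately show ?thesis using poly mult by metis
  qed
  have t: "root_t \<in> S" using gens(1) Qt_simps(3) by (auto simp: root_t_def)
  have gau: "cov_const x \<in> S" for x
  proof -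
    have "cov_const x = cov_const (of_base (gau_re x)) + root_t * cov_const (of_base (gau_im x))"
      by (simp add: cov_eq_iff gau_eq_iff)
    then show ?thesis using base t by (simp add: add mult)
  qed
  have "c = cov_const (cov_re c) + ppi * cov_const (cov_pi c)"
    by (simp add: cov_eq_iff)
  then show ?thesis using gau gens add mult by metis
qed

lemma twist_scal_order_4: "twist_scal (twist_scal (twist_scal (twist_scal c))) = c"
proof -
  let ?f = "\<lambda>c. twist_scal (twist_scal (twist_scal (twist_scal c)))"
  have "c \<in> {c. ?f c = c}"
  proof (rule scal_generated)
    fix c d :: "Qvt cov" assume "c \<in> {c. ?f c = c}" and cd: "c * d = 1"
    then have c: "?f c = c" by blast
    have "c * ?f d = ?f c * ?f d" by (simp only: c)
    also have "\<dots> = ?f (c * d)" by (simp only: twist_scal_mult)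
    also have "\<dots> = 1" by (simp add: cd twist_scal_1)
    finally have "d * (c * ?f d) = d" by simp
    then have "(c * d) * ?f d = d" by (simp only: ac_simps)
    then show "d \<in> {c. ?f c = c}" by (simp add: cd)
  next
    have "?f vT = tpow (4 * (- 1)) * vT"
      by (simp add: twist_scal_vT twist_scal_mult twist_scal_tpow mult.assoc[symmetric] tpow_add[symmetric])
    then show "vT \<in> {c. ?f c = c}" by (simp only: tpow_4) simp
  qed (auto simp: twist_scal_add twist_scal_mult twist_scal_Qt twist_scal_ppi twist_scal_minus)
  then show ?thesis by simp
qed

section \<open>Integrality of the scalar twist\<close>

lemma map_poly_of_int_add: "map_poly of_int (p + q) = map_poly of_int p + (map_poly of_int q :: rat poly)"
  by (rule poly_eqI) (simp add: coeff_map_poly)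

lemma map_poly_of_int_mult: "map_poly of_int (p * q) = map_poly of_int p * (map_poly of_int q :: rat poly)"
  by (rule poly_eqI) (simp add: coeff_map_poly coeff_mult)

lemma map_poly_of_int_uminus: "map_poly of_int (- p) = - (map_poly of_int p :: rat poly)"
  by (rule poly_eqI) (simp add: coeff_map_poly)

lemma monom_nonzero: "monom (1 :: rat) n \<noteq> 0" by simp

lemma map_poly_of_int_monom: "map_poly of_int (monom 1 n) = (monom 1 n :: rat poly)"
  by (rule poly_eqI) (simp add: coeff_map_poly)

lemma Zv_intro: "Fract (map_poly rat_of_int p) (monom 1 n) \<in> Zv"
  by (auto simp: Zv_def)

lemma Zv_add: assumes "x \<in> Zv" "y \<in> Zv" shows "x + y \<in> Zv"
proof -
  obtain p n q m where "x = Fract (map_poly rat_of_int p) (monom 1 n)"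
    "y = Fract (map_poly rat_of_int q) (monom 1 m)" using assms by (auto simp: Zv_def)
  then have "x + y = Fract (map_poly rat_of_int (p * monom 1 m + q * monom 1 n)) (monom 1 (n + m))"
    by (simp add: map_poly_of_int_add map_poly_of_int_mult map_poly_of_int_monom mult_monom monom_nonzero)
  then show ?thesis using Zv_intro by metis
qed

lemma Zv_mult: assumes "x \<in> Zv" "y \<in> Zv" shows "x * y \<in> Zv"
proof -
  obtain p n q m where "x = Fract (map_poly rat_of_int p) (monom 1 n)"
    "y = Fract (map_poly rat_of_int q) (monom 1 m)" using assms by (auto simp: Zv_def)
  then have "x * y = Fract (map_poly rat_of_int (p * q)) (monom 1 (n + m))"
    by (simp add: map_poly_of_int_mult mult_monom)
  then show ?thesis using Zv_intro by metis
qed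

lemma Zv_uminus: assumes "x \<in> Zv" shows "- x \<in> Zv"
proof -
  obtain p n where "x = Fract (map_poly rat_of_int p) (monom 1 n)" using assms by (auto simp: Zv_def)
  then have "- x = Fract (map_poly rat_of_int (- p)) (monom 1 n)"
    by (simp add: map_poly_of_int_uminus)
  then show ?thesis using Zv_intro by metis
qed

lemma Zv_of_int: "of_int a \<in> Zv"
proof -
  have "of_int a = Fract (map_poly rat_of_int [:a:]) (monom 1 0)"
    by (simp add: map_poly_pCons ofQ_def[symmetric] ofQ_of_int monom_0 flip: one_pCons)
  then show ?thesis using Zv_intro by metis
qed

lemma Zv_vv: "vv \<in> Zv" "inverse vv \<in> Zv"
proof -
  have "vv = Fract (map_poly rat_of_int [:0, 1:]) (monom 1 0)"
    by (simp add: map_poly_pCons vv_def monom_0 flip: one_pCons)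
  then show "vv \<in> Zv" using Zv_intro by metis
  have "inverse vv = Fract (map_poly rat_of_int [:1:]) (monom 1 1)"
    by (simp add: map_poly_pCons vv_def monom_altdef one_pCons)
  then show "inverse vv \<in> Zv" using Zv_intro by metis
qed

lemma Zv_0_1: "0 \<in> Zv" "1 \<in> Zv"
  using Zv_of_int[of 0] Zv_of_int[of 1] by simp_all

lemma Zv_diff: "x \<in> Zv \<Longrightarrow> y \<in> Zv \<Longrightarrow> x - y \<in> Zv"
  using Zv_add[of x "- y"] Zv_uminus by simp

lemma gau_Zv_closed:
  "x \<in> gau_ring Zv \<Longrightarrow> y \<in> gau_ring Zv \<Longrightarrow> x + y \<in> gau_ring Zv"
  "x \<in> gau_ring Zv \<Longrightarrow> y \<in> gau_ring Zv \<Longrightarrow> x * y \<in> gau_ring Zv"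
  "x \<in> gau_ring Zv \<Longrightarrow> - x \<in> gau_ring Zv"
  "x \<in> gau_ring Zv \<Longrightarrow> y \<in> gau_ring Zv \<Longrightarrow> x - y \<in> gau_ring Zv"
  by (simp_all add: mem_gau_ring Zv_add Zv_mult Zv_diff Zv_uminus)

text \<open>
  A Laurent polynomial is a polynomial times \<open>v\<^sup>-\<^sup>n\<close>, and the image of
  \<open>v\<^sup>-\<^sup>1\<close> is \<open>t v\<^sup>-\<^sup>1\<close>.
\<close>
lemma twist_Qv_integral: "x \<in> Zv \<Longrightarrow> twist_Qv x \<in> gau_ring Zv"
proof -
  assume "x \<in> Zv"
  then obtain p n where x: "x = Fract (map_poly rat_of_int p) (monom 1 n)" by (auto simp: Zv_def)
  have p: "twist_poly (map_poly rat_of_int p) \<in> gau_ring Zv"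
  proof (induction p)
    case 0
    then show ?case by (simp add: twist_poly_0 mem_gau_ring Zv_0_1)
  next
    case (pCons a p)
    then show ?case
      by (simp add: map_poly_pCons twist_poly_pCons mem_gau_ring ofQt_def ofQ_of_int Zv_of_int
          Zv_add Zv_diff Zv_mult Zv_uminus Zv_0_1 Zv_vv)
  qed
  have "twist_poly (monom 1 n) = Gau 0 (- vv) ^ n"
    by (induction n) (simp_all add: monom_0 monom_Suc twist_poly_const twist_poly_pCons twist_poly_0 ofQt_hom)
  then have "twist_Qv x = twist_poly (map_poly rat_of_int p) * inverse (Gau 0 (- vv)) ^ n"
    by (simp add: x twist_Qv_Fract divide_inverse power_inverse)
  moreover have "inverse (Gau 0 (- vv)) = Gau 0 (inverse vv)"
    by (rule inverse_unique) (simp add: gau_eq_iff vv_nonzero)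
  moreover have "Gau 0 (inverse vv) ^ n \<in> gau_ring Zv"
    by (induction n) (simp_all add: mem_gau_ring Zv_0_1 Zv_vv Zv_mult Zv_uminus)
  ultimately show ?thesis using p gau_Zv_closed by simp
qed

lemma twist_scal_integral:
  "c \<in> cov_ring (gau_ring Zv) \<Longrightarrow> twist_scal c \<in> cov_ring (gau_ring Zv)"
proof -
  assume "c \<in> cov_ring (gau_ring Zv)"
  moreover have "Gau 0 1 \<in> gau_ring Zv" by (simp add: mem_gau_ring Zv_0_1)
  ultimately show ?thesis
    by (auto simp: mem_cov_ring twist_scal_def twist_Qvt_def mem_gau_ring[of "cov_re c"]
        mem_gau_ring[of "cov_pi c"] intro!: gau_Zv_closed twist_Qv_integral)
qed

lemma tpow_integral: "tpow k \<in> cov_ring (gau_ring Zv)"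
  using tpow_cases[of k] by (auto simp: mem_cov_ring mem_gau_ring Zv_0_1 Zv_uminus)

section \<open>Homogeneous scalars\<close>

text \<open>
  Being an eigenvector of the scalar twist with eigenvalue \<open>t\<^sup>k\<close>. The eigenvalue depends
  only on \<open>k\<close> modulo 4, and \<open>0\<close> is homogeneous of every degree.
\<close>
definition hom_scal :: "int \<Rightarrow> Qv cov \<Rightarrow> bool" where
  "hom_scal k c \<longleftrightarrow> twist_scal (ext_scal c) = tpow k * ext_scal c"

lemma hom_scal_0: "hom_scal k 0"
  by (simp add: hom_scal_def ext_scal_hom twist_scal_0)

lemma hom_scal_1: "hom_scal 0 1"
  by (simp add: hom_scal_def ext_scal_hom twist_scal_1 tpow_0)

lemma hom_scal_diff: "hom_scal k c \<Longrightarrow> hom_scal k d \<Longrightarrow> hom_scal k (c - d)"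
  by (simp add: hom_scal_def ext_scal_hom twist_scal_diff algebra_simps)

lemma hom_scal_uminus: "hom_scal k c \<Longrightarrow> hom_scal k (- c)"
  using hom_scal_diff[OF hom_scal_0, of k c] by simp

lemma hom_scal_mult: "hom_scal k c \<Longrightarrow> hom_scal l d \<Longrightarrow> hom_scal (k + l) (c * d)"
  by (simp add: hom_scal_def ext_scal_hom twist_scal_mult tpow_add mult_ac)

lemma hom_scal_prod: "(\<And>x. x \<in> A \<Longrightarrow> hom_scal (k x) (c x)) \<Longrightarrow> hom_scal (\<Sum>x\<in>A. k x) (\<Prod>x\<in>A. c x)"
  by (induction A rule: infinite_finite_induct) (simp_all add: hom_scal_1 hom_scal_mult)

lemma hom_scal_power: "hom_scal k c \<Longrightarrow> hom_scal (k * int n) (c ^ n)"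
  using hom_scal_prod[of "{..<n}" "\<lambda>_. k" "\<lambda>_. c"] by (simp add: mult.commute)

text \<open>
  The inverse is either a genuine one or the default value \<open>0\<close>, which is homogeneous of every degree.
\<close>
lemma hom_scal_inverse: "hom_scal k c \<Longrightarrow> hom_scal (- k) (inverse c)"
proof (cases "cov_re c ^ 2 = cov_pi c ^ 2")
  case True
  then have "inverse c = 0" by (simp add: inverse_cov_def zero_cov_def)
  then show ?thesis by (simp add: hom_scal_0)
next
  case False
  assume c: "hom_scal k c"
  let ?x = "ext_scal c" and ?y = "ext_scal (inverse c)"
  have xy: "?x * ?y = 1" using cov_inverse[OF False] by (simp add: ext_scal_hom flip: ext_scal_hom(3))
  \<comment> \<open>The twist of \<open>x y = 1\<close> determines the twist of \<open>y\<close>.\<close>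
  have "tpow (- k) * ?y * (twist_scal (?x * ?y)) = (tpow (- k) * tpow k) * (?x * ?y) * twist_scal ?y"
    using c by (simp add: hom_scal_def twist_scal_mult mult_ac)
  then show ?thesis by (simp add: xy twist_scal_1 tpow_inverse hom_scal_def)
qed

lemma hom_scal_divide: "hom_scal k c \<Longrightarrow> hom_scal l d \<Longrightarrow> hom_scal (k - l) (c / d)"
  using hom_scal_mult[OF _ hom_scal_inverse, of k c l d] by (simp add: divide_cov_def)

lemma hom_scal_powi: "hom_scal k c \<Longrightarrow> hom_scal (k * n) (c powi n)"
  using hom_scal_power[of k c "nat n"] hom_scal_power[OF hom_scal_inverse, of k c "nat (- n)"]
  by (cases "0 \<le> n") (simp_all add: power_int_def)

lemma hom_scal_vK: "hom_scal (- 1) vK"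
proof -
  have "ext_scal vK = vT" by (simp add: cov_eq_iff vK_def vT_def of_base_hom)
  then show ?thesis by (simp add: hom_scal_def twist_scal_vT)
qed

lemma hom_scal_ppi: "hom_scal 2 ppi"
proof -
  have "ext_scal ppi = (ppi :: Qvt cov)" by (simp add: cov_eq_iff of_base_hom)
  then show ?thesis by (simp add: hom_scal_def twist_scal_ppi tpow_2)
qed

lemma hom_scal_minus_one_power: "hom_scal 0 ((- 1) ^ n)"
  using hom_scal_power[OF hom_scal_uminus[OF hom_scal_1], of n] by simp

context
  fixes w p :: "Qv cov" and d :: int
  assumes w: "hom_scal (- d) w" and p: "hom_scal (2 * d) p"
begin

text \<open>
  Here \<open>w\<close> has degree \<open>- d\<close> and \<open>p w\<close> has degree \<open>d\<close>, so
  the two terms have the same degree.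
\<close>
lemma hom_scal_quantum_diff: "hom_scal (d * n) ((p * w) powi n - w powi (- n))"
  using hom_scal_powi[OF hom_scal_mult[OF p w], of n] hom_scal_powi[OF w, of "- n"]
  by (intro hom_scal_diff) simp_all

lemma hom_scal_qint: "hom_scal (d * (n - 1)) (qint w p n)"
proof -
  have "hom_scal d (p * w - w powi (- 1))"
    using hom_scal_mult[OF p w] hom_scal_powi[OF w, of "- 1"] by (intro hom_scal_diff) simp_all
  from hom_scal_divide[OF hom_scal_quantum_diff this, of n] show ?thesis
    by (simp add: qint_def algebra_simps)
qed

lemma hom_scal_qfact: "hom_scal (\<Sum>l = 1..n. d * (int l - 1)) (qfact w p n)"
  unfolding qfact_def by (intro hom_scal_prod hom_scal_qint)

text \<open>
  The numerator has the factors with \<open>l\<close> from \<open>n - k + 1\<close> to \<open>n\<close>, the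
  denominator those with \<open>l\<close> from \<open>1\<close> to \<open>k\<close>. Each index is shifted
  by \<open>n - k\<close>, so the degrees differ by \<open>d k (n - k)\<close>.
\<close>
lemma hom_scal_qbinom:
  assumes "k \<le> n"
  shows "hom_scal (d * (int k * (int n - int k))) (qbinom w p n k)"
proof -
  have "(\<lambda>l. l + (int n - int k)) ` {1..int k} = {int n - int k + 1..int n}"
    by (auto simp: image_iff intro!: bexI[of _ "_ - (int n - int k)"])
  then have "(\<Sum>l = int n - int k + 1..int n. l) = (\<Sum>l\<in>(\<lambda>l. l + (int n - int k)) ` {1..int k}. l)"
    by (simp only:)
  also have "\<dots> = (\<Sum>l = 1..int k. l + (int n - int k))"
    by (subst sum.reindex) (auto simp: inj_on_def)
  also have "\<dots> = (\<Sum>l = 1..int k. l) + int k * (int n - int k)"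
    by (simp add: sum.distrib)
  finally have eq: "(\<Sum>l = int n - int k + 1..int n. d * l) - (\<Sum>l = 1..int k. d * l) = d * (int k * (int n - int k))"
    unfolding sum_distrib_left[symmetric] right_diff_distrib[symmetric] by simp
  show ?thesis
    unfolding qbinom_def eq[symmetric] by (intro hom_scal_divide hom_scal_prod hom_scal_quantum_diff)
qed

end

section \<open>Coefficientwise maps on monoid algebras\<close>

lemma poly_mapping_induct [consumes 1, case_names zero single add]:
  assumes "Poly_Mapping.keys p \<subseteq> W"
    and "P 0" and "\<And>w c. w \<in> W \<Longrightarrow> P (Poly_Mapping.single w c)"
    and "\<And>p q. Poly_Mapping.keys p \<subseteq> W \<Longrightarrow> Poly_Mapping.keys q \<subseteq> W \<Longrightarrow> P p \<Longrightarrow> P q \<Longrightarrow> P (p + q)"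
  shows "P (p :: 'a \<Rightarrow>\<^sub>0 'b::comm_monoid_add)"
  using assms(1)
proof (induction p rule: update_induct)
  case const
  show ?case by (rule assms(2))
next
  case (update f a b)
  have keys: "Poly_Mapping.keys (Poly_Mapping.update a b f) = insert a (Poly_Mapping.keys f)"
    using update(2) by (auto simp: in_keys_iff lookup_update split: if_splits)
  have "Poly_Mapping.update a b f = f + Poly_Mapping.single a b"
    using update(1) by (intro poly_mapping_eqI) (auto simp: lookup_update lookup_add lookup_single in_keys_iff when_def)
  then show ?case
    using update keys by (auto intro!: assms(3,4))
qed

lemmas poly_mapping_induct' = poly_mapping_induct[OF subset_UNIV, case_names zero single add]

lemma mapp_single: "f w 0 = 0 \<Longrightarrow> Poly_Mapping.mapp f (Poly_Mapping.single w c) = Poly_Mapping.single w (f w c)"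
  by (rule poly_mapping_eqI) (auto simp: lookup_mapp lookup_single when_def in_keys_iff)

lemma lookup_mapp_0: "(\<And>w. f w 0 = 0) \<Longrightarrow> Poly_Mapping.lookup (Poly_Mapping.mapp f p) w = f w (Poly_Mapping.lookup p w)"
  by (auto simp: lookup_mapp when_def in_keys_iff)

lemma mapp_add:
  assumes "\<And>w. f w 0 = 0" "\<And>w c d. f w (c + d) = f w c + f w d"
  shows "Poly_Mapping.mapp f (p + q) = Poly_Mapping.mapp f p + Poly_Mapping.mapp f q"
  by (rule poly_mapping_eqI) (simp add: lookup_mapp_0 lookup_add assms)

lemma mapp_0: "(\<And>w. f w 0 = 0) \<Longrightarrow> Poly_Mapping.mapp f 0 = 0"
  by (rule poly_mapping_eqI) (simp add: lookup_mapp_0)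

text \<open>
  A multiplicative twist of coefficients may depend on the word, provided that it does so multiplicatively.
\<close>
lemma mapp_mult:
  fixes f :: "'w::monoid_add \<Rightarrow> 'c::semiring_0 \<Rightarrow> 'd::semiring_0"
  assumes "\<And>w. f w 0 = 0" "\<And>w c d. f w (c + d) = f w c + f w d"
    and "\<And>w w' c d. f (w + w') (c * d) = f w c * f w' d"
  shows "Poly_Mapping.mapp f (p * q) = Poly_Mapping.mapp f p * Poly_Mapping.mapp f q"
proof (induction p rule: poly_mapping_induct')
  case (single w c)
  show ?case
    by (induction q rule: poly_mapping_induct')
      (simp_all add: mapp_single mapp_0 mapp_add mult_single assms distrib_left)
qed (simp_all add: mapp_0 mapp_add assms distrib_right)

lemma lookup_scalar_mult: "Poly_Mapping.lookup (Poly_Mapping.single 0 c * p) w = c * Poly_Mapping.lookup p w"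
  for p :: "'w::monoid_add \<Rightarrow>\<^sub>0 'c::semiring_0"
  by (induction p rule: poly_mapping_induct')
    (simp_all add: mult_single lookup_add distrib_left lookup_single when_def)

lemma scalar_central: "p * Poly_Mapping.single 0 c = Poly_Mapping.single 0 c * p"
  for p :: "'w::monoid_add \<Rightarrow>\<^sub>0 'c::comm_semiring_0"
  by (induction p rule: poly_mapping_induct')
    (simp_all add: mult_single distrib_left distrib_right mult.commute)

abbreviation scalar :: "'c::zero \<Rightarrow> 'w::zero \<Rightarrow>\<^sub>0 'c" where
  "scalar c \<equiv> Poly_Mapping.single 0 c"

lemma scalar_mult_assoc: "scalar c * (scalar d * p) = scalar (c * d) * p"
  for p :: "'w::monoid_add \<Rightarrow>\<^sub>0 'c::comm_semiring_0"
  by (simp add: mult.assoc[symmetric] mult_single)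

abbreviation ext_alg :: "('w \<Rightarrow>\<^sub>0 'c::comm_ring_1 cov) \<Rightarrow> 'w \<Rightarrow>\<^sub>0 'c gau cov" where
  "ext_alg \<equiv> Poly_Mapping.mapp (\<lambda>_. ext_scal)"

abbreviation re_alg :: "('w \<Rightarrow>\<^sub>0 'c::comm_ring_1 gau cov) \<Rightarrow> 'w \<Rightarrow>\<^sub>0 'c cov" where
  "re_alg \<equiv> Poly_Mapping.mapp (\<lambda>_. re_scal)"

abbreviation im_alg :: "('w \<Rightarrow>\<^sub>0 'c::comm_ring_1 gau cov) \<Rightarrow> 'w \<Rightarrow>\<^sub>0 'c cov" where
  "im_alg \<equiv> Poly_Mapping.mapp (\<lambda>_. im_scal)"

lemma re_im_scal:
  "re_scal (c + d) = re_scal c + re_scal d" "im_scal (c + d) = im_scal c + im_scal d"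
  "re_scal (c - d) = re_scal c - re_scal d" "im_scal (c - d) = im_scal c - im_scal d"
  "re_scal 0 = 0" "im_scal 0 = 0"
  "re_scal (c * d) = re_scal c * re_scal d - im_scal c * im_scal d"
  "im_scal (c * d) = re_scal c * im_scal d + im_scal c * re_scal d"
  "re_scal (ext_scal a) = a" "im_scal (ext_scal a) = 0"
  by (simp_all add: cov_eq_iff)

lemma lookup_coefficientwise:
  "Poly_Mapping.lookup (ext_alg a) w = ext_scal (Poly_Mapping.lookup a w)"
  "Poly_Mapping.lookup (re_alg p) w = re_scal (Poly_Mapping.lookup p w)"
  "Poly_Mapping.lookup (im_alg p) w = im_scal (Poly_Mapping.lookup p w)"
  by (simp_all add: lookup_mapp_0 re_im_scal ext_scal_hom)

lemma ext_alg_add: "ext_alg (a + b) = ext_alg a + ext_alg b"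
  by (simp add: mapp_add ext_scal_hom)

lemma ext_alg_0: "ext_alg 0 = 0"
  by (simp add: mapp_0 ext_scal_hom)

lemma ext_alg_diff: "ext_alg (a - b) = ext_alg a - ext_alg b"
  using ext_alg_add[of "a - b" b] by simp

lemma ext_alg_mult: "ext_alg (a * b) = ext_alg a * ext_alg (b :: 'w::monoid_add \<Rightarrow>\<^sub>0 _)"
  by (simp add: mapp_mult ext_scal_hom)

lemma ext_alg_single: "ext_alg (Poly_Mapping.single w c) = Poly_Mapping.single w (ext_scal c)"
  by (simp add: mapp_single ext_scal_hom)

lemma re_im_ext_alg: "re_alg (ext_alg a) = a" "im_alg (ext_alg a) = 0"
  by (rule poly_mapping_eqI, simp add: lookup_coefficientwise re_im_scal)+

lemma re_im_alg_add:
  "re_alg (p + q) = re_alg p + re_alg q" "im_alg (p + q) = im_alg p + im_alg q"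
  by (simp_all add: mapp_add re_im_scal)

lemma re_im_alg_0: "re_alg 0 = 0" "im_alg 0 = 0"
  by (simp_all add: mapp_0 re_im_scal)

lemma re_im_alg_diff:
  "re_alg (p - q) = re_alg p - re_alg q" "im_alg (p - q) = im_alg p - im_alg q"
  using re_im_alg_add[of "p - q" q] by simp_all

lemma re_im_alg_mult:
  fixes p q :: "'w::monoid_add \<Rightarrow>\<^sub>0 'c::comm_ring_1 gau cov"
  shows "re_alg (p * q) = re_alg p * re_alg q - im_alg p * im_alg q"
    and "im_alg (p * q) = re_alg p * im_alg q + im_alg p * re_alg q"
proof -
  have "re_alg (p * q) = re_alg p * re_alg q - im_alg p * im_alg q \<and>
    im_alg (p * q) = re_alg p * im_alg q + im_alg p * re_alg q"
  proof (induction p rule: poly_mapping_induct')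
    case (single w c)
    show ?case
      by (induction q rule: poly_mapping_induct')
        (simp_all add: re_im_alg_0 re_im_alg_add mult_single mapp_single re_im_scal single_add single_diff
          algebra_simps)
  qed (simp_all add: re_im_alg_0 re_im_alg_add algebra_simps)
  then show "re_alg (p * q) = re_alg p * re_alg q - im_alg p * im_alg q"
    and "im_alg (p * q) = re_alg p * im_alg q + im_alg p * re_alg q" by blast+
qed

lemma alg_decomp: "p = ext_alg (re_alg p) + scalar root_t * ext_alg (im_alg p)"
  for p :: "'w::monoid_add \<Rightarrow>\<^sub>0 'c::comm_ring_1 gau cov"
  by (rule poly_mapping_eqI)
    (simp add: lookup_add lookup_scalar_mult lookup_coefficientwise flip: scal_decomp)

section \<open>The modified quantum group and its integral form\<close>

lemma relideal_subgroup: "add_subgroup (relideal D)"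
  by (simp add: relideal_def add_subgroup_group_closure)

text \<open>
  The relation subgroup is generated by all two-sided multiples of relations, so it is an ideal.
\<close>
lemma relideal_mult:
  assumes "n \<in> relideal D" shows "p * n \<in> relideal D" "n * p \<in> relideal D"
proof -
  have "p * n \<in> relideal D \<and> n * p \<in> relideal D"
    using assms unfolding relideal_def
  proof (induction rule: group_closure.induct)
    case (base s)
    show ?case
    proof (cases "s = 0")
      case False
      with base obtain a r b where s: "s = a * r * b" "r \<in> rels D" by blast
      have "p * s = (p * a) * r * b" "s * p = a * r * (b * p)" by (simp_all only: s(1) mult.assoc)
      then have "p * s \<in> {p * r * q | p r q. r \<in> rels D}" "s * p \<in> {p * r * q | p r q. r \<in> rels D}"
        using s(2) by blast+
      then show ?thesis
        by (intro conjI group_closure.base insertI2)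
    qed simp
  next
    case (diff s t)
    then show ?case by (simp only: left_diff_distrib right_diff_distrib group_closure.diff simp_thms)
  qed
  then show "p * n \<in> relideal D" "n * p \<in> relideal D" by blast+
qed

lemma rels_relideal: "r \<in> rels D \<Longrightarrow> r \<in> relideal D"
  unfolding relideal_def
proof (rule group_closure.base)
  assume "r \<in> rels D"
  moreover have "r = 1 * r * 1" by simp
  ultimately show "r \<in> insert 0 {p * r * q | p r q. r \<in> rels D}" by blast
qed

abbreviation cls :: "('i, 'x::ab_group_add, 'y) root_datum \<Rightarrow> ('i, 'x) freealg \<Rightarrow> ('i, 'x) freealg set" where
  "cls D \<equiv> acoset (relideal D)"

lemma cls_eq: "cls D p = cls D q \<longleftrightarrow> p - q \<in> relideal D"
  by (rule acoset_eq_iff[OF relideal_subgroup])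

lemma dotU_ops:
  "add (dotU D) (cls D p) (cls D q) = cls D (p + q)"
  "mul (dotU D) (cls D p) (cls D q) = cls D (p * q)"
  "smul (dotU D) c (cls D p) = cls D (sc c * p)"
proof -
  show "add (dotU D) (cls D p) (cls D q) = cls D (p + q)"
    by (simp add: dotU_def acoset_lift2_plus[OF relideal_subgroup])
  have "p' * q' - p * q \<in> relideal D" if "p' - p \<in> relideal D" "q' - q \<in> relideal D" for p' q'
    using add_subgroupD(4)[OF relideal_subgroup relideal_mult(2)[OF that(1), of q']
        relideal_mult(1)[OF that(2), of p]]
    by (simp add: algebra_simps)
  then show "mul (dotU D) (cls D p) (cls D q) = cls D (p * q)"
    by (simp add: dotU_def acoset_lift2_acoset[OF relideal_subgroup])
  show "smul (dotU D) c (cls D p) = cls D (sc c * p)"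
    unfolding dotU_def nalg.simps
    by (rule acoset_lift_acoset[OF relideal_subgroup relideal_subgroup])
      (simp only: right_diff_distrib[symmetric] relideal_mult(1))
qed

lemma cls_in_dotU: "Poly_Mapping.lookup p 0 = 0 \<Longrightarrow> cls D p \<in> car (dotU D)"
  by (auto simp: dotU_def)

lemma dotU_cases [consumes 1]:
  assumes "x \<in> car (dotU D)" obtains p where "Poly_Mapping.lookup p 0 = 0" "x = cls D p"
  using assms by (auto simp: dotU_def)

lemma word_add_eq_0: "w + w' = 0 \<longleftrightarrow> w = 0 \<and> w' = (0 :: 'g word)"
  by (cases w; cases w') (auto simp: zero_word_def plus_word_def)

lemma lookup_mult_word_0:
  assumes "Poly_Mapping.lookup p 0 = 0"
  shows "Poly_Mapping.lookup (p * q) (0 :: 'g word) = 0"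
proof (rule ccontr)
  assume "Poly_Mapping.lookup (p * q) 0 \<noteq> 0"
  then have "0 \<in> Poly_Mapping.keys (p * q)" by (simp add: in_keys_iff)
  then obtain a b where "0 = a + b" "a \<in> Poly_Mapping.keys p" using keys_mult[of p q] by blast
  then have "0 \<in> Poly_Mapping.keys p" using word_add_eq_0 by metis
  then show False using assms by (simp add: in_keys_iff)
qed

lemma sc_simps: "sc (c + d) = sc c + sc d" "sc c * sc d = sc (c * d)" "sc 1 = 1" "sc 0 = 0"
  by (simp_all add: sc_def single_add mult_single)

lemma sc_mult_assoc: "sc c * (sc d * p) = sc (c * d) * p"
  by (simp only: sc_simps mult.assoc[symmetric])

lemma sc_central: "p * sc c = sc c * p"
  by (simp add: sc_def scalar_central)

lemma lookup_sc_mult: "Poly_Mapping.lookup (sc c * p) w = c * Poly_Mapping.lookup p w"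
  by (simp add: sc_def lookup_scalar_mult)

lemma dotU_nalgebra: "nalgebra (dotU D)"
proof
  show "1 \<in> scal (dotU D)" "\<And>c d. c - d \<in> scal (dotU D)" "\<And>c d. c * d \<in> scal (dotU D)"
    by (simp_all add: dotU_def)
  show "car (dotU D) \<noteq> {}" using cls_in_dotU[of 0] by auto
  fix x assume "x \<in> car (dotU D)"
  then obtain p where p: "Poly_Mapping.lookup p 0 = 0" "x = cls D p" by (rule dotU_cases)
  show "smul (dotU D) 1 x = x" by (simp add: p dotU_ops sc_simps)
  show "smul (dotU D) c x \<in> car (dotU D)" for c
    by (simp add: p dotU_ops lookup_sc_mult cls_in_dotU)
  show "smul (dotU D) (c + d) x = add (dotU D) (smul (dotU D) c x) (smul (dotU D) d x)" for c d
    by (simp add: p dotU_ops sc_simps distrib_right)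
  show "smul (dotU D) c (smul (dotU D) d x) = smul (dotU D) (c * d) x" for c d
    by (simp add: p dotU_ops sc_mult_assoc)
  fix y assume "y \<in> car (dotU D)"
  then obtain q where q: "Poly_Mapping.lookup q 0 = 0" "y = cls D q" by (rule dotU_cases)
  show "add (dotU D) x y \<in> car (dotU D)" "mul (dotU D) x y \<in> car (dotU D)"
    by (simp_all add: p q dotU_ops cls_in_dotU lookup_add lookup_mult_word_0)
  show "add (dotU D) x y = add (dotU D) y x" by (simp add: p q dotU_ops add.commute)
  show "smul (dotU D) 0 x = smul (dotU D) 0 y" by (simp add: p q dotU_ops sc_simps)
  show "smul (dotU D) c (add (dotU D) x y) = add (dotU D) (smul (dotU D) c x) (smul (dotU D) c y)" for c
    by (simp add: p q dotU_ops distrib_left)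
  show "mul (dotU D) (smul (dotU D) c x) y = smul (dotU D) c (mul (dotU D) x y)" for c
    by (simp add: p q dotU_ops mult.assoc)
  show "mul (dotU D) x (smul (dotU D) c y) = smul (dotU D) c (mul (dotU D) x y)" for c
    by (simp add: p q dotU_ops mult.assoc[symmetric] sc_central)
  fix z assume "z \<in> car (dotU D)"
  then obtain r where r: "Poly_Mapping.lookup r 0 = 0" "z = cls D r" by (rule dotU_cases)
  show "add (dotU D) (add (dotU D) x y) z = add (dotU D) x (add (dotU D) y z)"
    by (simp add: p q r dotU_ops add.assoc)
  show "mul (dotU D) (add (dotU D) x y) z = add (dotU D) (mul (dotU D) x z) (mul (dotU D) y z)"
    "mul (dotU D) x (add (dotU D) y z) = add (dotU D) (mul (dotU D) x y) (mul (dotU D) x z)"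
    by (simp_all add: p q r dotU_ops distrib_left distrib_right)
qed

lemma scal_dotU: "scal (dotU D) = UNIV" "pi_free (dotU D) = UNIV"
  by (simp_all add: dotU_def pi_free_def)

lemma dotU_pi_algebra: "pi_algebra (dotU D)"
proof -
  interpret nalgebra "dotU D" by (rule dotU_nalgebra)
  show ?thesis by unfold_locales (auto simp: scal_dotU mem_cov_ring)
qed

lemma lookup_gen_0: "Poly_Mapping.lookup (gen g) 0 = 0"
  by (simp add: gen_def lookup_single zero_word_def)

lemma lookup_mon_0: "Poly_Mapping.lookup (Defs.mon D w l) 0 = 0"
  by (induction w) (simp_all add: lookup_gen_0 lookup_mult_word_0)

lemma intform_dotU: "x \<in> intform D \<Longrightarrow> x \<in> car (dotU D)"
proof -
  interpret nalgebra "dotU D" by (rule dotU_nalgebra)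
  assume "x \<in> intform D"
  then show "x \<in> car (dotU D)"
    by (induction rule: intform.induct)
      (simp_all add: dotU_one_def divpow_def cls_in_dotU lookup_sc_mult lookup_gen_0 lookup_mon_0
        add_closed mul_closed smul_closed scal_dotU)
qed

lemma (in nalgebra) subalgebra_nalgebra:
  assumes "S \<subseteq> scal M" "1 \<in> S" "\<And>c d. c \<in> S \<Longrightarrow> d \<in> S \<Longrightarrow> c - d \<in> S"
    "\<And>c d. c \<in> S \<Longrightarrow> d \<in> S \<Longrightarrow> c * d \<in> S"
    and "K \<subseteq> car M" "K \<noteq> {}" "\<And>x y. x \<in> K \<Longrightarrow> y \<in> K \<Longrightarrow> add M x y \<in> K"
    "\<And>x y. x \<in> K \<Longrightarrow> y \<in> K \<Longrightarrow> mul M x y \<in> K" "\<And>c x. c \<in> S \<Longrightarrow> x \<in> K \<Longrightarrow> smul M c x \<in> K"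
  shows "nalgebra (M\<lparr>scal := S, car := K\<rparr>)"
proof -
  note in_car = subsetD[OF assms(5)] and in_scal = subsetD[OF assms(1)]
  show ?thesis
    by unfold_locales
      (use assms in \<open>auto simp: in_car in_scal add_assoc smul_add_left smul_add_right smul_smul smul_one
        mul_add_left mul_add_right mul_smul_left mul_smul_right
        intro: add_comm[OF in_car in_car] smul_zero_eq[OF in_car in_car]\<close>)
qed

lemma ZdotU_nalgebra: "nalgebra (ZdotU D)"
  unfolding ZdotU_def
proof (rule nalgebra.subalgebra_nalgebra[OF dotU_nalgebra])
  show "intform D \<noteq> {}" using intform.intros(1) by blast
qed (auto simp: scal_dotU mem_cov_ring Zv_0_1 Zv_diff Zv_add Zv_mult intform_dotU intro: intform.intros(3-5))

lemma scal_ZdotU: "scal (ZdotU D) = cov_ring Zv" "pi_free (ZdotU D) = Zv"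
  by (auto simp: ZdotU_def pi_free_def mem_cov_ring Zv_0_1)

lemma ZdotU_pi_algebra: "pi_algebra (ZdotU D)"
proof -
  interpret nalgebra "ZdotU D" by (rule ZdotU_nalgebra)
  show ?thesis by unfold_locales (simp add: scal_ZdotU)
qed

section \<open>A presentation over the extended scalars\<close>

type_synonym ('i, 'x) freealg_t = "('i, 'x) gen word \<Rightarrow>\<^sub>0 Qvt cov"

text \<open>
  The relations after adjoining \<open>t\<close>, described by components. Closure under multiplication by
  \<open>t\<close> is built in, and intersecting with the elements free of \<open>t\<close> visibly gives
  back the original relations.
\<close>
definition relideal_t :: "('i, 'x::ab_group_add, 'y) root_datum \<Rightarrow> ('i, 'x) freealg_t set" where
  "relideal_t D = {p. re_alg p \<in> relideal D \<and> im_alg p \<in> relideal D}"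

lemma relideal_t_mult:
  assumes "n \<in> relideal_t D" shows "p * n \<in> relideal_t D" "n * p \<in> relideal_t D"
  using assms by (simp_all add: relideal_t_def re_im_alg_mult relideal_mult add_subgroupD[OF relideal_subgroup])

lemma relideal_t_ext: "n \<in> relideal D \<Longrightarrow> ext_alg n \<in> relideal_t D"
  by (simp add: relideal_t_def re_im_ext_alg add_subgroupD(1)[OF relideal_subgroup])

lemma relideal_t_subgroup: "add_subgroup (relideal_t D)"
  by (auto simp: add_subgroup_def relideal_t_def re_im_alg_0 re_im_alg_diff
      add_subgroupD[OF relideal_subgroup])

text \<open>
  The projection from the free algebra over \<open>\<rat>(v,t)\<^sup>\<pi>\<close> onto the extended
  algebra; it is meaningful on the elements without constant term.
\<close>
definition present :: "('i, 'x::ab_group_add, 'y) root_datum \<Rightarrow> ('i, 'x) freealg_t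
    \<Rightarrow> (Qvt cov \<times> ('i, 'x) freealg set \<Rightarrow>\<^sub>0 int) set" where
  "present D p = pi_algebra.gpair (dotU D) (cls D (re_alg p)) (cls D (im_alg p))"

context
  fixes D :: "('i, 'x::ab_group_add, 'y) root_datum"
begin

interpretation U: pi_algebra "dotU D" by (rule dotU_pi_algebra)
interpretation Ut: pi_algebra "adj_t (dotU D)" by (rule U.adj_t_pi_algebra)

lemma augmentation_components:
  "Poly_Mapping.lookup p 0 = 0 \<longleftrightarrow> Poly_Mapping.lookup (re_alg p) 0 = 0 \<and> Poly_Mapping.lookup (im_alg p) 0 = 0"
proof -
  have "c = 0 \<longleftrightarrow> re_scal c = 0 \<and> im_scal c = 0" for c :: "'c::comm_ring_1 gau cov"
    by (auto simp: cov_eq_iff gau_eq_iff)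
  then show ?thesis by (simp add: lookup_coefficientwise)
qed

lemma present_closed: "Poly_Mapping.lookup p 0 = 0 \<Longrightarrow> present D p \<in> car (adj_t (dotU D))"
  by (simp add: present_def augmentation_components[of p] cls_in_dotU U.gpair_closed)

lemma present_surj:
  assumes "X \<in> car (adj_t (dotU D))" obtains p where "Poly_Mapping.lookup p 0 = 0" "X = present D p"
proof -
  obtain m n where mn: "m \<in> car (dotU D)" "n \<in> car (dotU D)" "X = U.gpair m n"
    using assms by (rule U.gpair_surj)
  obtain a where a: "Poly_Mapping.lookup a 0 = 0" "m = cls D a" using mn(1) by (rule dotU_cases)
  obtain b where b: "Poly_Mapping.lookup b 0 = 0" "n = cls D b" using mn(2) by (rule dotU_cases)
  let ?p = "ext_alg a + scalar root_t * ext_alg b"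
  have "re_scal (root_t * ext_scal c) = 0" "im_scal (root_t * ext_scal c) = c" for c :: "Qv cov"
    by (simp_all add: cov_eq_iff)
  then have "re_alg ?p = a" "im_alg ?p = b"
    by (intro poly_mapping_eqI; simp add: lookup_coefficientwise lookup_add lookup_scalar_mult re_im_scal del: root_t_sel)+
  then show ?thesis
    using a b mn by (intro that[of ?p]) (auto simp: present_def augmentation_components[of ?p])
qed

lemma present_eq_iff:
  assumes "Poly_Mapping.lookup p 0 = 0" "Poly_Mapping.lookup q 0 = 0"
  shows "present D p = present D q \<longleftrightarrow> p - q \<in> relideal_t D"
  using assms
  by (simp add: present_def augmentation_components[of p] augmentation_components[of q] U.gpair_inject
      cls_in_dotU cls_eq relideal_t_def re_im_alg_diff)

lemma present_add:
  assumes "Poly_Mapping.lookup p 0 = 0" "Poly_Mapping.lookup q 0 = 0"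
  shows "add (adj_t (dotU D)) (present D p) (present D q) = present D (p + q)"
  using assms
  by (simp add: present_def augmentation_components[of p] augmentation_components[of q] U.gpair_add
      cls_in_dotU dotU_ops re_im_alg_add)

lemma present_mul:
  assumes "Poly_Mapping.lookup p 0 = 0" "Poly_Mapping.lookup q 0 = 0"
  shows "mul (adj_t (dotU D)) (present D p) (present D q) = present D (p * q)"
proof -
  have "sc (- 1) = (- 1 :: ('i, 'x) freealg)" by (simp add: sc_def single_uminus)
  then show ?thesis
    using assms
    by (simp add: present_def augmentation_components[of p] augmentation_components[of q] U.gpair_mul
        cls_in_dotU dotU_ops re_im_alg_mult)
qed

lemma Rt_UNIV: "cov_ring (gau_ring (pi_free (dotU D))) = UNIV"
  by (auto simp: scal_dotU mem_cov_ring mem_gau_ring)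

lemma present_smul:
  assumes "Poly_Mapping.lookup p 0 = 0"
  shows "smul (adj_t (dotU D)) c (present D p) = present D (scalar c * p)"
proof -
  have sc: "sc (- d) * a = - (sc d * a)" for d :: "Qv cov" and a :: "('i, 'x) freealg"
    by (rule poly_mapping_eqI) (simp add: lookup_sc_mult)
  have "re_alg (scalar c) = (sc (re_scal c) :: ('i, 'x) freealg)"
    "im_alg (scalar c) = (sc (im_scal c) :: ('i, 'x) freealg)"
    by (simp_all add: sc_def mapp_single re_im_scal)
  then show ?thesis
    using assms
    by (simp add: present_def augmentation_components[of p] U.gpair_smul Rt_UNIV
        cls_in_dotU dotU_ops re_im_alg_mult sc)
qed

lemma present_ext: "Poly_Mapping.lookup a 0 = 0 \<Longrightarrow> present D (ext_alg a) = adj_t_el (dotU D) (cls D a)"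
proof -
  assume a: "Poly_Mapping.lookup a 0 = 0"
  have "cls D 0 = nzero (dotU D)"
    using U.smul_zero[of "cls D 0"] by (simp add: cls_in_dotU dotU_ops)
  then show ?thesis
    using a by (simp add: present_def re_im_ext_alg U.adj_t_el_gpair cls_in_dotU)
qed

end

section \<open>Weights and the form behind the twistor\<close>

lemma zscale_nonneg: "zscale (int n) x = (\<Sum>_<n. x)"
  by (simp add: zscale_def)

lemma zscale_neg: "zscale (- int n) x = - (\<Sum>_<n. x)"
  by (simp add: zscale_def)

lemma zscale_add_one: "zscale (k + 1) x = zscale k x + x"
proof (cases "k \<ge> 0")
  case True
  then obtain n where "k = int n" by (metis nonneg_int_cases)
  then show ?thesis using zscale_nonneg[of "Suc n" x] zscale_nonneg[of n x] by (simp add: add.commute)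
next
  case False
  then obtain n where "k = - int (Suc n)" by (metis not_le negD zero_le_imp_eq_int neg_int_cases Suc_pred)
  then have "k + 1 = - int n" and k: "k = - int (Suc n)" by simp_all
  then show ?thesis unfolding \<open>k + 1 = - int n\<close> unfolding k zscale_neg by simp
qed

lemma zcomb_add_unitv: "zcomb r (\<lambda>i. \<mu> i + unitv j i) = zcomb r \<mu> + r j"
proof -
  have "zscale (\<mu> i + unitv j i) (r i) = zscale (\<mu> i) (r i) + (if i = j then r j else 0)" for i
    by (simp add: unitv_def zscale_add_one)
  then show ?thesis by (simp add: zcomb_def sum.distrib)
qed

text \<open>The value \<open>\<phi>(i,j)\<close> on basis vectors.\<close>
definition phi_entry :: "('i::{finite,linorder}, 'x, 'y) root_datum \<Rightarrow> 'i \<Rightarrow> 'i \<Rightarrow> int" where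
  "phi_entry D i j = (if j < i then dd D i * aa D i j else if j = i then dd D i
     else - 2 * int (par D i) * int (par D j))"

lemma phi_unitv: "phi D (unitv i) \<mu> = (\<Sum>j\<in>UNIV. \<mu> j * phi_entry D i j)"
proof -
  have "phi D (unitv i) \<mu> = (\<Sum>i'\<in>UNIV. if i' = i then (\<Sum>j\<in>UNIV. \<mu> j * phi_entry D i j) else 0)"
    unfolding phi_def phi_entry_def[symmetric] by (rule sum.cong) (auto simp: unitv_def)
  then show ?thesis by simp
qed

lemma phi_unitv_add: "phi D (unitv i) (\<lambda>k. \<mu> k + unitv j k) = phi D (unitv i) \<mu> + phi_entry D i j"
proof -
  have "(\<mu> k + unitv j k) * phi_entry D i k = \<mu> k * phi_entry D i k + (if k = j then phi_entry D i j else 0)" for k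
    by (simp add: unitv_def algebra_simps)
  then show ?thesis by (simp add: phi_unitv sum.distrib)
qed

locale twist_datum =
  fixes D :: "('i::{finite,linorder}, 'x::ab_group_add, 'y::ab_group_add) root_datum"
    and C :: "'x set"
  assumes datum: "super_root_datum D" and trans: "transversal D C"
begin

lemma cartan: "super_cartan_datum D"
  using datum by (simp add: super_root_datum_def)

lemma aa_self: "aa D i i = 2"
proof -
  have "dd D i > 0" using cartan by (simp add: super_cartan_datum_def)
  then have "form D i i \<noteq> 0" by (auto simp: dd_def)
  then show ?thesis by (simp add: aa_def)
qed

lemma pairing_add: "pairing D y (l + m) = pairing D y l + pairing D y m"
proof -
  have "additive (pairing D y)"
    using datum bij_betwE[of "\<lambda>y. pairing D y" UNIV "{f. additive f}"]
    by (auto simp: super_root_datum_def)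
  then show ?thesis by (rule additive.add)
qed

lemma pairing_root: "pairing D (simple_coroot D i) (simple_root D j) = aa D i j"
  using datum by (simp add: super_root_datum_def)

lemma dd_aa: "dd D i * aa D i j = form D i j"
proof -
  have c: "even (form D i i)" "form D i i dvd 2 * form D i j" "dd D i > 0"
    using cartan by (cases "i = j"; simp add: super_cartan_datum_def)+
  then have "2 * (dd D i * aa D i j) = 2 * form D i j"
    by (auto simp: aa_def dd_def elim!: evenE)
  then show ?thesis by simp
qed

lemma dd_aa_sym: "dd D i * aa D i j = dd D j * aa D j i"
  using cartan by (simp add: dd_aa super_cartan_datum_def)

lemma dd_par: "even (dd D i - int (par D i))"
proof -
  have "dd D i mod 2 = int (par D i) mod 2" using cartan by (simp add: super_cartan_datum_def)
  then show ?thesis by (metis mod_eq_dvd_iff)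
qed

text \<open>
  This is where the parity condition on the entries \<open>a\<^sub>i\<^sub>j\<close> with \<open>i\<close>
  odd enters.
\<close>
lemma even_dd_aa: "even (dd D i * aa D i j)"
proof (cases "i \<in> odd_part D")
  case True
  then show ?thesis using cartan by (auto simp: super_cartan_datum_def)
next
  case False
  then show ?thesis using dd_par[of i] by (simp add: par_def)
qed

text \<open>
  The congruence on which all relations between different \<open>i\<close> and \<open>j\<close> rest. For \<open>j < i\<close> it is an equality. For \<open>i < j\<close> the two sides differ by
  \<open>4 p(i) p(j) + 2 d\<^sub>i a\<^sub>i\<^sub>j\<close>, and \<open>d\<^sub>i a\<^sub>i\<^sub>j\<close> is even: for odd \<open>i\<close> because \<open>a\<^sub>i\<^sub>j\<close> is even, for even \<open>i\<close> because \<open>d\<^sub>i\<close> is.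
\<close>
lemma phi_entry_skew:
  assumes "i \<noteq> j"
  shows "4 dvd phi_entry D i j - phi_entry D j i - dd D i * aa D i j - 2 * int (par D i * par D j)"
proof (cases "j < i")
  case True
  then show ?thesis by (simp add: phi_entry_def)
next
  case False
  then have less: "i < j" using assms by simp
  obtain e where e: "dd D i * aa D i j = 2 * e" using even_dd_aa by (rule evenE)
  define P where "P = int (par D i * par D j)"
  have "phi_entry D i j = - 2 * P" using assms False by (simp add: phi_entry_def P_def)
  moreover have "phi_entry D j i = 2 * e"
    using less e dd_aa_sym[of i j] by (simp add: phi_entry_def)
  ultimately have "phi_entry D i j - phi_entry D j i - dd D i * aa D i j - 2 * P = 4 * (- P - e)"
    using e by simp
  then show ?thesis unfolding P_def by (metis dvd_triv_left)
qed

lemma bb_int: "i \<noteq> j \<Longrightarrow> int (bb D i j) = 1 - aa D i j"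
proof -
  assume "i \<noteq> j"
  then have "aa D i j \<le> 0" using cartan by (simp add: super_cartan_datum_def)
  then show ?thesis by (simp add: bb_def)
qed

text \<open>
  Shifting a weight by a simple root keeps its representative in the transversal and adds a basis vector to
  its coordinates.
\<close>
lemma dotphi_shift:
  "dotphi D C (unitv i) (l + simple_root D j) = dotphi D C (unitv i) l + phi_entry D i j"
proof -
  let ?z = "zcomb (simple_root D)"
  have inj: "inj ?z" using datum by (simp add: super_root_datum_def)
  have ex: "\<exists>!\<mu>. l - ?z \<mu> \<in> C" for l
  proof -
    have ex1: "\<exists>!c. c \<in> C \<and> l - c \<in> range ?z" using trans by (simp add: transversal_def)
    then obtain c \<mu> where "c \<in> C" "l - c = ?z \<mu>" by blast
    then have "l - ?z \<mu> = c" by (simp add: algebra_simps)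
    then have "l - ?z \<mu> \<in> C" using \<open>c \<in> C\<close> by simp
    moreover have "\<mu> = \<nu>" if "l - ?z \<mu> \<in> C" "l - ?z \<nu> \<in> C" for \<mu> \<nu>
    proof -
      have "l - (l - ?z \<mu>) \<in> range ?z" "l - (l - ?z \<nu>) \<in> range ?z" by simp_all
      then have "l - ?z \<mu> = l - ?z \<nu>" using ex1 that by blast
      then show ?thesis using inj by (simp add: inj_def)
    qed
    ultimately show ?thesis by blast
  qed
  define \<mu> where "\<mu> = (THE \<mu>. l - ?z \<mu> \<in> C)"
  have \<mu>: "l - ?z \<mu> \<in> C" unfolding \<mu>_def by (rule theI'[OF ex])
  have "(THE \<mu>. l + simple_root D j - ?z \<mu> \<in> C) = (\<lambda>k. \<mu> k + unitv j k)"
    by (rule the1_equality[OF ex]) (use \<mu> in \<open>simp add: zcomb_add_unitv\<close>)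
  then show ?thesis
    unfolding dotphi_def \<mu>_def[symmetric] by (simp add: phi_unitv_add)
qed

section \<open>Degrees of words and the twist of the free algebra\<close>

text \<open>The exponents of \<open>t\<close> in the values of the twistor on generators.\<close>
fun gen_deg :: "('i, 'x) gen \<Rightarrow> int" where
  "gen_deg (gen.Idem l) = 0"
| "gen_deg (Gen (E i) l) = dd D i * pairing D (simple_coroot D i) l - dotphi D C (unitv i) l"
| "gen_deg (Gen (F i) l) = dotphi D C (unitv i) l"

text \<open>
  The change of the exponent of the first letter when the weight moves by the weight of the second.
\<close>
fun letter_form :: "'i letter \<Rightarrow> 'i letter \<Rightarrow> int" where
  "letter_form (E i) (E j) = dd D i * aa D i j - phi_entry D i j"
| "letter_form (E i) (F j) = phi_entry D i j - dd D i * aa D i j"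
| "letter_form (F i) (E j) = phi_entry D i j"
| "letter_form (F i) (F j) = - phi_entry D i j"

lemma gen_deg_shift: "gen_deg (Gen x (l + wt D y)) = gen_deg (Gen x l) + letter_form x y"
proof -
  have p: "pairing D c (l - simple_root D j) = pairing D c l - pairing D c (simple_root D j)" for c j
    using pairing_add[of c "l - simple_root D j" "simple_root D j"] by simp
  have d: "dotphi D C (unitv i) (l - simple_root D j) = dotphi D C (unitv i) l - phi_entry D i j" for i j
    using dotphi_shift[of i "l - simple_root D j" j] by simp
  show ?thesis
    by (cases x; cases y) (simp_all add: pairing_add dotphi_shift p d pairing_root algebra_simps)
qed

lemma gen_deg_shift_list:
  "gen_deg (Gen x (l + sum_list (map (wt D) w))) = gen_deg (Gen x l) + sum_list (map (letter_form x) w)"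
proof (induction w arbitrary: l)
  case (Cons y w)
  from Cons[of "l + wt D y"] show ?case by (simp add: gen_deg_shift add.assoc)
qed simp

fun mon_deg :: "'i letter list \<Rightarrow> 'x \<Rightarrow> int" where
  "mon_deg [] l = 0"
| "mon_deg (x # w) l = gen_deg (Gen x l) + sum_list (map (letter_form x) w) + mon_deg w l"

lemma mon_deg_replicate_append:
  "mon_deg (replicate a x @ w) l = mon_deg w l +
     int a * (gen_deg (Gen x l) + sum_list (map (letter_form x) w)) + int (a choose 2) * letter_form x x"
  by (induction a) (simp_all add: sum_list_replicate numeral_2_eq_2 algebra_simps)

lemma two_choose_two: "2 * int (n choose 2) = int n * (int n - 1)"
  by (induction n) (simp_all add: numeral_2_eq_2 algebra_simps)

text \<open>
  Only the last term depends on \<open>k\<close>: moving one \<open>x\<close> from the left to the right of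
  \<open>y\<close> changes the degree by the skew part of the form.
\<close>
lemma mon_deg_serre:
  assumes "k \<le> b"
  shows "mon_deg (replicate (b - k) x @ [y] @ replicate k x) l =
    int b * gen_deg (Gen x l) + gen_deg (Gen y l) + int (b choose 2) * letter_form x x +
    int b * letter_form x y + int k * (letter_form y x - letter_form x y)"
proof -
  have "2 * (int ((b - k) choose 2) + int (k choose 2) + int k * (int b - int k)) = 2 * int (b choose 2)"
    using assms by (simp add: two_choose_two distrib_left of_nat_diff algebra_simps)
  then have c: "int (b choose 2) = int ((b - k) choose 2) + int (k choose 2) + int k * (int b - int k)"
    by simp
  have "mon_deg (replicate k x) l = int k * gen_deg (Gen x l) + int (k choose 2) * letter_form x x"
    using mon_deg_replicate_append[of k x "[]" l] by simp
  then show ?thesis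
    using assms unfolding c
    by (simp add: mon_deg_replicate_append sum_list_replicate of_nat_diff algebra_simps)
qed

definition word_deg :: "('i, 'x) gen word \<Rightarrow> int" where
  "word_deg w = (case w of Word gs \<Rightarrow> sum_list (map gen_deg gs))"

lemma word_deg_add: "word_deg (w + w') = word_deg w + word_deg w'"
  by (cases w; cases w') (simp add: word_deg_def plus_word_def)

lemma word_deg_0: "word_deg 0 = 0"
  by (simp add: word_deg_def zero_word_def)

definition twist_alg :: "('i, 'x) freealg_t \<Rightarrow> ('i, 'x) freealg_t" where
  "twist_alg = Poly_Mapping.mapp (\<lambda>w c. tpow (word_deg w) * twist_scal c)"

lemma lookup_twist_alg: "Poly_Mapping.lookup (twist_alg p) w = tpow (word_deg w) * twist_scal (Poly_Mapping.lookup p w)"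
  by (simp add: twist_alg_def lookup_mapp_0 twist_scal_0)

lemma twist_alg_single: "twist_alg (Poly_Mapping.single w c) = Poly_Mapping.single w (tpow (word_deg w) * twist_scal c)"
  by (simp add: twist_alg_def mapp_single twist_scal_0)

lemma twist_alg_add: "twist_alg (p + q) = twist_alg p + twist_alg q"
  by (simp add: twist_alg_def mapp_add twist_scal_0 twist_scal_add distrib_left)

lemma twist_alg_0: "twist_alg 0 = 0"
  by (simp add: twist_alg_def mapp_0 twist_scal_0)

lemma twist_alg_diff: "twist_alg (p - q) = twist_alg p - twist_alg q"
  using twist_alg_add[of "p - q" q] by simp

lemma twist_alg_mult: "twist_alg (p * q) = twist_alg p * twist_alg q"
  unfolding twist_alg_def
  by (rule mapp_mult) (simp_all add: twist_scal_0 twist_scal_add twist_scal_mult word_deg_add tpow_add algebra_simps)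

lemma twist_alg_scalar: "twist_alg (scalar c) = scalar (twist_scal c)"
  by (simp add: twist_alg_single word_deg_0 tpow_0)

lemma twist_alg_order_4: "twist_alg (twist_alg (twist_alg (twist_alg p))) = p"
proof (rule poly_mapping_eqI)
  fix w
  have "tpow (word_deg w) * (tpow (word_deg w) * (tpow (word_deg w) * (tpow (word_deg w) * c))) = c" for c
  proof -
    have "tpow (word_deg w) * tpow (word_deg w) * tpow (word_deg w) * tpow (word_deg w) = tpow (4 * word_deg w)"
      by (simp flip: tpow_add)
    then show ?thesis by (simp only: mult.assoc[symmetric] tpow_4 mult_1_left)
  qed
  then show "Poly_Mapping.lookup (twist_alg (twist_alg (twist_alg (twist_alg p)))) w = Poly_Mapping.lookup p w"
    by (simp add: lookup_twist_alg twist_scal_mult twist_scal_tpow twist_scal_order_4)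
qed

definition homog :: "int \<Rightarrow> ('i, 'x) freealg \<Rightarrow> bool" where
  "homog k p \<longleftrightarrow> twist_alg (ext_alg p) = scalar (tpow k) * ext_alg p"

lemma homog_0: "homog k 0"
  by (simp add: homog_def ext_alg_0 twist_alg_0)

lemma homog_add: "homog k p \<Longrightarrow> homog k q \<Longrightarrow> homog k (p + q)"
  by (simp add: homog_def ext_alg_add twist_alg_add distrib_left)

lemma homog_diff: "homog k p \<Longrightarrow> homog k q \<Longrightarrow> homog k (p - q)"
  by (simp add: homog_def ext_alg_diff twist_alg_diff right_diff_distrib)

lemma homog_sum: "(\<And>x. x \<in> A \<Longrightarrow> homog k (f x)) \<Longrightarrow> homog k (\<Sum>x\<in>A. f x)"
  by (induction A rule: infinite_finite_induct) (simp_all add: homog_0 homog_add)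

lemma homog_mult:
  assumes "homog k p" "homog l q" shows "homog (k + l) (p * q)"
proof -
  have "scalar (tpow k) * ext_alg p * (scalar (tpow l) * ext_alg q) =
    scalar (tpow k) * (ext_alg p * scalar (tpow l)) * ext_alg q"
    by (simp only: mult.assoc)
  also have "\<dots> = scalar (tpow (k + l)) * (ext_alg p * ext_alg q)"
    by (simp only: scalar_central scalar_mult_assoc mult.assoc tpow_add)
  finally show ?thesis
    using assms by (simp add: homog_def ext_alg_mult twist_alg_mult)
qed

lemma homog_sc: "hom_scal k c \<Longrightarrow> homog k (sc c)"
  by (simp add: homog_def sc_def ext_alg_single twist_alg_scalar hom_scal_def mult_single)

lemma homog_gen: "homog (gen_deg g) (gen g)"
  by (simp add: homog_def gen_def ext_alg_single twist_alg_single word_deg_def mult_single ext_scal_hom twist_scal_1)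

lemma homog_cong: "homog k p \<Longrightarrow> 4 dvd k - l \<Longrightarrow> homog l p"
  using tpow_cong by (simp add: homog_def)

lemma homog_mon: "homog (mon_deg w l) (Defs.mon D w l)"
proof (induction w)
  case Nil
  show ?case using homog_gen[of "gen.Idem l"] by simp
next
  case (Cons x w)
  then show ?case
    using homog_mult[OF homog_gen[of "Gen x (l + sum_list (map (wt D) w))"] Cons]
    by (simp add: gen_deg_shift_list)
qed

lemma homog_sc_mult: "hom_scal k c \<Longrightarrow> homog l p \<Longrightarrow> homog (k + l) (sc c * p)"
  by (rule homog_mult[OF homog_sc])

lemma hom_scal_vi: "hom_scal (- dd D i) (vi D i)"
  using hom_scal_powi[OF hom_scal_vK, of "dd D i"] by (simp add: vi_def)

lemma hom_scal_ppii: "hom_scal (2 * dd D i) (ppii D i)"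
  using hom_scal_powi[OF hom_scal_ppi, of "dd D i"] by (simp add: ppii_def)

lemma hom_scal_ppi_power: "hom_scal (2 * int n) (ppi ^ n)"
  by (rule hom_scal_power[OF hom_scal_ppi])

lemma homog_divpow:
  "\<exists>k. homog k (sc (inverse (qfact (vi D i) (ppii D i) n)) * Defs.mon D (replicate n x) l)"
  using homog_sc_mult[OF hom_scal_inverse[OF hom_scal_qfact[OF hom_scal_vi hom_scal_ppii]] homog_mon]
  by blast

text \<open>
  Once the degree \<open>2 p(i) p(j)\<close> of the power of \<open>\<pi>\<close> is included, the two words
  agree modulo 4: for \<open>i \<noteq> j\<close> by \<open>phi_entry_skew\<close>, and for \<open>i =
  j\<close> because their degrees then differ by \<open>2 d\<^sub>i + 2 p(i)\<close>, a multiple of 4. The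
  quantum integer \<open>[n]\<close> has the matching degree \<open>d\<^sub>i (n - 1)\<close>.
\<close>
lemma homog_EF:
  "homog (mon_deg [E i, F j] l)
    (Defs.mon D [E i, F j] l - sc (ppi ^ (par D i * par D j)) * Defs.mon D [F j, E i] l
        - (if i = j then sc (qint (vi D i) (ppii D i) (pairing D (simple_coroot D i) l)) * gen (gen.Idem l)
           else 0))"
proof -
  have "4 dvd mon_deg [E i, F j] l - (2 * int (par D i * par D j) + mon_deg [F j, E i] l)"
  proof (cases "i = j")
    case True
    obtain r where r: "dd D i - int (par D i) = 2 * r" using dd_par by (rule evenE)
    have "int (par D i) * int (par D i) = int (par D i)" by (simp add: par_def)
    then have "mon_deg [E i, F j] l - (2 * int (par D i * par D j) + mon_deg [F j, E i] l) =
      4 * (r - dd D i)"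
      using True r aa_self[of i] by (auto simp: phi_entry_def)
    then show ?thesis by simp
  next
    case False
    then show ?thesis using phi_entry_skew[OF False] by (simp add: algebra_simps)
  qed
  then have "4 dvd (2 * int (par D i * par D j) + mon_deg [F j, E i] l) - mon_deg [E i, F j] l"
    by (subst dvd_diff_commute)
  note 2 = homog_cong[OF homog_sc_mult[OF hom_scal_ppi_power homog_mon] this]
  have 3: "homog (mon_deg [E i, F j] l)
      (sc (qint (vi D i) (ppii D i) (pairing D (simple_coroot D i) l)) * gen (gen.Idem l))" if "i = j"
    using homog_sc_mult[OF hom_scal_qint[OF hom_scal_vi hom_scal_ppii, of i "pairing D (simple_coroot D i) l"]
        homog_gen[of "gen.Idem l"]] that
    by (simp add: phi_entry_def aa_self algebra_simps)
  show ?thesis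
  proof (intro homog_diff homog_mon 2, cases "i = j")
    case True
    show "homog (mon_deg [E i, F j] l)
      (if i = j then sc (qint (vi D i) (ppii D i) (pairing D (simple_coroot D i) l)) * gen (gen.Idem l)
       else 0)"
      unfolding if_P[OF True] by (rule 3[OF True])
  qed (simp only: if_False homog_0)
qed

text \<open>
  In the \<open>k\<close>-th term the word contributes \<open>k (d\<^sub>i a\<^sub>i\<^sub>j + 2 p(i)
  p(j))\<close> modulo 4, the power of \<open>\<pi>\<close> contributes \<open>k (k - 1) p(i) + 2 k p(i)
  p(j)\<close> and the binomial \<open>d\<^sub>i k (1 - a\<^sub>i\<^sub>j - k)\<close>. The sum is \<open>k
  (k - 1) (p(i) - d\<^sub>i)\<close> modulo 4, a product of two even numbers.
\<close>
lemma homog_serre: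
  assumes ij: "i \<noteq> j" and X: "X \<in> {E, F}"
  shows "\<exists>K. homog K (\<Sum>k\<le>bb D i j.
       sc ((- 1) ^ k * ppi ^ ((k choose 2) * par D i + k * par D i * par D j) *
           qbinom (vi D i) (ppii D i) (bb D i j) k) *
       Defs.mon D (replicate (bb D i j - k) (X i) @ [X j] @ replicate k (X i)) l)"
proof -
  let ?b = "bb D i j" and ?x = "X i" and ?y = "X j"
  define K where "K = int ?b * gen_deg (Gen ?x l) + gen_deg (Gen ?y l) +
    int (?b choose 2) * letter_form ?x ?x + int ?b * letter_form ?x ?y"
  have "homog K (sc ((- 1) ^ k * ppi ^ ((k choose 2) * par D i + k * par D i * par D j) *
           qbinom (vi D i) (ppii D i) ?b k) *
       Defs.mon D (replicate (?b - k) ?x @ [?y] @ replicate k ?x) l)" if k: "k \<le> ?b" for k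
  proof -
    let ?m = "(k choose 2) * par D i + k * par D i * par D j"
    have h: "hom_scal (0 + 2 * int ?m + dd D i * (int k * (int ?b - int k)))
      ((- 1) ^ k * ppi ^ ?m * qbinom (vi D i) (ppii D i) ?b k)"
      by (intro hom_scal_mult hom_scal_minus_one_power hom_scal_ppi_power
          hom_scal_qbinom[OF hom_scal_vi hom_scal_ppii k])
    obtain q where q: "phi_entry D i j - phi_entry D j i - dd D i * aa D i j - 2 * int (par D i * par D j) = 4 * q"
      using phi_entry_skew[OF ij] by (rule dvdE)
    obtain r where r: "dd D i - int (par D i) = 2 * r" using dd_par by (rule evenE)
    have lf: "letter_form ?y ?x - letter_form ?x ?y = phi_entry D i j - phi_entry D j i"
      using X dd_aa_sym[of i j] by auto
    have "(0 + 2 * int ?m + dd D i * (int k * (int ?b - int k)) +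
        mon_deg (replicate (?b - k) ?x @ [?y] @ replicate k ?x) l) - K =
      4 * (int k * int (par D i * par D j) + int k * q - int (k choose 2) * r)"
    proof -
      have 1: "2 * int ?m = 2 * int (k choose 2) * int (par D i) + 2 * int k * int (par D i * par D j)"
        by (simp add: algebra_simps)
      have 2: "phi_entry D i j - phi_entry D j i = 4 * q + dd D i * aa D i j + 2 * int (par D i * par D j)"
        using q by simp
      have 3: "dd D i = int (par D i) + 2 * r" using r by simp
      \<comment> \<open>The even number \<open>k (k - 1)\<close> is written as twice a binomial coefficient.\<close>
      have 4: "dd D i * (int k * (int ?b - int k)) = - (dd D i * (2 * int (k choose 2))) - int k * (dd D i * aa D i j)"
        unfolding two_choose_two bb_int[OF ij] by (simp add: algebra_simps)
      have "(0 + 2 * int ?m + dd D i * (int k * (int ?b - int k)) +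
        mon_deg (replicate (?b - k) ?x @ [?y] @ replicate k ?x) l) - K =
        2 * int ?m + dd D i * (int k * (int ?b - int k)) + int k * (phi_entry D i j - phi_entry D j i)"
        unfolding mon_deg_serre[OF k] K_def lf by simp
      also have "\<dots> = 4 * int k * int (par D i * par D j) + 4 * int k * q +
          2 * int (k choose 2) * (int (par D i) - dd D i)"
        unfolding 1 2 4 by (simp add: algebra_simps)
      also have "int (par D i) - dd D i = - 2 * r" using r by simp
      finally show ?thesis by (simp add: algebra_simps)
    qed
    then have "4 dvd (0 + 2 * int ?m + dd D i * (int k * (int ?b - int k)) +
        mon_deg (replicate (?b - k) ?x @ [?y] @ replicate k ?x) l) - K"
      by (metis dvd_triv_left)
    then show ?thesis by (rule homog_cong[OF homog_sc_mult[OF h homog_mon]])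
  qed
  then show ?thesis by (intro exI[of _ K] homog_sum) simp
qed

lemma rels_homog: "r \<in> rels D \<Longrightarrow> \<exists>k. homog k r"
proof (induction rule: rels.induct)
  case (idem l l')
  show ?case
    using homog_mult[OF homog_gen[of "gen.Idem l"] homog_gen[of "gen.Idem l'"]] homog_gen[of "gen.Idem l"] homog_0
    by (intro exI[of _ 0] homog_diff) auto
next
  case (right x l l')
  show ?case
    using homog_mult[OF homog_gen[of "Gen x l"] homog_gen[of "gen.Idem l'"]] homog_gen[of "Gen x l"] homog_0
    by (intro exI[of _ "gen_deg (Gen x l)"] homog_diff) auto
next
  case (left l' x l)
  show ?case
    using homog_mult[OF homog_gen[of "gen.Idem l'"] homog_gen[of "Gen x l"]] homog_gen[of "Gen x l"] homog_0
    by (intro exI[of _ "gen_deg (Gen x l)"] homog_diff) auto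
next
  case (EF i j l)
  show ?case using homog_EF by blast
next
  case (serre i j X l)
  then show ?case by (rule homog_serre)
qed

text \<open>Multiplying a relation by a power of \<open>t\<close> keeps it in the ideal.\<close>
lemma twist_relideal: "n \<in> relideal D \<Longrightarrow> twist_alg (ext_alg n) \<in> relideal_t D"
  unfolding relideal_def
proof (induction rule: group_closure.induct)
  case (base s)
  show ?case
  proof (cases "s = 0")
    case True
    then show ?thesis by (simp add: ext_alg_0 twist_alg_0 add_subgroupD[OF relideal_t_subgroup])
  next
    case False
    with base obtain a r b where s: "s = a * r * b" "r \<in> rels D" by blast
    obtain k where "homog k r" using rels_homog[OF s(2)] by blast
    then have "twist_alg (ext_alg s) =
        twist_alg (ext_alg a) * (scalar (tpow k) * ext_alg r) * twist_alg (ext_alg b)"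
      by (simp only: s(1) ext_alg_mult twist_alg_mult homog_def)
    then show ?thesis
      by (simp only: relideal_t_mult relideal_t_ext[OF rels_relideal[OF s(2)]])
  qed
next
  case (diff s t)
  then show ?case by (simp add: ext_alg_diff twist_alg_diff add_subgroupD[OF relideal_t_subgroup])
qed

lemma twist_relideal_t: "p \<in> relideal_t D \<Longrightarrow> twist_alg p \<in> relideal_t D"
proof -
  assume p: "p \<in> relideal_t D"
  have "twist_alg p = twist_alg (ext_alg (re_alg p)) + scalar (twist_scal root_t) * twist_alg (ext_alg (im_alg p))"
    by (subst alg_decomp[of p]) (simp only: twist_alg_add twist_alg_mult twist_alg_scalar)
  moreover have "re_alg p \<in> relideal D" "im_alg p \<in> relideal D"
    using p by (simp_all add: relideal_t_def)
  ultimately show ?thesis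
    by (simp only: add_subgroupD(4)[OF relideal_t_subgroup] relideal_t_mult twist_relideal)
qed

end

context twist_datum
begin

interpretation U: pi_algebra "dotU D" by (rule dotU_pi_algebra)
interpretation Ut: pi_algebra "adj_t (dotU D)" by (rule U.adj_t_pi_algebra)
interpretation Z: pi_algebra "ZdotU D" by (rule ZdotU_pi_algebra)
interpretation Zt: pi_algebra "adj_t (ZdotU D)" by (rule Z.adj_t_pi_algebra)

abbreviation "U \<equiv> dotU D"
abbreviation "Ut \<equiv> adj_t (dotU D)"
abbreviation "ZU \<equiv> ZdotU D"
abbreviation "ZUt \<equiv> adj_t (ZdotU D)"

section \<open>The twistor\<close>

lemma twist_alg_augmentation: "Poly_Mapping.lookup p 0 = 0 \<Longrightarrow> Poly_Mapping.lookup (twist_alg p) 0 = 0"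
  by (simp add: lookup_twist_alg twist_scal_0)

lemma augmentation_closed:
  fixes p q :: "('i, 'x) freealg_t"
  assumes "Poly_Mapping.lookup p 0 = 0"
  shows "Poly_Mapping.lookup q 0 = 0 \<Longrightarrow> Poly_Mapping.lookup (p + q) 0 = 0"
    "Poly_Mapping.lookup (p * q) 0 = 0" "Poly_Mapping.lookup (scalar c * p) 0 = 0"
  using assms by (simp_all add: lookup_add lookup_mult_word_0 lookup_scalar_mult)

lemma ext_augmentation: "Poly_Mapping.lookup a 0 = 0 \<Longrightarrow> Poly_Mapping.lookup (ext_alg a) 0 = 0"
  by (simp add: lookup_coefficientwise ext_scal_hom)

text \<open>The map that \<open>twist_alg\<close> induces on the quotient.\<close>
definition twist_map :: "(Qvt cov \<times> ('i, 'x) freealg set \<Rightarrow>\<^sub>0 int) set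
    \<Rightarrow> (Qvt cov \<times> ('i, 'x) freealg set \<Rightarrow>\<^sub>0 int) set" where
  "twist_map X = present D (twist_alg (SOME p. Poly_Mapping.lookup p 0 = 0 \<and> X = present D p))"

lemma twist_map_present:
  assumes "Poly_Mapping.lookup p 0 = 0"
  shows "twist_map (present D p) = present D (twist_alg p)"
proof -
  define q where "q = (SOME q. Poly_Mapping.lookup q 0 = 0 \<and> present D p = present D q)"
  have q: "Poly_Mapping.lookup q 0 = 0 \<and> present D p = present D q"
    unfolding q_def by (rule someI[of _ p]) (use assms in simp)
  then have "q - p \<in> relideal_t D" using assms present_eq_iff by metis
  then have "twist_alg q - twist_alg p \<in> relideal_t D"
    using twist_relideal_t twist_alg_diff by metis
  then show ?thesis
    unfolding twist_map_def q_def[symmetric]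
    using q assms by (simp add: present_eq_iff twist_alg_augmentation)
qed

lemma homog_present:
  assumes "Poly_Mapping.lookup a 0 = 0" "homog k a"
  shows "present D (twist_alg (ext_alg a)) = smul Ut (tpow k) (adj_t_el U (cls D a))"
  using assms(2) by (simp add: homog_def present_smul[OF ext_augmentation[OF assms(1)], symmetric]
      flip: present_ext[OF assms(1)])

lemma twist_map_gen:
  "twist_map (adj_t_el U (cls D (gen g))) = smul Ut (tpow (gen_deg g)) (adj_t_el U (cls D (gen g)))"
  using homog_present[OF lookup_gen_0 homog_gen, of g]
    twist_map_present[OF ext_augmentation[OF lookup_gen_0[of g]]]
  by (simp add: present_ext lookup_gen_0)

text \<open>
  Bijectivity comes from \<open>twist_alg_order_4\<close>: the inverse is the third iterate.
\<close>
lemma is_twistor_twist_map: "is_twistor D C twist_map"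
proof -
  have closed: "twist_map X \<in> car Ut" if X: "X \<in> car Ut" for X
  proof -
    obtain p where "Poly_Mapping.lookup p 0 = 0" "X = present D p" using X by (rule present_surj)
    then show ?thesis by (simp add: twist_map_present present_closed twist_alg_augmentation)
  qed
  have order: "twist_map (twist_map (twist_map (twist_map X))) = X" if X: "X \<in> car Ut" for X
  proof -
    obtain p where "Poly_Mapping.lookup p 0 = 0" "X = present D p" using X by (rule present_surj)
    then show ?thesis by (simp add: twist_map_present twist_alg_augmentation twist_alg_order_4)
  qed
  have bij: "bij_betw twist_map (car Ut) (car Ut)"
    by (rule bij_betw_byWitness[where f' = "\<lambda>X. twist_map (twist_map (twist_map X))"])
      (use closed order in auto)
  have add: "twist_map (add Ut X Y) = add Ut (twist_map X) (twist_map Y)"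
    and mul: "twist_map (mul Ut X Y) = mul Ut (twist_map X) (twist_map Y)"
    if X: "X \<in> car Ut" and Y: "Y \<in> car Ut" for X Y
  proof -
    obtain p where p: "Poly_Mapping.lookup p 0 = 0" "X = present D p" using X by (rule present_surj)
    obtain q where q: "Poly_Mapping.lookup q 0 = 0" "Y = present D q" using Y by (rule present_surj)
    show "twist_map (add Ut X Y) = add Ut (twist_map X) (twist_map Y)"
      "twist_map (mul Ut X Y) = mul Ut (twist_map X) (twist_map Y)"
      using p q by (simp_all add: present_add present_mul twist_map_present augmentation_closed
          twist_alg_augmentation twist_alg_add twist_alg_mult)
  qed
  have smul: "twist_map (smul Ut c X) = smul Ut (twist_scal c) (twist_map X)" if X: "X \<in> car Ut" for c X
  proof -
    obtain p where p: "Poly_Mapping.lookup p 0 = 0" "X = present D p" using X by (rule present_surj)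
    then show ?thesis
      by (simp add: present_smul twist_map_present augmentation_closed twist_alg_augmentation
          twist_alg_mult twist_alg_scalar)
  qed
  have "alg_iso (cov_const ` Qt) Ut Ut twist_map"
    unfolding alg_iso_def alg_hom_def
    using closed add mul smul bij by (auto simp: twist_scal_Qt)
  moreover have "smul Ut 1 (adj_t_el U (dotU_one D l)) = adj_t_el U (dotU_one D l)" for l
    by (simp add: Ut.smul_one U.adj_t_el_closed dotU_one_def cls_in_dotU lookup_gen_0)
  ultimately show ?thesis
    unfolding is_twistor_def Let_def
    using twist_map_gen[of "gen.Idem _"] twist_map_gen[of "Gen (E _) _"] twist_map_gen[of "Gen (F _) _"]
    by (simp add: smul twist_scal_ppi twist_scal_vT tT_powi tT_powi[of "- 1", simplified] dotU_one_def dotU_gen_def tpow_0)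
qed

context
  fixes \<Psi>
  assumes \<Psi>: "is_twistor D C \<Psi>"
begin

lemma twistor_iso: "alg_iso (cov_const ` Qt) Ut Ut \<Psi>"
  using \<Psi> by (simp add: is_twistor_def Let_def)

lemma twistor_closed: "X \<in> car Ut \<Longrightarrow> \<Psi> X \<in> car Ut"
  and twistor_add: "X \<in> car Ut \<Longrightarrow> Y \<in> car Ut \<Longrightarrow> \<Psi> (add Ut X Y) = add Ut (\<Psi> X) (\<Psi> Y)"
  and twistor_mul: "X \<in> car Ut \<Longrightarrow> Y \<in> car Ut \<Longrightarrow> \<Psi> (mul Ut X Y) = mul Ut (\<Psi> X) (\<Psi> Y)"
  using twistor_iso by (simp_all add: alg_iso_def alg_hom_def)

lemma scal_Ut: "c \<in> scal Ut"
  by (simp add: U.scal_adj_t Rt_UNIV)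

text \<open>
  A twistor is prescribed only on multiples by \<open>\<rat>(t)\<close>, \<open>\<pi>\<close> and
  \<open>v\<close>, but the scalars on which it is semilinear are closed under sums, products and inverses.
\<close>
lemma twistor_smul:
  assumes X: "X \<in> car Ut" shows "\<Psi> (smul Ut c X) = smul Ut (twist_scal c) (\<Psi> X)"
proof -
  let ?S = "{c. \<forall>X\<in>car Ut. \<Psi> (smul Ut c X) = smul Ut (twist_scal c) (\<Psi> X)}"
  have "c \<in> ?S"
  proof (rule scal_generated)
    fix c d assume c: "c \<in> ?S" and d: "d \<in> ?S"
    show "c + d \<in> ?S"
      using c d by (simp add: Ut.smul_add_left scal_Ut twistor_add Ut.smul_closed twistor_closed twist_scal_add)
    have "\<Psi> (smul Ut (c * d) X) = smul Ut (twist_scal (c * d)) (\<Psi> X)" if X: "X \<in> car Ut" for X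
    proof -
      have dX: "smul Ut d X \<in> car Ut" using X by (simp add: Ut.smul_closed scal_Ut)
      have "\<Psi> (smul Ut (c * d) X) = \<Psi> (smul Ut c (smul Ut d X))"
        using X by (simp add: Ut.smul_smul scal_Ut)
      also have "\<dots> = smul Ut (twist_scal c) (\<Psi> (smul Ut d X))" using c dX by blast
      also have "\<dots> = smul Ut (twist_scal c) (smul Ut (twist_scal d) (\<Psi> X))" using d X by auto
      finally show ?thesis
        using X by (simp add: scal_Ut Ut.smul_smul twistor_closed twist_scal_mult)
    qed
    then show "c * d \<in> ?S" by blast
  next
    fix c d assume c: "c \<in> ?S" and cd: "c * d = 1"
    have tcd: "twist_scal d * twist_scal c = 1"
      using cd by (metis twist_scal_mult twist_scal_1 mult.commute)
    have "\<Psi> (smul Ut d X) = smul Ut (twist_scal d) (\<Psi> X)" if X: "X \<in> car Ut" for X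
    proof -
      have dX: "smul Ut d X \<in> car Ut" using X by (simp add: Ut.smul_closed scal_Ut)
      have "\<Psi> X = \<Psi> (smul Ut c (smul Ut d X))"
        using X by (simp add: Ut.smul_smul scal_Ut cd Ut.smul_one)
      also have "\<dots> = smul Ut (twist_scal c) (\<Psi> (smul Ut d X))" using c dX by blast
      finally have "smul Ut (twist_scal d) (\<Psi> X) = smul Ut (twist_scal d * twist_scal c) (\<Psi> (smul Ut d X))"
        using dX by (simp add: Ut.smul_smul scal_Ut twistor_closed)
      then show ?thesis using dX by (simp add: tcd Ut.smul_one twistor_closed)
    qed
    then show "d \<in> ?S" by blast
  next
    show "cov_const ` Qt \<subseteq> ?S"
      using twistor_iso by (auto simp: alg_iso_def alg_hom_def twist_scal_Qt)
    show "ppi \<in> ?S" "vT \<in> ?S"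
      using \<Psi> by (simp_all add: is_twistor_def Let_def twist_scal_ppi twist_scal_vT tT_powi[of "- 1", simplified])
  qed
  with X show ?thesis by blast
qed

lemma twistor_gen: "\<Psi> (present D (ext_alg (gen g))) = present D (twist_alg (ext_alg (gen g)))"
proof -
  have "\<Psi> (adj_t_el U (cls D (gen g))) = smul Ut (tpow (gen_deg g)) (adj_t_el U (cls D (gen g)))"
  proof (cases g)
    case (Idem l)
    have "smul Ut 1 (adj_t_el U (cls D (gen g))) = adj_t_el U (cls D (gen g))"
      by (simp add: Ut.smul_one U.adj_t_el_closed cls_in_dotU lookup_gen_0)
    then show ?thesis
      using \<Psi> Idem by (simp add: is_twistor_def Let_def dotU_one_def tpow_0)
  next
    case (Gen x l)
    then show ?thesis
      using \<Psi> by (cases x) (simp_all add: is_twistor_def Let_def dotU_gen_def tT_powi)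
  qed
  then show ?thesis
    using homog_present[OF lookup_gen_0 homog_gen, of g] by (simp add: present_ext lookup_gen_0)
qed

text \<open>
  Hence a twistor is unique on the carrier: it is semilinear and multiplicative, and nonempty words in the
  generators span.
\<close>
lemma twistor_present:
  assumes "Poly_Mapping.lookup p 0 = 0"
  shows "\<Psi> (present D p) = present D (twist_alg p)"
proof -
  have g: "ext_alg (gen g) = (Poly_Mapping.single (Word [g]) 1 :: ('i, 'x) freealg_t)" for g
    by (simp add: gen_def ext_alg_single ext_scal_hom)
  have nz: "Poly_Mapping.lookup (Poly_Mapping.single (Word (g # gs)) c) 0 = 0" for g gs and c :: "Qvt cov"
    by (simp add: lookup_single zero_word_def)
  have word: "\<Psi> (present D (Poly_Mapping.single (Word (g # gs)) 1)) =
      present D (twist_alg (Poly_Mapping.single (Word (g # gs)) 1))" for g gs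
  proof (induction gs arbitrary: g)
    case Nil
    show ?case using twistor_gen[of g] by (simp add: g)
  next
    case (Cons h gs)
    have s: "(Poly_Mapping.single (Word (g # h # gs)) 1 :: ('i, 'x) freealg_t) =
      Poly_Mapping.single (Word [g]) 1 * Poly_Mapping.single (Word (h # gs)) 1"
      by (simp add: mult_single plus_word_def)
    show ?case
      unfolding s
      using twistor_gen[of g] Cons[of h]
      by (simp add: g nz twistor_mul present_closed twist_alg_mult twist_alg_augmentation flip: present_mul)
  qed
  have "Poly_Mapping.keys p \<subseteq> - {0}" using assms by (auto simp: in_keys_iff)
  then show ?thesis
  proof (induction p rule: poly_mapping_induct)
    case zero
    have "present D 0 = present D (scalar 0 * 0)" by simp
    also have "\<dots> = nzero Ut"
      by (subst present_smul[symmetric]) (simp_all add: Ut.smul_zero present_closed)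
    finally have z: "present D 0 = nzero Ut" .
    show ?case
      using twistor_smul[OF Ut.nzero_closed, of 0]
      by (simp add: twist_alg_0 z twist_scal_0 Ut.smul_zero Ut.nzero_closed twistor_closed)
  next
    case (single w c)
    then obtain g gs where w: "w = Word (g # gs)"
      by (cases w) (metis ComplD insertI1 list.exhaust zero_word_def)
    have s: "Poly_Mapping.single w c = scalar c * Poly_Mapping.single w 1"
      by (simp add: mult_single)
    have "\<Psi> (present D (scalar c * Poly_Mapping.single w 1)) =
        smul Ut (twist_scal c) (\<Psi> (present D (Poly_Mapping.single w 1)))"
      unfolding w present_smul[OF nz, symmetric] by (rule twistor_smul[OF present_closed[OF nz]])
    also have "\<dots> = present D (scalar (twist_scal c) * twist_alg (Poly_Mapping.single w 1))"
      unfolding w word by (rule present_smul[OF twist_alg_augmentation[OF nz]])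
    finally show ?case
      unfolding s by (simp only: twist_alg_mult twist_alg_scalar)
  next
    case (add p q)
    then have "Poly_Mapping.lookup p 0 = 0" "Poly_Mapping.lookup q 0 = 0"
      by (auto simp: in_keys_iff)
    then show ?case
      using add by (simp add: twistor_add present_closed twist_alg_add twist_alg_augmentation flip: present_add)
  qed
qed

lemma twistor_order_4: "X \<in> car Ut \<Longrightarrow> \<Psi> (\<Psi> (\<Psi> (\<Psi> X))) = X"
proof -
  assume "X \<in> car Ut"
  then obtain p where "Poly_Mapping.lookup p 0 = 0" "X = present D p" by (rule present_surj)
  then show ?thesis by (simp add: twistor_present twist_alg_augmentation twist_alg_order_4)
qed

section \<open>The integral form\<close>

lemma ZdotU_ops: "add ZU = add U" "mul ZU = mul U" "smul ZU = smul U" "car ZU = intform D"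
  by (simp_all add: ZdotU_def)

lemma intform_car: "m \<in> intform D \<Longrightarrow> m \<in> car U"
  by (rule intform_dotU)

abbreviation "incl \<equiv> adj_t_incl U"

text \<open>
  The operations of the integral form are restrictions, so its tensor relations are among those of the full
  algebra.
\<close>
lemma incl_coset:
  "incl (acoset (tens_rel (cov_ring (gau_ring (pi_free ZU))) ext_scal ZU) x) =
   acoset (tens_rel (cov_ring (gau_ring (pi_free U))) ext_scal U) x"
proof -
  let ?NZ = "tens_rel (cov_ring (gau_ring (pi_free ZU))) ext_scal ZU"
  let ?N = "tens_rel (cov_ring (gau_ring (pi_free U))) ext_scal U"
  interpret A: base_change_setting U "cov_ring (gau_ring (pi_free U))" ext_scal
    by (rule U.adj_t_setting)
  interpret AZ: base_change_setting ZU "cov_ring (gau_ring (pi_free ZU))" ext_scal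
    by (rule Z.adj_t_setting)
  have "y \<in> ?N" if "y \<in> ?NZ" for y
    using that
  proof (induction rule: AZ.tens_rel_induct)
    case (diff x y)
    then show ?case by (simp add: add_subgroupD[OF A.N_subgroup])
  next
    case (left a b m)
    then show ?case using A.tens_rel_intros(1)[of a b m]
      by (simp add: Rt_UNIV ZdotU_ops intform_car)
  next
    case (right a m n)
    then show ?case using A.tens_rel_intros(2)[of a m n]
      by (simp add: Rt_UNIV ZdotU_ops intform_car)
  next
    case (balanced a s m)
    then show ?case using A.tens_rel_intros(3)[of a s m]
      by (simp add: Rt_UNIV ZdotU_ops intform_car scal_dotU(1))
  qed (simp add: add_subgroupD[OF A.N_subgroup])
  then show ?thesis
    unfolding adj_t_incl_def by (intro acoset_lift_acoset A.N_subgroup AZ.N_subgroup) simp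
qed

lemma incl_gpair: "m \<in> intform D \<Longrightarrow> n \<in> intform D \<Longrightarrow> incl (Z.gpair m n) = U.gpair m n"
  by (simp add: Z.gpair_eq_coset U.gpair_eq_coset ZdotU_ops intform_car incl_coset)

lemma incl_el: "incl (adj_t_el ZU u) = adj_t_el U u"
  by (simp add: adj_t_el_def tens_def incl_coset)

lemma ZUt_cases:
  assumes "X \<in> car ZUt" obtains m n where "m \<in> intform D" "n \<in> intform D" "X = Z.gpair m n"
  using assms by (rule Z.gpair_surj) (simp add: ZdotU_ops that)

lemma intform_closed:
  "m \<in> intform D \<Longrightarrow> n \<in> intform D \<Longrightarrow> add U m n \<in> intform D"
  "m \<in> intform D \<Longrightarrow> n \<in> intform D \<Longrightarrow> mul U m n \<in> intform D"
  "c \<in> cov_ring Zv \<Longrightarrow> n \<in> intform D \<Longrightarrow> smul U c n \<in> intform D"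
  by (rule intform.intros; assumption)+

lemma scal_ZUt: "scal ZUt = cov_ring (gau_ring Zv)"
  by (simp add: Z.scal_adj_t scal_ZdotU)

lemma incl_closed: "X \<in> car ZUt \<Longrightarrow> incl X \<in> car Ut"
  by (erule ZUt_cases) (simp add: incl_gpair U.gpair_closed intform_car)

text \<open>
  The inclusion sends \<open>m + t n\<close> to \<open>m + t n\<close>, and these expressions are unique on
  both sides.
\<close>
lemma incl_inject: "X \<in> car ZUt \<Longrightarrow> Y \<in> car ZUt \<Longrightarrow> incl X = incl Y \<longleftrightarrow> X = Y"
  by (erule ZUt_cases, erule ZUt_cases)
    (simp add: incl_gpair U.gpair_inject Z.gpair_inject ZdotU_ops intform_car)

lemma incl_add: "X \<in> car ZUt \<Longrightarrow> Y \<in> car ZUt \<Longrightarrow> incl (add ZUt X Y) = add Ut (incl X) (incl Y)"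
  by (erule ZUt_cases, erule ZUt_cases)
    (simp add: incl_gpair U.gpair_add Z.gpair_add ZdotU_ops intform_car intform_closed)

lemma minus_one_Zv: "- 1 \<in> cov_ring Zv"
  by (simp add: mem_cov_ring Zv_0_1 Zv_uminus)

lemma incl_mul: "X \<in> car ZUt \<Longrightarrow> Y \<in> car ZUt \<Longrightarrow> incl (mul ZUt X Y) = mul Ut (incl X) (incl Y)"
  by (erule ZUt_cases, erule ZUt_cases)
    (simp add: incl_gpair U.gpair_mul Z.gpair_mul ZdotU_ops intform_car intform_closed minus_one_Zv)

lemma incl_smul:
  assumes c: "c \<in> cov_ring (gau_ring Zv)" and X: "X \<in> car ZUt"
  shows "incl (smul ZUt c X) = smul Ut c (incl X)"
proof -
  have "re_scal c \<in> cov_ring Zv" "im_scal c \<in> cov_ring Zv" "- im_scal c \<in> cov_ring Zv"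
    using c by (auto simp: mem_cov_ring mem_gau_ring Zv_uminus)
  moreover obtain m n where "m \<in> intform D" "n \<in> intform D" "X = Z.gpair m n"
    using X by (rule ZUt_cases)
  ultimately show ?thesis
    using c by (simp add: incl_gpair U.gpair_smul Z.gpair_smul ZdotU_ops intform_car intform_closed
        Rt_UNIV scal_ZdotU)
qed

text \<open>
  The generators of the integral form are homogeneous, hence multiplied by powers of \<open>t\<close>, and
  the scalar twist preserves \<open>\<int>[v,v\<^sup>-\<^sup>1,t]\<^sup>\<pi>\<close>.
\<close>
lemma twistor_integral_el: "u \<in> intform D \<Longrightarrow> \<Psi> (adj_t_el U u) \<in> incl ` car ZUt"
proof (induction rule: intform.induct)
  have W: "smul Ut (tpow k) (adj_t_el U u) \<in> incl ` car ZUt" if "u \<in> intform D" for k u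
  proof -
    have el: "adj_t_el ZU u \<in> car ZUt" using that by (simp add: Z.adj_t_el_closed ZdotU_ops)
    then have "smul ZUt (tpow k) (adj_t_el ZU u) \<in> car ZUt"
      by (simp add: Zt.smul_closed scal_ZUt tpow_integral)
    moreover have "incl (smul ZUt (tpow k) (adj_t_el ZU u)) = smul Ut (tpow k) (adj_t_el U u)"
      by (simp add: incl_smul tpow_integral el incl_el)
    ultimately show ?thesis by (metis imageI)
  qed
  have hom: "\<Psi> (adj_t_el U (cls D a)) \<in> incl ` car ZUt"
    if a: "Poly_Mapping.lookup a 0 = 0" "homog k a" "cls D a \<in> intform D" for k a
  proof -
    have "\<Psi> (adj_t_el U (cls D a)) = smul Ut (tpow k) (adj_t_el U (cls D a))"
      using twistor_present[OF ext_augmentation[OF a(1)]] homog_present[OF a(1,2)] a(1)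
      by (simp add: present_ext)
    then show ?thesis using W[OF a(3)] by simp
  qed
  show "\<Psi> (adj_t_el U (dotU_one D l)) \<in> incl ` car ZUt" for l
    unfolding dotU_one_def
    by (rule hom[OF lookup_gen_0 homog_gen]) (use intform.intros(1)[of D l] in \<open>simp add: dotU_one_def\<close>)
  show "\<Psi> (adj_t_el U (divpow D X i n l)) \<in> incl ` car ZUt" if "1 \<le> n" "X \<in> {E, F}" for n X i l
  proof -
    obtain k where "homog k (sc (inverse (qfact (vi D i) (ppii D i) n)) * Defs.mon D (replicate n (X i)) l)"
      using homog_divpow by blast
    from hom[OF _ this] show ?thesis
      using intform.intros(2)[OF that, of D i l] by (simp add: divpow_def lookup_sc_mult lookup_mon_0)
  qed
next
  case (3 x y)
  then obtain X Y where XY: "X \<in> car ZUt" "Y \<in> car ZUt" "\<Psi> (adj_t_el U x) = incl X" "\<Psi> (adj_t_el U y) = incl Y"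
    by blast
  have "\<Psi> (adj_t_el U (add U x y)) = incl (add ZUt X Y)"
    using 3 XY by (simp add: U.adj_t_el_add intform_car twistor_add U.adj_t_el_closed incl_add)
  then show ?case using XY Zt.add_closed by blast
next
  case (4 x y)
  then obtain X Y where XY: "X \<in> car ZUt" "Y \<in> car ZUt" "\<Psi> (adj_t_el U x) = incl X" "\<Psi> (adj_t_el U y) = incl Y"
    by blast
  have "\<Psi> (adj_t_el U (mul U x y)) = incl (mul ZUt X Y)"
    using 4 XY by (simp add: U.adj_t_el_mul intform_car twistor_mul U.adj_t_el_closed incl_mul)
  then show ?case using XY Zt.mul_closed by blast
next
  case (5 c x)
  then obtain X where X: "X \<in> car ZUt" "\<Psi> (adj_t_el U x) = incl X" by blast
  have c: "twist_scal (ext_scal c) \<in> cov_ring (gau_ring Zv)"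
    using 5(1) by (intro twist_scal_integral) (auto simp: mem_cov_ring mem_gau_ring Zv_0_1)
  have "\<Psi> (adj_t_el U (smul U c x)) = incl (smul ZUt (twist_scal (ext_scal c)) X)"
    using 5 X c by (simp add: U.adj_t_el_smul intform_car twistor_smul U.adj_t_el_closed incl_smul scal_dotU)
  moreover have "smul ZUt (twist_scal (ext_scal c)) X \<in> car ZUt"
    using X c by (simp add: Zt.smul_closed scal_ZUt)
  ultimately show ?case by blast
qed

lemma twistor_integral: "X \<in> car ZUt \<Longrightarrow> \<Psi> (incl X) \<in> incl ` car ZUt"
proof -
  assume "X \<in> car ZUt"
  then obtain m n where mn: "m \<in> intform D" "n \<in> intform D" "X = Z.gpair m n" by (rule ZUt_cases)
  from twistor_integral_el[OF mn(1)] twistor_integral_el[OF mn(2)] obtain Y Y' where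
    Y: "Y \<in> car ZUt" "Y' \<in> car ZUt" "\<Psi> (adj_t_el U m) = incl Y" "\<Psi> (adj_t_el U n) = incl Y'"
    by (elim imageE)
  have t: "root_t \<in> cov_ring (gau_ring Zv)" "twist_scal root_t = root_t"
    using tpow_integral[of 1] twist_scal_tpow[of 1] by (simp_all add: tpow_1)
  have el: "adj_t_el U m \<in> car Ut" "adj_t_el U n \<in> car Ut"
    using mn by (simp_all add: U.adj_t_el_closed intform_car)
  have rY: "smul ZUt root_t Y' \<in> car ZUt"
    using Y(2) t(1) by (simp add: Zt.smul_closed scal_ZUt)
  have "incl X = add Ut (adj_t_el U m) (smul Ut root_t (adj_t_el U n))"
    unfolding mn(3) incl_gpair[OF mn(1,2)] by (rule U.gpair_def)
  then have "\<Psi> (incl X) = add Ut (\<Psi> (adj_t_el U m)) (smul Ut root_t (\<Psi> (adj_t_el U n)))"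
    by (simp only: twistor_add[OF el(1) U.smul_root_closed[OF el(2)]] twistor_smul[OF el(2)] t(2))
  also have "\<dots> = incl (add ZUt Y (smul ZUt root_t Y'))"
    by (simp only: Y(3,4) incl_add[OF Y(1) rY] incl_smul[OF t(1) Y(2)])
  finally show ?thesis
    using Zt.add_closed[OF Y(1) rY] by blast
qed

text \<open>
  The fourth power of the twistor is the identity, so preserving the image of the integral form implies
  mapping it onto itself.
\<close>
lemma integral_twist:
  obtains \<psi> where "bij_betw \<psi> (car ZUt) (car ZUt)" "\<And>X. X \<in> car ZUt \<Longrightarrow> incl (\<psi> X) = \<Psi> (incl X)"
proof -
  define \<psi> where "\<psi> X = inv_into (car ZUt) incl (\<Psi> (incl X))" for X
  have \<psi>: "\<psi> X \<in> car ZUt" "incl (\<psi> X) = \<Psi> (incl X)" if "X \<in> car ZUt" for X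
    unfolding \<psi>_def using twistor_integral[OF that] by (rule inv_into_into, rule f_inv_into_f)
  have order: "\<psi> (\<psi> (\<psi> (\<psi> X))) = X" if "X \<in> car ZUt" for X
  proof -
    have "incl (\<psi> (\<psi> (\<psi> (\<psi> X)))) = incl X"
      using that by (simp add: \<psi> twistor_order_4 incl_closed)
    then show ?thesis by (simp add: incl_inject \<psi>(1) that)
  qed
  have "bij_betw \<psi> (car ZUt) (car ZUt)"
    by (rule bij_betw_byWitness[where f' = "\<lambda>X. \<psi> (\<psi> (\<psi> X))"]) (use \<psi>(1) order in auto)
  then show ?thesis using \<psi>(2) by (rule that)
qed

lemma twistor_specialization:
  "\<exists>\<Theta> \<Theta>Z.
    alg_iso Qt (spec 1 Ut) (spec (- 1) Ut) \<Theta> \<and>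
    (\<forall>x\<in>car Ut. \<Theta> (spec_el 1 Ut x) = spec_el (- 1) Ut (\<Psi> x)) \<and>
    alg_iso Zt (spec 1 ZUt) (spec (- 1) ZUt) \<Theta>Z \<and>
    (\<forall>x\<in>car ZUt. \<exists>y\<in>car ZUt. incl y = \<Psi> (incl x) \<and>
       \<Theta>Z (spec_el 1 ZUt x) = spec_el (- 1) ZUt y)"
proof -
  have bij: "bij_betw \<Psi> (car Ut) (car Ut)" using twistor_iso by (simp add: alg_iso_def)
  have free: "pi_free Ut = UNIV" by (auto simp: U.pi_free_adj_t scal_dotU mem_gau_ring)
  have pi: "\<Psi> (smul Ut ppi X) = smul Ut (- ppi) (\<Psi> X)" if "X \<in> car Ut" for X
    using twistor_smul[OF that, of ppi] by (simp only: twist_scal_ppi)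
  have const: "\<Psi> (smul Ut (cov_const c) X) = smul Ut (cov_const c) (\<Psi> X)"
    if "c \<in> Qt" "X \<in> car Ut" for c X
    using twistor_smul[OF that(2), of "cov_const c"] by (simp only: twist_scal_Qt[OF that(1)])
  have Qt: "Qt \<subseteq> pi_free Ut" "- 1 \<in> Qt" by (simp_all add: free Qt_simps)
  obtain \<Theta> where \<Theta>: "alg_iso Qt (spec 1 Ut) (spec (- 1) Ut) \<Theta>"
    "\<And>x. x \<in> car Ut \<Longrightarrow> \<Theta> (spec_el 1 Ut x) = spec_el (- 1) Ut (\<Psi> x)"
    using Ut.spec_twist[OF bij twistor_add twistor_mul pi Qt const] by metis
  obtain \<psi> where \<psi>: "bij_betw \<psi> (car ZUt) (car ZUt)" "\<And>X. X \<in> car ZUt \<Longrightarrow> incl (\<psi> X) = \<Psi> (incl X)"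
    using integral_twist by metis
  have \<psi>c: "\<psi> X \<in> car ZUt" if "X \<in> car ZUt" for X
    using \<psi>(1) that by (auto simp: bij_betw_def)
  have sem: "\<psi> (smul ZUt c X) = smul ZUt (twist_scal c) (\<psi> X)"
    if "c \<in> cov_ring (gau_ring Zv)" "X \<in> car ZUt" for c X
    using that twist_scal_integral[OF that(1)]
    by (subst incl_inject[symmetric])
      (simp_all add: \<psi> \<psi>c Zt.smul_closed scal_ZUt incl_smul twistor_smul incl_closed)
  have Zt: "Zt \<subseteq> gau_ring Zv" "- 1 \<in> Zt" "Zt \<subseteq> Qt"
  proof -
    show "Zt \<subseteq> gau_ring Zv" by (auto simp: Zt_def mem_gau_ring Zv_of_int)
    have "(- 1 :: Qv) \<in> range of_int" "(0 :: Qv) \<in> range of_int"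
      using rangeI[of of_int "- 1"] rangeI[of of_int 0] by simp_all
    then show "- 1 \<in> Zt" by (simp add: Zt_def mem_gau_ring)
    have "of_int a \<in> range ofQ" for a
      unfolding ofQ_of_int[symmetric] by (rule rangeI)
    then show "Zt \<subseteq> Qt" by (auto simp: Zt_def Qt_def mem_gau_ring)
  qed
  have free_Z: "pi_free ZUt = gau_ring Zv" by (simp add: Z.pi_free_adj_t scal_ZdotU)
  have ppi: "ppi \<in> cov_ring (gau_ring Zv)" by (simp add: mem_cov_ring mem_gau_ring Zv_0_1)
  have cc: "cov_const c \<in> cov_ring (gau_ring Zv)" if "c \<in> Zt" for c
    using that Zt(1) by (auto simp: mem_cov_ring mem_gau_ring Zv_0_1)
  have add: "\<psi> (add ZUt X Y) = add ZUt (\<psi> X) (\<psi> Y)"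
    and mul: "\<psi> (mul ZUt X Y) = mul ZUt (\<psi> X) (\<psi> Y)"
    if XY: "X \<in> car ZUt" "Y \<in> car ZUt" for X Y
  proof -
    show "\<psi> (add ZUt X Y) = add ZUt (\<psi> X) (\<psi> Y)"
      using XY by (subst incl_inject[symmetric])
        (simp_all add: \<psi> \<psi>c Zt.add_closed incl_add twistor_add incl_closed)
    show "\<psi> (mul ZUt X Y) = mul ZUt (\<psi> X) (\<psi> Y)"
      using XY by (subst incl_inject[symmetric])
        (simp_all add: \<psi> \<psi>c Zt.mul_closed incl_mul twistor_mul incl_closed)
  qed
  have piZ: "\<psi> (smul ZUt ppi X) = smul ZUt (- ppi) (\<psi> X)" if "X \<in> car ZUt" for X
    using sem[OF ppi that] by (simp only: twist_scal_ppi)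
  have constZ: "\<psi> (smul ZUt (cov_const c) X) = smul ZUt (cov_const c) (\<psi> X)"
    if "c \<in> Zt" "X \<in> car ZUt" for c X
    using sem[OF cc[OF that(1)] that(2)] twist_scal_Qt[OF subsetD[OF Zt(3) that(1)]] by (simp only:)
  obtain \<Theta>Z where \<Theta>Z: "alg_iso Zt (spec 1 ZUt) (spec (- 1) ZUt) \<Theta>Z"
    "\<And>x. x \<in> car ZUt \<Longrightarrow> \<Theta>Z (spec_el 1 ZUt x) = spec_el (- 1) ZUt (\<psi> x)"
    using Zt.spec_twist[OF \<psi>(1) add mul piZ Zt(1)[folded free_Z] Zt(2) constZ] by metis
  have 1: "\<forall>x\<in>car Ut. \<Theta> (spec_el 1 Ut x) = spec_el (- 1) Ut (\<Psi> x)"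
    using \<Theta>(2) by (rule ballI)
  have 2: "\<forall>x\<in>car ZUt. \<exists>y\<in>car ZUt. incl y = \<Psi> (incl x) \<and> \<Theta>Z (spec_el 1 ZUt x) = spec_el (- 1) ZUt y"
  proof
    fix X assume X: "X \<in> car ZUt"
    show "\<exists>y\<in>car ZUt. incl y = \<Psi> (incl X) \<and> \<Theta>Z (spec_el 1 ZUt X) = spec_el (- 1) ZUt y"
      by (rule bexI[of _ "\<psi> X"]) (simp_all only: \<psi>(2)[OF X] \<Theta>Z(2)[OF X] \<psi>c[OF X] simp_thms)
  qed
  show ?thesis
    by (rule exI[of _ \<Theta>], rule exI[of _ \<Theta>Z]) (rule conjI \<Theta>(1) 1 \<Theta>Z(1) 2)+
qed

end

lemma is_twistor_twistor: "is_twistor D C (twistor D C)"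
  unfolding twistor_def by (rule someI[of _ twist_map]) (rule is_twistor_twist_map)

end

theorem theorem4p4:
  fixes D :: "('i::{finite,linorder}, 'x::ab_group_add, 'y::ab_group_add) root_datum"
    and C :: "'x set"
  assumes "super_root_datum D" and "transversal D C"
  defines "U \<equiv> dotU D" and "ZU \<equiv> ZdotU D"
  defines "Ut \<equiv> adj_t U" and "ZUt \<equiv> adj_t ZU"
  shows "\<exists>\<Theta> \<Theta>Z.
    alg_iso Qt (spec 1 Ut) (spec (- 1) Ut) \<Theta> \<and>
    (\<forall>x\<in>car Ut. \<Theta> (spec_el 1 Ut x) = spec_el (- 1) Ut (twistor D C x)) \<and>
    alg_iso Zt (spec 1 ZUt) (spec (- 1) ZUt) \<Theta>Z \<and>
    (\<forall>x\<in>car ZUt. \<exists>y\<in>car ZUt. adj_t_incl U y = twistor D C (adj_t_incl U x) \<and>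
       \<Theta>Z (spec_el 1 ZUt x) = spec_el (- 1) ZUt y) \<and>
    (\<exists>e. alg_emb (range ofQ) of_base (spec 1 U) (spec (- 1) Ut) e \<and>
       (\<forall>u\<in>car U. e (spec_el 1 U u) = \<Theta> (spec_el 1 Ut (adj_t_el U u)))) \<and>
    (\<exists>e. alg_emb (range ofQ) of_base (spec (- 1) U) (spec 1 Ut) e \<and>
       (\<forall>u\<in>car U. \<Theta> (e (spec_el (- 1) U u)) = spec_el (- 1) Ut (adj_t_el U u))) \<and>
    (\<exists>e. alg_emb (range of_int) of_base (spec 1 ZU) (spec (- 1) ZUt) e \<and>
       (\<forall>u\<in>car ZU. e (spec_el 1 ZU u) = \<Theta>Z (spec_el 1 ZUt (adj_t_el ZU u)))) \<and>
    (\<exists>e. alg_emb (range of_int) of_base (spec (- 1) ZU) (spec 1 ZUt) e \<and>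
       (\<forall>u\<in>car ZU. \<Theta>Z (e (spec_el (- 1) ZU u)) = spec_el (- 1) ZUt (adj_t_el ZU u)))"
proof -
  interpret twist_datum D C by unfold_locales (fact assms)+
  interpret U: pi_algebra "dotU D" by (rule dotU_pi_algebra)
  interpret Z: pi_algebra "ZdotU D" by (rule ZdotU_pi_algebra)
  obtain \<Theta> \<Theta>Z where 1: "alg_iso Qt (spec 1 Ut) (spec (- 1) Ut) \<Theta>"
    "\<forall>x\<in>car Ut. \<Theta> (spec_el 1 Ut x) = spec_el (- 1) Ut (twistor D C x)"
    "alg_iso Zt (spec 1 ZUt) (spec (- 1) ZUt) \<Theta>Z"
    "\<forall>x\<in>car ZUt. \<exists>y\<in>car ZUt. adj_t_incl U y = twistor D C (adj_t_incl U x) \<and>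
       \<Theta>Z (spec_el 1 ZUt x) = spec_el (- 1) ZUt y"
    using twistor_specialization[OF is_twistor_twistor]
    unfolding U_def ZU_def Ut_def ZUt_def by blast
  have Q: "Qt \<subseteq> pi_free (adj_t (dotU D))" "range ofQ \<subseteq> pi_free (dotU D)" "of_base ` range ofQ \<subseteq> Qt"
    by (auto simp: U.pi_free_adj_t scal_dotU mem_gau_ring Qt_def simp flip: ofQ_hom(3))
  have "of_base (of_int k) \<in> Zt" for k
    using rangeI[of of_int 0] by (simp add: Zt_def mem_gau_ring)
  then have Z: "Zt \<subseteq> pi_free (adj_t (ZdotU D))" "range of_int \<subseteq> pi_free (ZdotU D)" "of_base ` range of_int \<subseteq> Zt"
    by (auto simp: Z.pi_free_adj_t scal_ZdotU mem_gau_ring Zt_def Zv_of_int)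
  show ?thesis
    by (intro exI[of _ \<Theta>] exI[of _ \<Theta>Z] conjI 1)
      (use U.spec_twist_embeddings[OF 1(1)[unfolded Ut_def U_def] Q]
        Z.spec_twist_embeddings[OF 1(3)[unfolded ZUt_def ZU_def] Z] in
        \<open>simp_all only: U_def ZU_def Ut_def ZUt_def\<close>)
qed

end
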